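(* Let $d\ge2$, $2\le p<\infty$, and let $\omega_{\varepsilon,\eta}=\mathbb{R}^d\setminus\bigcup_{k\in\mathbb{Z}^d}\varepsilon(k+\eta T)$ be a periodically perforated domain with hole $T$ as in the context, $\varepsilon,\eta\in(0,1]$. Let $$C_p(\varepsilon,\eta)=\sup\|u\|_{L^p(\omega_{\varepsilon,\eta})},$$ where the supremum is over all weak solutions $u\in W^{1,2}_0(\omega_{\varepsilon,\eta})$ of $-\Delta u=\mathrm{div}(f)$ in $\omega_{\varepsilon,\eta}$ with $f\in L^p(\omega_{\varepsilon,\eta};\mathbb{R}^d)\cap L^2(\omega_{\varepsilon,\eta};\mathbb{R}^d)$ and $\|f\|_{L^p(\omega_{\varepsilon,\eta})}=1$. Then, for $d\ge3$, $$c\,\varepsilon\eta^{\frac{2-d}2}\le C_p(\varepsilon,\eta)\le C\,\varepsilon\eta^{\frac{2-d}2},$$ and for $d=2$, $$c\,\varepsilon|\ln(\eta/2)|^{\frac12}\le C_p(\varepsilon,\eta)\le C\,\varepsilon|\ln(\eta/2)|^{\frac12},$$ where $C,c>0$ depend only on $d$, $p$ and $T$.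
   Context: $Y=[-1/2,1/2]^d$. The hole $T$ is the closure of a bounded Lipschitz subdomain of $Y$ such that $Y\setminus T$ is connected, $B(0,c_0)\subset T$ and $\mathrm{dist}(\partial T,\partial Y)\ge c_0$ for some $c_0>0$. $W^{1,2}_0(\Omega)$ is the completion of $C_0^\infty(\Omega)$ with respect to the norm $\|\nabla\psi\|_{L^2(\Omega)}$; a weak solution of $-\Delta u=\mathrm{div}(f)$ satisfies $\int\nabla u\cdot\nabla\phi=-\int f\cdot\nabla\phi$ for all $\phi\in C_0^\infty$. *)

theory Defs
  imports "HOL-Analysis.Analysis"
begin

subsection \<open>Perforated domains\<close>

text \<open>Near each boundary point the set is, in suitable orthonormal coordinates, the region strictly
  above the graph of a Lipschitz function.  The coordinates are given by the unit vector \<open>\<nu>\<close>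
  (the ``vertical'' direction) and its orthogonal hyperplane, on which \<open>g\<close> is defined;
  \<open>y - (y \<bullet> \<nu>) *\<^sub>R \<nu>\<close> is the orthogonal projection of \<open>y\<close> to that hyperplane.\<close>

definition bounded_lipschitz_domain :: "(real^'n) set \<Rightarrow> bool" where
  "bounded_lipschitz_domain D \<longleftrightarrow>
     open D \<and> connected D \<and> D \<noteq> {} \<and> bounded D \<and>
     (\<forall>x\<in>frontier D. \<exists>r>0. \<exists>\<nu>. norm \<nu> = 1 \<and>
        (\<exists>(g :: real^'n \<Rightarrow> real) L. L-lipschitz_on {z. z \<bullet> \<nu> = 0} g \<and>
           D \<inter> ball x r = {y \<in> ball x r. g (y - (y \<bullet> \<nu>) *\<^sub>R \<nu>) < y \<bullet> \<nu>}))"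

definition unit_cell :: "(real^'n) set" where
  "unit_cell = cbox (\<chi> i. - 1 / 2) (\<chi> i. 1 / 2)"

definition admissible_hole :: "(real^'n) set \<Rightarrow> bool" where
  "admissible_hole T \<longleftrightarrow>
     (\<exists>D. bounded_lipschitz_domain D \<and> D \<subseteq> unit_cell \<and> T = closure D) \<and>
     connected (unit_cell - T) \<and>
     (\<exists>c\<^sub>0>0. ball 0 c\<^sub>0 \<subseteq> T \<and> c\<^sub>0 \<le> setdist (frontier T) (frontier unit_cell))"

definition int_lattice :: "(real^'n) set" where
  "int_lattice = {k. \<forall>i. k $ i \<in> \<int>}"

definition perforated_domain :: "(real^'n) set \<Rightarrow> real \<Rightarrow> real \<Rightarrow> (real^'n) set" where
  "perforated_domain T \<epsilon> \<eta> =
     UNIV - (\<Union>k\<in>int_lattice. (\<lambda>x. \<epsilon> *\<^sub>R (k + \<eta> *\<^sub>R x)) ` T)"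

subsection \<open>Lebesgue spaces\<close>

text \<open>The norm is extended-valued: it is \<open>\<infinity>\<close> when the \<open>p\<close>-th power is not integrable.\<close>

definition Lp_norm :: "real \<Rightarrow> (real^'n) set \<Rightarrow> (real^'n \<Rightarrow> 'b::real_normed_vector) \<Rightarrow> ennreal" where
  "Lp_norm p \<Omega> f =
     (let I = (\<integral>\<^sup>+ x. ennreal (norm (f x) powr p) \<partial>lebesgue_on \<Omega>)
      in if I = \<infinity> then \<infinity> else ennreal (enn2real I powr (1 / p)))"

definition Lp_space :: "real \<Rightarrow> (real^'n) set \<Rightarrow> (real^'n \<Rightarrow> 'b::real_normed_vector) set" where
  "Lp_space p \<Omega> = {f. f \<in> borel_measurable (lebesgue_on \<Omega>) \<and> Lp_norm p \<Omega> f < \<infinity>}"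

subsection \<open>Test functions\<close>

text \<open>Continuous partial derivatives up to order \<open>k\<close>.\<close>

fun Ck :: "nat \<Rightarrow> (real^'n \<Rightarrow> real) \<Rightarrow> bool" where
  "Ck 0 f \<longleftrightarrow> continuous_on UNIV f"
| "Ck (Suc k) f \<longleftrightarrow> (\<forall>x. f differentiable (at x)) \<and>
     (\<forall>v. Ck k (\<lambda>x. frechet_derivative f (at x) v))"

text \<open>Elements of \<open>C\<^sub>0\<^sup>\<infinity>(\<Omega>)\<close>, extended by zero to the whole space.\<close>

definition test_function :: "(real^'n) set \<Rightarrow> (real^'n \<Rightarrow> real) \<Rightarrow> bool" where
  "test_function \<Omega> \<psi> \<longleftrightarrow>
     (\<forall>k. Ck k \<psi>) \<and> compact (closure {x. \<psi> x \<noteq> 0}) \<and> closure {x. \<psi> x \<noteq> 0} \<subseteq> \<Omega>"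

definition gradient :: "(real^'n \<Rightarrow> real) \<Rightarrow> real^'n \<Rightarrow> real^'n" where
  "gradient f x = (\<chi> i. frechet_derivative f (at x) (axis i 1))"

subsection \<open>The energy space and weak solutions\<close>

text \<open>\<open>W012 \<Omega> u G\<close>: the function \<open>u\<close> belongs to the completion \<open>W\<^sub>0\<^sup>1\<^sup>,\<^sup>2(\<Omega>)\<close> of the test functions
  under \<open>\<parallel>\<nabla>\<psi>\<parallel>\<close> in \<open>L\<^sup>2(\<Omega>)\<close>, and \<open>G\<close> is its gradient.  A point of the completion is given by a
  sequence of test functions whose gradients are Cauchy, that is, convergent in \<open>L\<^sup>2(\<Omega>)\<close>; it is
  identified with the function to which the sequence converges in \<open>L\<^sup>1\<close> on compact subsets.
  For perforated domains the Poincare inequality makes every such sequence converge to a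
  function (even in \<open>L\<^sup>2(\<Omega>)\<close>), so this is the whole completion.\<close>

definition W012 :: "(real^'n) set \<Rightarrow> (real^'n \<Rightarrow> real) \<Rightarrow> (real^'n \<Rightarrow> real^'n) \<Rightarrow> bool" where
  "W012 \<Omega> u G \<longleftrightarrow>
     u \<in> borel_measurable (lebesgue_on \<Omega>) \<and> G \<in> Lp_space 2 \<Omega> \<and>
     (\<exists>\<psi> :: nat \<Rightarrow> real^'n \<Rightarrow> real.
        (\<forall>n. test_function \<Omega> (\<psi> n)) \<and>
        (\<lambda>n. Lp_norm 2 \<Omega> (\<lambda>x. gradient (\<psi> n) x - G x)) \<longlonglongrightarrow> 0 \<and>
        (\<forall>K. compact K \<and> K \<subseteq> \<Omega> \<longrightarrow>
           (\<lambda>n. Lp_norm 1 K (\<lambda>x. \<psi> n x - u x)) \<longlonglongrightarrow> 0))"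

text \<open>Weak solutions \<open>u\<close> in the energy space of \<open>- \<Delta> u = div f\<close> in \<open>\<Omega>\<close>.\<close>

definition weak_solution ::
    "(real^'n) set \<Rightarrow> (real^'n \<Rightarrow> real^'n) \<Rightarrow> (real^'n \<Rightarrow> real) \<Rightarrow> bool" where
  "weak_solution \<Omega> f u \<longleftrightarrow>
     (\<exists>G. W012 \<Omega> u G \<and>
        (\<forall>\<phi>. test_function \<Omega> \<phi> \<longrightarrow>
           (LINT x|lebesgue_on \<Omega>. G x \<bullet> gradient \<phi> x) =
           - (LINT x|lebesgue_on \<Omega>. f x \<bullet> gradient \<phi> x)))"

definition C_sup :: "(real^'n) set \<Rightarrow> real \<Rightarrow> real \<Rightarrow> real \<Rightarrow> ennreal" where
  "C_sup T p \<epsilon> \<eta> =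
     (let \<omega> = perforated_domain T \<epsilon> \<eta>
      in Sup {Lp_norm p \<omega> u | u f.
           f \<in> Lp_space p \<omega> \<and> f \<in> Lp_space 2 \<omega> \<and> Lp_norm p \<omega> f = 1 \<and> weak_solution \<omega> f u})"

end

theory Submission
  imports Defs
begin

text \<open>Write \<open>L = \<epsilon> \<eta>\<^bsup>(2-d)/2\<^esup>\<close>, respectively \<open>L = \<epsilon> |ln (\<eta>/2)|\<^bsup>1/2\<^esup>\<close> if \<open>d = 2\<close>.  On functions that vanish on the
  holes the Poincare inequality holds with constant of order \<open>L\<close>: in each cell integrate the gradient
  along the rays through the centre, starting on the ball contained in the hole.

  Upper bound: testing the equation with a truncation of \<open>|u|\<^bsup>p-2\<^esup>u\<close> gives
  \<open>\<integral> |u|\<^bsup>p-2\<^esup>|\<nabla>u|\<^sup>2 \<le> \<integral> |u|\<^bsup>p-2\<^esup>|f|\<^sup>2\<close>, and the Poincare inequality for \<open>|u|\<^bsup>p/2\<^esup>\<close> turns the left hand side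
  into \<open>L\<^bsup>-2\<^esup> \<integral> |u|\<^bsup>p\<^esup>\<close>, which absorbs the factor \<open>|u|\<^bsup>p-2\<^esup>\<close> on the right.

  Lower bound: take \<open>f(x) = R(x/L) e\<^sub>i\<close> with a fixed profile \<open>R\<close>.  The test function
  \<open>v(x) = \<chi>(x) (\<partial>\<^sub>iR)(x/L)\<close>, where \<open>\<chi>\<close> cuts off the holes at the cost of an energy density of order
  \<open>L\<^bsup>-2\<^esup>\<close>, shows that the energy of the solution \<open>u\<close> is at least of order \<open>L\<^bsup>d\<^esup>\<close>.  Since this energy is
  \<open>\<integral> u div f\<close>, the average of \<open>|u|\<close> over the support of \<open>f\<close> is at least of order \<open>L\<close>.\<close>

section \<open>Smooth functions\<close>

text \<open>The size of L comes from one integral. On a ray whose first part, a fraction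
  \<open>s\<close> of order \<eta>, lies in the hole, Cauchy-Schwarz against the polar weight
  t^(d-1) costs the integral of t^(1-d) over [s,1], which is of order \<eta>^(2-d), or of |ln
  \<eta>| plus a constant if d = 2. The obstacle in the upper bound is that |u|^(p-2) u may not be
  inserted into the equation: test functions are smooth with compact support, and u is only a limit
  of such functions. So the estimate is made for an approximant \<open>\<psi> n\<close>, with the
  power truncated at height N. Since \<open>\<psi> n\<close> does not solve the equation, an error
  of size (N+1)^(p-2) times the L^2 distance of the gradients remains; it vanishes as n grows for
  fixed N, and N goes to infinity last. In the lower bound the exponent p enters only through
  volumes: f is normalised over a cube of side 8L and Hoelder's inequality for u is used on the same
  cube, so the factors L^(d/p) cancel. Of the hole, a ball inside it serves the upper bound and a
  cube around it the lower.\<close>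

lemma differentiable_iff_has_gradient:
  fixes f :: "real^'n \<Rightarrow> real"
  shows "f differentiable (at x) \<longleftrightarrow> (f has_derivative (\<lambda>h. gradient f x \<bullet> h)) (at x)"
proof
  assume "f differentiable (at x)"
  then have D: "(f has_derivative frechet_derivative f (at x)) (at x)"
    using frechet_derivative_works by blast
  then interpret linear "frechet_derivative f (at x)"
    by (rule has_derivative_linear)
  have "frechet_derivative f (at x) h = gradient f x \<bullet> h" for h
  proof -
    have "h = (\<Sum>i\<in>UNIV. (h $ i) *\<^sub>R axis i 1)"
      by (simp add: basis_expansion scalar_mult_eq_scaleR[symmetric])
    then have "frechet_derivative f (at x) h = frechet_derivative f (at x) (\<Sum>i\<in>UNIV. (h $ i) *\<^sub>R axis i 1)"
      by simp
    also have "\<dots> = (\<Sum>i\<in>UNIV. (h $ i) *\<^sub>R frechet_derivative f (at x) (axis i 1))"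
      by (simp add: sum scale)
    also have "\<dots> = gradient f x \<bullet> h"
      by (simp add: gradient_def inner_vec_def mult.commute)
    finally show ?thesis .
  qed
  then show "(f has_derivative (\<lambda>h. gradient f x \<bullet> h)) (at x)"
    using D by (metis (no_types, lifting) ext)
qed (auto simp: differentiable_def)

text \<open>Uniqueness of derivatives makes this the working rule: a gradient is computed by
  exhibiting a derivative in inner-product form.\<close>

lemma has_derivative_imp_gradient:
  fixes f :: "real^'n \<Rightarrow> real"
  assumes "(f has_derivative (\<lambda>h. v \<bullet> h)) (at x)"
  shows "gradient f x = v"
proof -
  have "frechet_derivative f (at x) = (\<lambda>h. v \<bullet> h)"
    using frechet_derivative_at[OF assms] by simp
  then show ?thesis
    by (simp add: gradient_def vec_eq_iff inner_axis)
qed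

lemma Ck_imp_continuous: "Ck k f \<Longrightarrow> continuous_on UNIV f"
  by (cases k)
     (auto intro!: differentiable_imp_continuous_on simp: differentiable_on_def)

lemma Ck_SucD: "Ck (Suc k) f \<Longrightarrow> Ck k f"
proof (induction k arbitrary: f)
  case 0
  then show ?case using Ck_imp_continuous[of 1 f] by simp
next
  case (Suc k)
  then show ?case by (metis Ck.simps(2))
qed

lemma Ck_Suc_has_derivative:
  assumes "Ck (Suc k) f"
  shows "(f has_derivative frechet_derivative f (at x)) (at x)"
  using assms frechet_derivative_works by auto

text \<open>\<open>Ck\<close> recurses through \<open>frechet_derivative\<close>; by uniqueness of
  derivatives any explicitly known derivative may stand in for it, which is how the closure rules
  below run.\<close>

lemma Ck_SucI:
  assumes "\<And>x. (f has_derivative f' x) (at x)" "\<And>v. Ck k (\<lambda>x. f' x v)"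
  shows "Ck (Suc k) f"
proof -
  have "frechet_derivative f (at x) = f' x" for x
    using frechet_derivative_at[OF assms(1)] by simp
  then show ?thesis
    using assms by (auto simp: differentiable_def)
qed

lemma Ck_const [intro]: "Ck k (\<lambda>x. c)"
proof (induction k arbitrary: c)
  case (Suc k)
  show ?case by (rule Ck_SucI[where f'="\<lambda>x v. 0"]) (auto intro: Suc)
qed auto

lemma Ck_add [intro]: "Ck k f \<Longrightarrow> Ck k g \<Longrightarrow> Ck k (\<lambda>x. f x + g x)"
proof (induction k arbitrary: f g)
  case (Suc k)
  show ?case
    by (rule Ck_SucI, rule has_derivative_add[OF Ck_Suc_has_derivative[OF Suc(2)]
          Ck_Suc_has_derivative[OF Suc(3)]]) (use Suc in auto)
qed (auto intro!: continuous_intros)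

lemma Ck_mult [intro]: "Ck k f \<Longrightarrow> Ck k g \<Longrightarrow> Ck k (\<lambda>x. f x * g x)"
proof (induction k arbitrary: f g)
  case (Suc k)
  have "Ck k f" "Ck k g" using Suc Ck_SucD by blast+
  then show ?case
    by - (rule Ck_SucI, rule has_derivative_mult[OF Ck_Suc_has_derivative[OF Suc(2)]
          Ck_Suc_has_derivative[OF Suc(3)]], use Suc in auto)
qed (auto intro!: continuous_intros)

lemma Ck_diff [intro]: "Ck k f \<Longrightarrow> Ck k g \<Longrightarrow> Ck k (\<lambda>x. f x - g x)"
  using Ck_add[OF _ Ck_mult[OF Ck_const[of k "-1"]], of f g] by simp

lemma Ck_sum [intro]: "(\<And>i. i \<in> I \<Longrightarrow> Ck k (f i)) \<Longrightarrow> Ck k (\<lambda>x. \<Sum>i\<in>I. f i x)"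
  by (induction I rule: infinite_finite_induct) auto

lemma Ck_prod [intro]: "(\<And>i. i \<in> I \<Longrightarrow> Ck k (f i)) \<Longrightarrow> Ck k (\<lambda>x. \<Prod>i\<in>I. f i x)"
  by (induction I rule: infinite_finite_induct) auto

lemma Ck_power [intro]: "Ck k f \<Longrightarrow> Ck k (\<lambda>x. f x ^ n)"
  by (induction n) auto

lemma Ck_nth [intro]: "Ck k (\<lambda>x. x $ i)"
proof (cases k)
  case (Suc k)
  show ?thesis unfolding Suc
    by (rule Ck_SucI[where f'="\<lambda>x v. v $ i"])
       (auto intro: bounded_linear_imp_has_derivative bounded_linear_vec_nth)
qed (auto intro!: continuous_intros)

text \<open>The cell cutoffs are rescaled translates of one function. The induction needs f
  arbitrary, because the derivative in direction \<open>v\<close> is the transform of the derivative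
  of f in direction \<open>c *\<^sub>R v\<close>.\<close>

lemma Ck_scale_shift: "Ck k f \<Longrightarrow> Ck k (\<lambda>x. f (c *\<^sub>R (x - b)))"
proof (induction k arbitrary: f)
  case 0
  then have "continuous_on UNIV (f \<circ> (\<lambda>x. c *\<^sub>R (x - b)))"
    by (intro continuous_on_compose) (auto intro!: continuous_intros intro: continuous_on_subset)
  then show ?case by (simp add: o_def)
next
  case (Suc k)
  show ?case
  proof (rule Ck_SucI)
    fix x
    have 1: "((\<lambda>x. c *\<^sub>R (x - b)) has_derivative (\<lambda>v. c *\<^sub>R v)) (at x)"
      by (auto intro!: derivative_eq_intros)
    show "((\<lambda>x. f (c *\<^sub>R (x - b))) has_derivative
         (\<lambda>v. frechet_derivative f (at (c *\<^sub>R (x - b))) (c *\<^sub>R v))) (at x)"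
      by (rule has_derivative_compose[OF 1 Ck_Suc_has_derivative[OF Suc(2)]])
  next
    fix v
    show "Ck k (\<lambda>x. frechet_derivative f (at (c *\<^sub>R (x - b))) (c *\<^sub>R v))"
      using Suc.IH[of "\<lambda>x. frechet_derivative f (at x) (c *\<^sub>R v)"] Suc(2) by simp
  qed
qed

lemma gradient_add:
  assumes "f differentiable (at x)" "g differentiable (at x)"
  shows "gradient (\<lambda>x. f x + g x) x = gradient f x + gradient g x"
  by (rule has_derivative_imp_gradient)
     (auto intro!: derivative_eq_intros assms[unfolded differentiable_iff_has_gradient]
        simp: inner_add_left)

lemma gradient_cmult:
  assumes "f differentiable (at x)"
  shows "gradient (\<lambda>x. c * f x) x = c *\<^sub>R gradient f x"
  by (rule has_derivative_imp_gradient)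
     (auto intro!: derivative_eq_intros assms[unfolded differentiable_iff_has_gradient])

lemma gradient_mult:
  assumes "f differentiable (at x)" "g differentiable (at x)"
  shows "gradient (\<lambda>x. f x * g x) x = f x *\<^sub>R gradient g x + g x *\<^sub>R gradient f x"
  by (rule has_derivative_imp_gradient)
     (auto intro!: derivative_eq_intros assms[unfolded differentiable_iff_has_gradient]
        simp: inner_add_left algebra_simps)

lemma gradient_sum:
  assumes "\<And>i. i \<in> I \<Longrightarrow> f i differentiable (at x)"
  shows "gradient (\<lambda>x. \<Sum>i\<in>I. f i x) x = (\<Sum>i\<in>I. gradient (f i) x)"
  by (rule has_derivative_imp_gradient)
     (auto intro!: derivative_eq_intros assms[unfolded differentiable_iff_has_gradient]
        simp: inner_sum_left)

lemma gradient_const [simp]: "gradient (\<lambda>x. c) x = 0"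
  by (rule has_derivative_imp_gradient) simp

lemma gradient_scale_shift:
  assumes "f differentiable (at (c *\<^sub>R (x - b)))"
  shows "gradient (\<lambda>x. f (c *\<^sub>R (x - b))) x = c *\<^sub>R gradient f (c *\<^sub>R (x - b))"
proof (rule has_derivative_imp_gradient)
  have 1: "((\<lambda>x. c *\<^sub>R (x - b)) has_derivative (\<lambda>v. c *\<^sub>R v)) (at x)"
    by (auto intro!: derivative_eq_intros)
  show "((\<lambda>x. f (c *\<^sub>R (x - b))) has_derivative
         (\<bullet>) (c *\<^sub>R gradient f (c *\<^sub>R (x - b)))) (at x)"
    using has_derivative_compose[OF 1 assms[unfolded differentiable_iff_has_gradient]]
    by (simp add: inner_scaleR_left[abs_def])
qed

lemma gradient_compose_real:
  assumes "g differentiable (at x)" "(\<phi> has_real_derivative D) (at (g x))"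
  shows "gradient (\<lambda>x. \<phi> (g x)) x = D *\<^sub>R gradient g x"
    and "(\<lambda>x. \<phi> (g x)) differentiable (at x)"
proof -
  have "((\<lambda>x. \<phi> (g x)) has_derivative (\<lambda>v. D * (gradient g x \<bullet> v))) (at x)"
    using has_derivative_compose[OF assms(1)[unfolded differentiable_iff_has_gradient]
        assms(2)[unfolded has_field_derivative_def]] .
  then show "gradient (\<lambda>x. \<phi> (g x)) x = D *\<^sub>R gradient g x"
    and "(\<lambda>x. \<phi> (g x)) differentiable (at x)"
    by (auto intro!: has_derivative_imp_gradient simp: differentiable_def)
qed

lemma Ck_1_differentiable: "Ck (Suc k) f \<Longrightarrow> f differentiable (at x)"
  by simp

lemma Ck_gradient_nth: "Ck (Suc k) f \<Longrightarrow> Ck k (\<lambda>x. gradient f x $ i)"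
  by (simp add: gradient_def)

lemma continuous_gradient:
  assumes "Ck (Suc k) f"
  shows "continuous_on UNIV (gradient f)"
proof -
  have "continuous_on UNIV (\<lambda>x. \<chi> i. gradient f x $ i)"
    by (intro continuous_on_vec_lambda Ck_imp_continuous[OF Ck_gradient_nth[OF assms]])
  then show ?thesis by (simp add: vec_lambda_eta)
qed

lemma gradient_eq_0_outside:
  assumes "x \<notin> closure {x. f x \<noteq> 0}"
  shows "gradient f x = 0"
proof (rule has_derivative_imp_gradient)
  have "((\<lambda>x. 0) has_derivative (\<lambda>h. 0 \<bullet> h)) (at x)" by simp
  then show "(f has_derivative (\<lambda>h. 0 \<bullet> h)) (at x)"
  proof (rule has_derivative_transform_within_open)
    show "open (- closure {x. f x \<noteq> 0})" by auto
    show "x \<in> - closure {x. f x \<noteq> 0}" using assms by simp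
    show "0 = f y" if "y \<in> - closure {x. f x \<noteq> 0}" for y
      using that closure_subset[of "{x. f x \<noteq> 0}"] by auto
  qed
qed

subsection \<open>Test functions\<close>

lemma test_function_zero: "test_function \<Omega> \<psi> \<Longrightarrow> x \<notin> \<Omega> \<Longrightarrow> \<psi> x = 0 \<and> gradient \<psi> x = 0"
  using gradient_eq_0_outside[of x \<psi>] closure_subset[of "{x. \<psi> x \<noteq> 0}"]
  by (auto simp: test_function_def)

lemma test_function_mult:
  assumes "test_function \<Omega> \<phi>" "\<And>k. Ck k \<psi>"
  shows "test_function \<Omega> (\<lambda>x. \<phi> x * \<psi> x)"
proof -
  have *: "closure {x. \<phi> x * \<psi> x \<noteq> 0} \<subseteq> closure {x. \<phi> x \<noteq> 0}"
    by (rule closure_mono) auto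
  then have "compact (closure {x. \<phi> x * \<psi> x \<noteq> 0})"
    using assms unfolding test_function_def
    by (meson closed_closure compact_eq_bounded_closed bounded_subset)
  then show ?thesis using assms * unfolding test_function_def by auto
qed

lemma test_function_cmult: "test_function \<Omega> \<phi> \<Longrightarrow> test_function \<Omega> (\<lambda>x. c * \<phi> x)"
  using test_function_mult[of \<Omega> \<phi> "\<lambda>_. c"] by (simp add: mult.commute Ck_const)

lemma test_function_add:
  assumes "test_function \<Omega> \<phi>" "test_function \<Omega> \<psi>"
  shows "test_function \<Omega> (\<lambda>x. \<phi> x + \<psi> x)"
proof -
  have *: "closure {x. \<phi> x + \<psi> x \<noteq> 0} \<subseteq> closure {x. \<phi> x \<noteq> 0} \<union> closure {x. \<psi> x \<noteq> 0}"
    unfolding closure_Un[symmetric] by (rule closure_mono) auto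
  then have "compact (closure {x. \<phi> x + \<psi> x \<noteq> 0})"
    using assms unfolding test_function_def
    by (meson closed_closure compact_eq_bounded_closed bounded_subset compact_Un)
  then show ?thesis using assms * unfolding test_function_def by auto
qed

lemma test_function_zero_fun: "test_function \<Omega> (\<lambda>x. 0)"
  by (auto simp: test_function_def Ck_const)


lemma test_function_diff:
  assumes "test_function \<Omega> \<phi>" "test_function \<Omega> \<psi>"
  shows "test_function \<Omega> (\<lambda>x. \<phi> x - \<psi> x)"
  using test_function_add[OF assms(1) test_function_cmult[OF assms(2), of "-1"]] by simp

lemma test_function_Ck: "test_function \<Omega> \<phi> \<Longrightarrow> Ck k \<phi>"
  by (simp add: test_function_def)

lemma test_function_differentiable: "test_function \<Omega> \<phi> \<Longrightarrow> \<phi> differentiable (at x)"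
  using test_function_Ck[of \<Omega> \<phi> 1] by simp

lemma test_function_gradient_add:
  "test_function \<Omega> \<phi> \<Longrightarrow> test_function \<Omega> \<psi> \<Longrightarrow>
    gradient (\<lambda>x. \<phi> x + \<psi> x) x = gradient \<phi> x + gradient \<psi> x"
  by (simp add: gradient_add test_function_differentiable)

lemma test_function_gradient_cmult:
  "test_function \<Omega> \<phi> \<Longrightarrow> gradient (\<lambda>x. c * \<phi> x) x = c *\<^sub>R gradient \<phi> x"
  by (simp add: gradient_cmult test_function_differentiable)

lemma test_function_gradient_diff:
  assumes "test_function \<Omega> \<phi>" "test_function \<Omega> \<psi>"
  shows "gradient (\<lambda>x. \<phi> x - \<psi> x) x = gradient \<phi> x - gradient \<psi> x"
  using test_function_gradient_add[OF assms(1) test_function_cmult[OF assms(2), of "-1"]]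
    test_function_gradient_cmult[OF assms(2), of "-1"] by simp

lemma test_function_bounded:
  assumes "test_function \<Omega> \<psi>"
  obtains B where "B > 0" "\<And>x. \<bar>\<psi> x\<bar> \<le> B" "\<And>x. norm (gradient \<psi> x) \<le> B"
proof -
  let ?S = "closure {x. \<psi> x \<noteq> 0}"
  have S: "compact ?S" using assms by (simp add: test_function_def)
  have "continuous_on ?S \<psi>" "continuous_on ?S (gradient \<psi>)"
    using assms Ck_imp_continuous[of 0 \<psi>] continuous_gradient[of 0 \<psi>]
    by (auto simp: test_function_def intro: continuous_on_subset)
  then have "bounded (\<psi> ` ?S)" "bounded (gradient \<psi> ` ?S)"
    using S compact_continuous_image compact_imp_bounded by blast+
  then obtain a b where a: "a > 0" "\<And>x. x \<in> ?S \<Longrightarrow> \<bar>\<psi> x\<bar> \<le> a"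
    and b: "b > 0" "\<And>x. x \<in> ?S \<Longrightarrow> norm (gradient \<psi> x) \<le> b"
    unfolding bounded_pos by (metis image_eqI real_norm_def)
  show ?thesis
  proof (rule that[of "max a b"])
    show "max a b > 0" using a by simp
    show "\<bar>\<psi> x\<bar> \<le> max a b" for x
    proof (cases "x \<in> ?S")
      case False
      then have "\<psi> x = 0" using closure_subset[of "{x. \<psi> x \<noteq> 0}"] by auto
      then show ?thesis using a by simp
    qed (use a in \<open>auto simp: le_max_iff_disj\<close>)
    show "norm (gradient \<psi> x) \<le> max a b" for x
      using a b gradient_eq_0_outside[of x \<psi>] by (cases "x \<in> ?S") (auto simp: le_max_iff_disj)
  qed
qed

lemma test_function_gradient_nth:
  assumes "test_function \<Omega> \<psi>"
  shows "test_function \<Omega> (\<lambda>x. gradient \<psi> x $ i)"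
proof -
  have sub: "closure {x. gradient \<psi> x $ i \<noteq> 0} \<subseteq> closure {x. \<psi> x \<noteq> 0}"
    by (rule closure_minimal) (auto dest!: gradient_eq_0_outside[rotated] intro: ccontr simp: gradient_eq_0_outside)
  then have "compact (closure {x. gradient \<psi> x $ i \<noteq> 0})"
    using assms unfolding test_function_def
    by (meson closed_closure compact_eq_bounded_closed bounded_subset)
  moreover have "Ck k (\<lambda>x. gradient \<psi> x $ i)" for k
    using Ck_gradient_nth[OF test_function_Ck[OF assms]] .
  ultimately show ?thesis using sub assms unfolding test_function_def by auto
qed

subsection \<open>A smooth bump function of one variable\<close>

text \<open>The one-variable counterpart of \<open>Ck\<close>; the derivative is existentially
  quantified so that a closed formula can be supplied as witness.\<close>

primrec smooth_upto :: "nat \<Rightarrow> (real \<Rightarrow> real) \<Rightarrow> bool" where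
  "smooth_upto 0 f \<longleftrightarrow> continuous_on UNIV f"
| "smooth_upto (Suc k) f \<longleftrightarrow> (\<exists>f'. (\<forall>x. (f has_real_derivative f' x) (at x)) \<and> smooth_upto k f')"

lemma smooth_upto_SucD: "smooth_upto (Suc k) f \<Longrightarrow> smooth_upto k f"
proof (induction k arbitrary: f)
  case 0
  then show ?case
    by (metis DERIV_continuous_on UNIV_I has_field_derivative_at_within smooth_upto.simps)
qed auto

lemma smooth_upto_SucI:
  "(\<And>x. (f has_real_derivative f' x) (at x)) \<Longrightarrow> smooth_upto k f' \<Longrightarrow> smooth_upto (Suc k) f"
  by auto

lemma smooth_upto_const: "smooth_upto k (\<lambda>x. c)"
  by (induction k arbitrary: c) (auto intro!: derivative_eq_intros exI[of _ "\<lambda>x. 0"])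

lemma smooth_upto_add: "smooth_upto k f \<Longrightarrow> smooth_upto k g \<Longrightarrow> smooth_upto k (\<lambda>x. f x + g x)"
proof (induction k arbitrary: f g)
  case (Suc k)
  then obtain f' g' where "\<forall>x. (f has_real_derivative f' x) (at x)" "smooth_upto k f'"
    "\<forall>x. (g has_real_derivative g' x) (at x)" "smooth_upto k g'" by auto
  then show ?case using Suc.IH by (auto intro!: derivative_intros exI[of _ "\<lambda>x. f' x + g' x"])
qed (auto intro!: continuous_intros)

lemma smooth_upto_mult: "smooth_upto k f \<Longrightarrow> smooth_upto k g \<Longrightarrow> smooth_upto k (\<lambda>x. f x * g x)"
proof (induction k arbitrary: f g)
  case (Suc k)
  then obtain f' g' where *: "\<forall>x. (f has_real_derivative f' x) (at x)" "smooth_upto k f'"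
    "\<forall>x. (g has_real_derivative g' x) (at x)" "smooth_upto k g'" by auto
  have "smooth_upto k f" "smooth_upto k g" using Suc smooth_upto_SucD by blast+
  then have "smooth_upto k (\<lambda>x. f' x * g x + g' x * f x)"
    using Suc.IH * smooth_upto_add by auto
  then show ?case using *
    by (auto intro!: derivative_eq_intros exI[of _ "\<lambda>x. f' x * g x + g' x * f x"])
qed (auto intro!: continuous_intros)

lemma smooth_upto_affine: "smooth_upto k f \<Longrightarrow> smooth_upto k (\<lambda>x. f (a * x + b))"
proof (induction k arbitrary: f)
  case 0
  then have "continuous_on UNIV (f \<circ> (\<lambda>x. a * x + b))"
    by (intro continuous_on_compose) (auto intro!: continuous_intros intro: continuous_on_subset)
  then show ?case by (simp add: o_def)
next
  case (Suc k)
  then obtain f' where *: "\<forall>x. (f has_real_derivative f' x) (at x)" "smooth_upto k f'" by auto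
  have "((\<lambda>x. f (a * x + b)) has_real_derivative (f' (a * x + b) * a)) (at x)" for x
    by (intro DERIV_chain2[of f]) (use * in \<open>auto intro!: derivative_eq_intros\<close>)
  moreover have "smooth_upto k (\<lambda>x. f' (a * x + b) * a)"
    using smooth_upto_mult[OF Suc.IH[OF *(2)] smooth_upto_const] .
  ultimately show ?case by (rule smooth_upto_SucI)
qed

lemma smooth_upto_inverse:
  assumes "\<And>x. f x \<noteq> 0"
  shows "smooth_upto k f \<Longrightarrow> smooth_upto k (\<lambda>x. inverse (f x))"
proof (induction k)
  case (Suc k)
  then obtain f' where *: "\<forall>x. (f has_real_derivative f' x) (at x)" "smooth_upto k f'" by auto
  have "smooth_upto k (\<lambda>x. inverse (f x))" using Suc smooth_upto_SucD by blast
  then have "smooth_upto k (\<lambda>x. (-1) * (f' x * (inverse (f x) * inverse (f x))))"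
    by (intro smooth_upto_mult smooth_upto_const *(2))
  moreover have "((\<lambda>x. inverse (f x)) has_real_derivative
      (-1) * (f' x * (inverse (f x) * inverse (f x)))) (at x)" for x
    using DERIV_inverse'[OF *(1)[rule_format, of x] assms] by (simp add: mult_ac)
  ultimately show ?case by (rule smooth_upto_SucI[rotated])
qed (use assms in \<open>auto intro!: continuous_intros\<close>)

text \<open>The functions x^(-n) e^(-1/x), extended by 0. The classical flat function is n = 0; the
  other members are the terms produced by differentiating it, so the family is closed under
  derivatives up to linear combination.\<close>

definition flat_exp :: "nat \<Rightarrow> real \<Rightarrow> real" where
  "flat_exp n x = (if 0 < x then inverse x ^ n * exp (- inverse x) else 0)"

lemma flat_exp_tendsto_0: "(flat_exp n \<longlongrightarrow> 0) (at_right 0)"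
proof -
  \<comment> \<open>In the variable 1/x, flatness at 0 says that the exponential outgrows every
    power.\<close>
  have "((\<lambda>x::real. x ^ n / exp x) \<longlongrightarrow> 0) at_top" by (rule tendsto_power_div_exp_0)
  then have "((\<lambda>x::real. inverse x ^ n / exp (inverse x)) \<longlongrightarrow> 0) (at_right 0)"
    by (rule filterlim_compose) (rule filterlim_inverse_at_top_right)
  then show ?thesis
    by (rule Lim_transform_eventually)
       (auto simp: flat_exp_def eventually_at_right_less exp_minus divide_inverse
         intro!: eventually_mono[OF eventually_at_right_less])
qed

lemma flat_exp_derivative:
  "(flat_exp n has_real_derivative flat_exp (n + 2) x - of_nat n * flat_exp (n + 1) x) (at x)"
proof -
  consider "x < 0" | "x = 0" | "x > 0" by linarith
  then show ?thesis
  proof cases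
    case 1
    have "((\<lambda>x. 0) has_real_derivative 0) (at x)" by simp
    then have "(flat_exp n has_real_derivative 0) (at x)"
      by (rule DERIV_cong_ev[OF refl _ refl, THEN iffD1, rotated])
         (use 1 in \<open>auto simp: flat_exp_def eventually_nhds intro!: exI[of _ "{..<0}"]\<close>)
    then show ?thesis using 1 by (simp add: flat_exp_def)
  next
    case 2
    \<comment> \<open>Dividing by h adds one power of 1/h, so from the right the difference quotient
      at 0 is \<open>flat_exp (Suc n)\<close>.\<close>
    have "((\<lambda>h. flat_exp n h / h) \<longlongrightarrow> 0) (at_right 0)"
      by (rule Lim_transform_eventually[OF flat_exp_tendsto_0[of "Suc n"]])
         (auto simp: flat_exp_def field_simps intro!: eventually_mono[OF eventually_at_right_less])
    moreover have "((\<lambda>h. flat_exp n h / h) \<longlongrightarrow> 0) (at_left 0)"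
      by (rule tendsto_eventually)
         (auto simp: flat_exp_def eventually_at_filter)
    ultimately have "((\<lambda>h. flat_exp n h / h) \<longlongrightarrow> 0) (at 0)"
      by (simp add: filterlim_split_at)
    then show ?thesis using 2 by (simp add: DERIV_def flat_exp_def)
  next
    case 3
    have "((\<lambda>x. inverse x ^ n * exp (- inverse x)) has_real_derivative
        flat_exp (n + 2) x - of_nat n * flat_exp (n + 1) x) (at x)"
      using 3 by (auto intro!: derivative_eq_intros simp: flat_exp_def)
         (cases n; simp add: field_simps power2_eq_square)
    then show ?thesis
      by (rule DERIV_cong_ev[OF refl _ refl, THEN iffD1, rotated])
         (use 3 in \<open>auto simp: flat_exp_def eventually_nhds intro!: exI[of _ "{0<..}"]\<close>)
  qed
qed

lemma smooth_flat_exp: "smooth_upto k (flat_exp n)"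
proof (induction k arbitrary: n)
  case 0
  then show ?case
    using DERIV_continuous_on[OF has_field_derivative_at_within[OF flat_exp_derivative]] by auto
next
  case (Suc k)
  have "smooth_upto k (\<lambda>x. flat_exp (n + 2) x + (- of_nat n) * flat_exp (n + 1) x)"
    by (intro smooth_upto_add smooth_upto_mult smooth_upto_const Suc)
  then show ?case
    by (rule smooth_upto_SucI[rotated]) (use flat_exp_derivative[of n] in simp)
qed

lemma smooth_step_exists:
  obtains S :: "real \<Rightarrow> real" where "\<And>k. smooth_upto k S" "\<And>x. 0 \<le> S x \<and> S x \<le> 1"
    "\<And>x. x \<le> 0 \<Longrightarrow> S x = 0" "\<And>x. 1 \<le> x \<Longrightarrow> S x = 1"
proof -
  let ?E = "flat_exp 0"
  \<comment> \<open>The quotient E(x) / (E(x) + E(1 - x)) with E(x) = e^(-1/x) for positive x; one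
    of x and 1 - x is always positive. Writing 1 - x as \<open>(-1) * x + 1\<close> fits
    \<open>smooth_upto_affine\<close>.\<close>
  let ?S = "\<lambda>x. ?E x * inverse (?E x + ?E ((-1) * x + 1))"
  have nn: "?E x \<ge> 0" for x by (simp add: flat_exp_def)
  have pos: "?E x + ?E ((-1) * x + 1) > 0" for x
    using nn[of x] nn[of "(-1) * x + 1"] by (auto simp: flat_exp_def add_pos_pos)
  have "smooth_upto k ?S" for k
    using pos by (intro smooth_upto_mult smooth_upto_inverse smooth_upto_add
        smooth_upto_affine smooth_flat_exp) (simp add: less_imp_neq[symmetric])
  moreover have "0 \<le> ?S x \<and> ?S x \<le> 1" for x
  proof -
    have "?S x = ?E x / (?E x + ?E ((-1) * x + 1))" by (simp add: divide_inverse)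
    then show ?thesis using nn[of x] nn[of "(-1) * x + 1"] pos[of x]
      by (simp add: divide_le_eq)
  qed
  moreover have "?S x = 0" if "x \<le> 0" for x using that by (simp add: flat_exp_def)
  moreover have "?S x = 1" if "1 \<le> x" for x using that by (simp add: flat_exp_def)
  ultimately show ?thesis using that[of ?S] by blast
qed

lemma smooth_bump_exists:
  assumes "0 < a" "a < b"
  obtains \<beta> :: "real \<Rightarrow> real" where "\<And>k. smooth_upto k \<beta>" "\<And>x. 0 \<le> \<beta> x \<and> \<beta> x \<le> 1"
    "\<And>x. \<bar>x\<bar> \<le> a \<Longrightarrow> \<beta> x = 1" "\<And>x. b \<le> \<bar>x\<bar> \<Longrightarrow> \<beta> x = 0"
proof -
  obtain S :: "real \<Rightarrow> real" where S: "\<And>k. smooth_upto k S" "\<And>x. 0 \<le> S x \<and> S x \<le> 1"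
    "\<And>x. x \<le> 0 \<Longrightarrow> S x = 0" "\<And>x. 1 \<le> x \<Longrightarrow> S x = 1"
    using smooth_step_exists by metis
  define c where "c = 1 / (b - a)"
  have c: "c > 0" "c * (b - a) = 1" using assms by (auto simp: c_def)
  \<comment> \<open>A step falling at the right end times a step rising at the left end;
    \<open>c\<close> stretches the gap from a to b to unit length.\<close>
  let ?\<beta> = "\<lambda>x. S ((-c) * x + c * b) * S (c * x + c * b)"
  have eq: "(-c) * x + c * b = c * (b - x)" "c * x + c * b = c * (b + x)" for x
    by (auto simp: algebra_simps)
  have "smooth_upto k ?\<beta>" for k
    by (intro smooth_upto_mult smooth_upto_affine S)
  moreover have "0 \<le> ?\<beta> x \<and> ?\<beta> x \<le> 1" for x using S(2) by (simp add: mult_le_one)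
  moreover have "?\<beta> x = 1" if "\<bar>x\<bar> \<le> a" for x
  proof -
    have "c * (b - a) \<le> c * (b - x)" "c * (b - a) \<le> c * (b + x)"
      using that c(1) by (intro mult_left_mono; linarith)+
    then have "1 \<le> c * (b - x)" "1 \<le> c * (b + x)" using c(2) by linarith+
    then show ?thesis unfolding eq using S(4) by simp
  qed
  moreover have "?\<beta> x = 0" if "b \<le> \<bar>x\<bar>" for x
  proof (cases "x \<ge> 0")
    case True
    then have "c * (b - x) \<le> 0" using that c by (simp add: mult_le_0_iff)
    then show ?thesis unfolding eq using S(3) by simp
  next
    case False
    then have "c * (b + x) \<le> 0" using that c by (simp add: mult_le_0_iff)
    then show ?thesis unfolding eq using S(3) by simp
  qed
  ultimately show ?thesis using that[of ?\<beta>] by blast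
qed

lemma Ck_compose_real: "smooth_upto k \<phi> \<Longrightarrow> Ck k g \<Longrightarrow> Ck k (\<lambda>x. \<phi> (g x))"
proof (induction k arbitrary: \<phi>)
  case 0
  then have "continuous_on UNIV (\<phi> \<circ> g)"
    by (intro continuous_on_compose) (auto intro: continuous_on_subset)
  then show ?case by (simp add: o_def)
next
  case (Suc k)
  then obtain \<phi>' where *: "\<forall>x. (\<phi> has_real_derivative \<phi>' x) (at x)" "smooth_upto k \<phi>'" by auto
  show ?case
  proof (rule Ck_SucI)
    show "((\<lambda>x. \<phi> (g x)) has_derivative (\<lambda>v. \<phi>' (g x) * frechet_derivative g (at x) v)) (at x)" for x
      using has_derivative_compose[OF Ck_Suc_has_derivative[OF Suc(3)]]
        *(1)[rule_format, unfolded has_field_derivative_def] by blast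
    show "Ck k (\<lambda>x. \<phi>' (g x) * frechet_derivative g (at x) v)" for v
      using Suc(3) by (intro Ck_mult Suc.IH[OF *(2) Ck_SucD[OF Suc(3)]]) simp
  qed
qed

text \<open>A product of one-variable bumps, so that plateau and support are cubes and fit the cells
  of the lattice.\<close>

lemma test_function_box_bump:
  fixes a b :: real
  assumes "0 < a" "a < b"
  obtains \<beta> :: "real^'n \<Rightarrow> real" where "\<And>k. Ck k \<beta>" "\<And>x. 0 \<le> \<beta> x \<and> \<beta> x \<le> 1"
    "\<And>x. (\<And>i. \<bar>x $ i\<bar> \<le> a) \<Longrightarrow> \<beta> x = 1" "\<And>x i. b \<le> \<bar>x $ i\<bar> \<Longrightarrow> \<beta> x = 0"
    "test_function UNIV \<beta>"
proof -
  obtain \<theta> :: "real \<Rightarrow> real" where \<theta>: "\<And>k. smooth_upto k \<theta>" "\<And>x. 0 \<le> \<theta> x \<and> \<theta> x \<le> 1"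
    "\<And>x. \<bar>x\<bar> \<le> a \<Longrightarrow> \<theta> x = 1" "\<And>x. b \<le> \<bar>x\<bar> \<Longrightarrow> \<theta> x = 0"
    using smooth_bump_exists[OF assms] by metis
  let ?B = "\<lambda>x::real^'n. \<Prod>i\<in>UNIV. \<theta> (x $ i)"
  have 1: "Ck k ?B" for k by (intro Ck_prod Ck_compose_real[OF \<theta>(1)] Ck_nth)
  have 2: "?B x = 0" if "b \<le> \<bar>x $ i\<bar>" for x i
    using \<theta>(4)[OF that] by (auto simp: prod_zero_iff)
  have "{x. ?B x \<noteq> 0} \<subseteq> cbox (\<chi> i. -b) (\<chi> i. b)"
  proof
    fix x assume "x \<in> {x. ?B x \<noteq> 0}"
    then have "\<bar>x $ i\<bar> < b" for i using 2[of x i] by (cases "b \<le> \<bar>x $ i\<bar>") auto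
    then show "x \<in> cbox (\<chi> i. -b) (\<chi> i. b)" by (simp add: mem_box_cart abs_less_iff less_imp_le minus_less_iff)
  qed
  then have "bounded {x. ?B x \<noteq> 0}" using bounded_cbox bounded_subset by blast
  then have 3: "test_function UNIV ?B"
    using 1 bounded_closure by (auto simp: test_function_def compact_eq_bounded_closed simp del: prod_zero_iff)
  show ?thesis
    by (rule that[OF 1 _ _ 2 3]) (auto intro!: prod_nonneg prod_le_1 \<theta> simp: \<theta>)
qed

section \<open>Integration on perforated domains\<close>

lemma countable_int_lattice: "countable (int_lattice :: (real^'n) set)"
proof -
  have "int_lattice \<subseteq> range (\<lambda>f :: 'n \<Rightarrow> int. \<chi> i. real_of_int (f i))"
  proof
    fix k :: "real^'n" assume "k \<in> int_lattice"
    then have "k = (\<chi> i. real_of_int \<lfloor>k $ i\<rfloor>)"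
      by (simp add: int_lattice_def vec_eq_iff)
    then show "k \<in> range (\<lambda>f :: 'n \<Rightarrow> int. \<chi> i. real_of_int (f i))"
      by (rule range_eqI[where x="\<lambda>i. \<lfloor>k $ i\<rfloor>"])
  qed
  then show ?thesis by (rule countable_subset) simp
qed

lemma perforated_domain_borel:
  assumes "compact T"
  shows "perforated_domain T \<epsilon> \<eta> \<in> sets borel"
proof -
  have "compact ((\<lambda>x. \<epsilon> *\<^sub>R (k + \<eta> *\<^sub>R x)) ` T)" for k
    by (rule compact_continuous_image[OF _ assms]) (auto intro!: continuous_intros)
  then have "(\<lambda>x. \<epsilon> *\<^sub>R (k + \<eta> *\<^sub>R x)) ` T \<in> sets borel" for k
    using compact_imp_closed borel_closed by blast
  then have "(\<Union>k\<in>int_lattice. (\<lambda>x. \<epsilon> *\<^sub>R (k + \<eta> *\<^sub>R x)) ` T) \<in> sets borel"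
    by (intro sets.countable_UN'[OF countable_int_lattice]) auto
  then show ?thesis unfolding perforated_domain_def by auto
qed

text \<open>\<open>Lp_norm\<close> and \<open>weak_solution\<close> integrate over
  \<open>lebesgue_on\<close>, while scaling, translation and Fubini are carried out on
  \<open>lborel\<close>. This is the bridge, for integrands that vanish off \<Omega>.\<close>

lemma nn_integral_lebesgue_on_eq_lborel:
  fixes f :: "'a::euclidean_space \<Rightarrow> ennreal"
  assumes "\<Omega> \<in> sets borel" "\<And>x. x \<notin> \<Omega> \<Longrightarrow> f x = 0"
  shows "(\<integral>\<^sup>+ x. f x \<partial>lebesgue_on \<Omega>) = (\<integral>\<^sup>+ x. f x \<partial>lborel)"
proof -
  have "(\<integral>\<^sup>+ x. f x \<partial>lebesgue_on \<Omega>) = (\<integral>\<^sup>+ x. f x * indicator \<Omega> x \<partial>lebesgue)"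
    using assms by (intro nn_integral_restrict_space) (auto intro: sets_completionI_sets)
  also have "(\<lambda>x. f x * indicator \<Omega> x) = f"
    using assms(2) by (auto simp: indicator_def fun_eq_iff)
  finally show ?thesis by (simp add: nn_integral_completion)
qed

lemma integral_lebesgue_on_eq_lborel:
  fixes f :: "'a::euclidean_space \<Rightarrow> 'b::{banach, second_countable_topology}"
  assumes "\<Omega> \<in> sets borel" "\<And>x. x \<notin> \<Omega> \<Longrightarrow> f x = 0" "f \<in> borel_measurable borel"
  shows "integral\<^sup>L (lebesgue_on \<Omega>) f = integral\<^sup>L lborel f"
proof -
  have "integral\<^sup>L (lebesgue_on \<Omega>) f = (\<integral>x. indicator \<Omega> x *\<^sub>R f x \<partial>lebesgue)"
    using assms by (intro integral_restrict_space) (auto intro: sets_completionI_sets)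
  also have "(\<lambda>x. indicator \<Omega> x *\<^sub>R f x) = f"
    using assms(2) by (auto simp: indicator_def fun_eq_iff)
  finally show ?thesis using assms(3) by (simp add: integral_completion)
qed

lemma borel_measurable_lebesgue_onI:
  "f \<in> borel_measurable borel \<Longrightarrow> f \<in> borel_measurable (lebesgue_on \<Omega>)"
  by (rule measurable_restrict_space1) (simp add: measurable_completion)

lemma nn_integral_lebesgue_on_mono_set:
  fixes f :: "'a::euclidean_space \<Rightarrow> ennreal"
  assumes "\<Omega> \<in> sets lebesgue" "K \<in> sets lebesgue" "K \<subseteq> \<Omega>"
  shows "(\<integral>\<^sup>+ x. f x \<partial>lebesgue_on K) \<le> (\<integral>\<^sup>+ x. f x \<partial>lebesgue_on \<Omega>)"
  using assms by (auto simp: nn_integral_restrict_space indicator_def intro!: nn_integral_mono)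

lemma test_function_measurable:
  assumes "test_function \<Omega> \<psi>"
  shows "\<psi> \<in> borel_measurable borel" "gradient \<psi> \<in> borel_measurable borel"
    "\<psi> \<in> borel_measurable (lebesgue_on A)" "gradient \<psi> \<in> borel_measurable (lebesgue_on A)"
proof -
  show "\<psi> \<in> borel_measurable borel" "gradient \<psi> \<in> borel_measurable borel"
    using Ck_imp_continuous[OF test_function_Ck[OF assms, of 0]] continuous_gradient[OF test_function_Ck[OF assms, of "Suc 0"]]
    by (auto intro: borel_measurable_continuous_onI)
  then show "\<psi> \<in> borel_measurable (lebesgue_on A)" "gradient \<psi> \<in> borel_measurable (lebesgue_on A)"
    by (auto intro: borel_measurable_lebesgue_onI)
qed

subsection \<open>Norms\<close>

lemma powr_le_powr_iff:
  fixes a b p :: real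
  assumes "0 < p" "0 \<le> a" "0 \<le> b"
  shows "a powr p \<le> b powr p \<longleftrightarrow> a \<le> b"
  using powr_less_mono2[of p b a] powr_mono2[of p a b] assms by force

text \<open>Eliminates the p-th root and the case distinction at infinity, so that afterwards only
  integrals of p-th powers are estimated.\<close>

lemma Lp_norm_le_iff:
  assumes "0 < p" "0 \<le> c"
  shows "Lp_norm p \<Omega> f \<le> ennreal c \<longleftrightarrow>
    (\<integral>\<^sup>+ x. ennreal (norm (f x) powr p) \<partial>lebesgue_on \<Omega>) \<le> ennreal (c powr p)"
proof (cases "(\<integral>\<^sup>+ x. ennreal (norm (f x) powr p) \<partial>lebesgue_on \<Omega>)")
  case (real r)
  have "r powr (1 / p) \<le> c \<longleftrightarrow> (r powr (1 / p)) powr p \<le> c powr p"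
    using assms by (intro powr_le_powr_iff[symmetric]) auto
  also have "(r powr (1 / p)) powr p = r" using assms real by (simp add: powr_powr)
  finally show ?thesis using real assms by (simp add: Lp_norm_def)
qed (simp add: Lp_norm_def top_unique)

lemma Lp_norm_ge_iff:
  assumes "0 < p" "0 \<le> c"
  shows "ennreal c \<le> Lp_norm p \<Omega> f \<longleftrightarrow>
    ennreal (c powr p) \<le> (\<integral>\<^sup>+ x. ennreal (norm (f x) powr p) \<partial>lebesgue_on \<Omega>)"
proof (cases "(\<integral>\<^sup>+ x. ennreal (norm (f x) powr p) \<partial>lebesgue_on \<Omega>)")
  case (real r)
  have "c \<le> r powr (1 / p) \<longleftrightarrow> c powr p \<le> (r powr (1 / p)) powr p"
    using assms by (intro powr_le_powr_iff[symmetric]) auto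
  also have "(r powr (1 / p)) powr p = r" using assms real by (simp add: powr_powr)
  finally show ?thesis using real assms by (simp add: Lp_norm_def)
qed (simp add: Lp_norm_def)

lemma Lp_norm_eq_iff:
  assumes "0 < p" "0 \<le> c"
  shows "Lp_norm p \<Omega> f = ennreal c \<longleftrightarrow>
    (\<integral>\<^sup>+ x. ennreal (norm (f x) powr p) \<partial>lebesgue_on \<Omega>) = ennreal (c powr p)"
  using Lp_norm_le_iff[OF assms] Lp_norm_ge_iff[OF assms] by (metis antisym order_refl)

lemma Lp_norm_finite_iff:
  "Lp_norm p \<Omega> f < \<infinity> \<longleftrightarrow> (\<integral>\<^sup>+ x. ennreal (norm (f x) powr p) \<partial>lebesgue_on \<Omega>) < \<infinity>"
  by (auto simp: Lp_norm_def Let_def top.not_eq_extremum)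

lemma norm_powr_2 [simp]: "norm x powr 2 = (norm x)\<^sup>2"
  by (simp add: powr_numeral)

lemma ennreal_tendsto_0_iff:
  fixes f :: "nat \<Rightarrow> ennreal"
  shows "f \<longlonglongrightarrow> 0 \<longleftrightarrow> (\<forall>e>0. eventually (\<lambda>n. f n \<le> ennreal e) sequentially)"
proof
  assume L: "f \<longlonglongrightarrow> 0"
  show "\<forall>e>0. eventually (\<lambda>n. f n \<le> ennreal e) sequentially"
  proof (intro allI impI)
    fix e :: real assume "e > 0"
    then have "eventually (\<lambda>n. f n < ennreal e) sequentially"
      by (intro order_tendstoD(2)[OF L]) simp
    then show "eventually (\<lambda>n. f n \<le> ennreal e) sequentially"
      by (rule eventually_mono) simp
  qed
next
  assume *: "\<forall>e>0. eventually (\<lambda>n. f n \<le> ennreal e) sequentially"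
  show "f \<longlonglongrightarrow> 0"
  proof (rule order_tendstoI)
    fix a :: ennreal assume "0 < a"
    then obtain b where b: "0 < b" "b < a" using dense by blast
    then obtain e where e: "b = ennreal e" "0 < e" by (cases b) auto
    show "eventually (\<lambda>n. f n < a) sequentially"
      by (rule eventually_mono[OF *[rule_format, OF e(2)]]) (use b e in auto)
  qed auto
qed

lemma Lp_norm_tendsto_0_iff:
  assumes "0 < p"
  shows "(\<lambda>n. Lp_norm p \<Omega> (f n)) \<longlonglongrightarrow> 0 \<longleftrightarrow>
    (\<lambda>n. \<integral>\<^sup>+ x. ennreal (norm (f n x) powr p) \<partial>lebesgue_on \<Omega>) \<longlonglongrightarrow> 0"
    (is "?L \<longleftrightarrow> ?R")
proof
  assume L: ?L
  show ?R unfolding ennreal_tendsto_0_iff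
  proof (intro allI impI)
    fix e :: real assume "e > 0"
    then have "eventually (\<lambda>n. Lp_norm p \<Omega> (f n) \<le> ennreal (e powr (1/p))) sequentially"
      using L by (auto simp: ennreal_tendsto_0_iff)
    then show "eventually (\<lambda>n. (\<integral>\<^sup>+ x. ennreal (norm (f n x) powr p) \<partial>lebesgue_on \<Omega>) \<le> ennreal e) sequentially"
      using assms \<open>e > 0\<close> by (simp add: Lp_norm_le_iff powr_powr)
  qed
next
  assume R: ?R
  show ?L unfolding ennreal_tendsto_0_iff
    using R assms by (auto simp: Lp_norm_le_iff ennreal_tendsto_0_iff)
qed

section \<open>Square-integrable functions for a general measure\<close>

text \<open>Functions rather than classes, so that the Hilbert space arguments below (expansion of
  squares, Cauchy-Schwarz, completeness) apply directly to \<psi>, u and their gradients, on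
  \<open>lebesgue_on\<close> and on \<open>lborel\<close>.\<close>

definition square_integrable :: "'a measure \<Rightarrow> ('a \<Rightarrow> 'b::euclidean_space) \<Rightarrow> bool" where
  "square_integrable M f \<longleftrightarrow> f \<in> borel_measurable M \<and> integrable M (\<lambda>x. (norm (f x))\<^sup>2)"

lemma square_integrable_iff_nn:
  "square_integrable M f \<longleftrightarrow> f \<in> borel_measurable M \<and> (\<integral>\<^sup>+x. ennreal ((norm (f x))\<^sup>2) \<partial>M) < \<infinity>"
  by (auto simp: square_integrable_def integrable_iff_bounded)

lemma Lp_space_2_iff: "f \<in> Lp_space 2 \<Omega> \<longleftrightarrow> square_integrable (lebesgue_on \<Omega>) f"
  by (simp add: Lp_space_def Lp_norm_finite_iff[unfolded infinity_ennreal_def] square_integrable_iff_nn)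

lemma square_integrable_measurable: "square_integrable M f \<Longrightarrow> f \<in> borel_measurable M"
  by (simp add: square_integrable_def)

lemma square_integrable_inner:
  assumes "square_integrable M f" "square_integrable M g"
  shows "integrable M (\<lambda>x. f x \<bullet> g x)"
proof (rule Bochner_Integration.integrable_bound)
  show "integrable M (\<lambda>x. (norm (f x))\<^sup>2 + (norm (g x))\<^sup>2)"
    using assms by (auto simp: square_integrable_def)
  show "(\<lambda>x. f x \<bullet> g x) \<in> borel_measurable M"
    using assms by (auto simp: square_integrable_def)
  have "norm (f x \<bullet> g x) \<le> norm ((norm (f x))\<^sup>2 + (norm (g x))\<^sup>2)" for x
  proof -
    have "norm (f x \<bullet> g x) \<le> norm (f x) * norm (g x)" by (simp add: Cauchy_Schwarz_ineq2)
    also have "\<dots> \<le> (norm (f x))\<^sup>2 + (norm (g x))\<^sup>2"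
      using sum_squares_bound[of "norm (f x)" "norm (g x)"]
        mult_nonneg_nonneg[OF norm_ge_zero norm_ge_zero, of "f x" "g x"]
      unfolding mult.assoc by linarith
    finally show ?thesis by simp
  qed
  then show "AE x in M. norm (f x \<bullet> g x) \<le> norm ((norm (f x))\<^sup>2 + (norm (g x))\<^sup>2)" by simp
qed

lemma square_integrable_add:
  assumes "square_integrable M f" "square_integrable M g"
  shows "square_integrable M (\<lambda>x. f x + g x)"
proof -
  have "integrable M (\<lambda>x. (norm (f x))\<^sup>2 + 2 * (f x \<bullet> g x) + (norm (g x))\<^sup>2)"
    using assms square_integrable_inner[OF assms] by (auto simp: square_integrable_def)
  then have "integrable M (\<lambda>x. (norm (f x + g x))\<^sup>2)"
    by (simp add: power2_norm_eq_inner inner_add inner_commute algebra_simps)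
  then show ?thesis using assms by (auto simp: square_integrable_def)
qed

lemma square_integrable_scaleR:
  "square_integrable M f \<Longrightarrow> square_integrable M (\<lambda>x. c *\<^sub>R f x)"
  by (auto simp: square_integrable_def power_mult_distrib)

lemma square_integrable_diff:
  assumes "square_integrable M f" "square_integrable M g"
  shows "square_integrable M (\<lambda>x. f x - g x)"
  using square_integrable_add[OF assms(1) square_integrable_scaleR[OF assms(2), of "-1"]] by simp

lemma square_integrable_bounded_mult:
  assumes "square_integrable M f" "h \<in> borel_measurable M" "\<And>x. \<bar>h x\<bar> \<le> B"
  shows "square_integrable M (\<lambda>x. h x *\<^sub>R f x)"
proof -
  have "integrable M (\<lambda>x. (norm (h x *\<^sub>R f x))\<^sup>2)"
  proof (rule Bochner_Integration.integrable_bound)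
    show "integrable M (\<lambda>x. B\<^sup>2 * (norm (f x))\<^sup>2)"
      using assms by (auto simp: square_integrable_def)
    show "(\<lambda>x. (norm (h x *\<^sub>R f x))\<^sup>2) \<in> borel_measurable M"
      using assms by (auto simp: square_integrable_def)
    have "(h x)\<^sup>2 \<le> B\<^sup>2" for x using assms(3)[of x] by (metis abs_ge_zero power2_abs power_mono)
    then show "AE x in M. norm ((norm (h x *\<^sub>R f x))\<^sup>2) \<le> norm (B\<^sup>2 * (norm (f x))\<^sup>2)"
      by (auto simp: power_mult_distrib abs_mult intro!: mult_right_mono)
  qed
  then show ?thesis using assms by (auto simp: square_integrable_def)
qed

text \<open>A quadratic polynomial in t: its nonnegativity yields Cauchy-Schwarz, and at a near
  minimiser of the energy it shows that the first variation almost vanishes.\<close>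

lemma square_integral_expand:
  assumes "square_integrable M f" "square_integrable M g"
  shows "(\<integral>x. (norm (f x + t *\<^sub>R g x))\<^sup>2 \<partial>M) =
    (\<integral>x. (norm (f x))\<^sup>2 \<partial>M) + 2 * t * (\<integral>x. f x \<bullet> g x \<partial>M) + t\<^sup>2 * (\<integral>x. (norm (g x))\<^sup>2 \<partial>M)"
proof -
  have i: "integrable M (\<lambda>x. (norm (f x))\<^sup>2)" "integrable M (\<lambda>x. f x \<bullet> g x)"
    "integrable M (\<lambda>x. (norm (g x))\<^sup>2)"
    using assms square_integrable_inner[OF assms] by (auto simp: square_integrable_def)
  have "(norm (f x + t *\<^sub>R g x))\<^sup>2 = (norm (f x))\<^sup>2 + 2 * t * (f x \<bullet> g x) + t\<^sup>2 * (norm (g x))\<^sup>2" for x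
    unfolding power2_norm_eq_inner power2_eq_square[of t]
    by (simp add: inner_add inner_commute algebra_simps)
  then show ?thesis using i by simp
qed

lemma Cauchy_Schwarz_integral:
  assumes "square_integrable M f" "square_integrable M g"
  shows "(\<integral>x. f x \<bullet> g x \<partial>M)\<^sup>2 \<le> (\<integral>x. (norm (f x))\<^sup>2 \<partial>M) * (\<integral>x. (norm (g x))\<^sup>2 \<partial>M)"
proof -
  let ?A = "\<integral>x. (norm (f x))\<^sup>2 \<partial>M" and ?B = "\<integral>x. f x \<bullet> g x \<partial>M" and ?C = "\<integral>x. (norm (g x))\<^sup>2 \<partial>M"
  have q: "?A + 2 * t * ?B + t\<^sup>2 * ?C \<ge> 0" for t
    unfolding square_integral_expand[OF assms, symmetric] by simp
  have C: "?C \<ge> 0" and A: "?A \<ge> 0" by simp_all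
  show ?thesis
  proof (cases "?C = 0")
    case True
    have "?B = 0"
    proof (rule ccontr)
      assume "?B \<noteq> 0"
      \<comment> \<open>With vanishing leading coefficient the polynomial is affine, and this t
        would give it the value -1.\<close>
      then have *: "2 * (- (?A + 1) / (2 * ?B)) * ?B = - (?A + 1)" by simp
      show False using q[of "- (?A + 1) / (2 * ?B)"] unfolding * True by simp
    qed
    then show ?thesis using True by simp
  next
    case False
    then have "?C > 0" using C by linarith
    have "?A - ?B\<^sup>2 / ?C \<ge> 0"
      using q[of "- ?B / ?C"] \<open>?C > 0\<close> by (simp add: power2_eq_square field_simps)
    then show ?thesis using \<open>?C > 0\<close> by (simp add: field_simps)
  qed
qed

lemma test_function_integrable:
  fixes g :: "real^'n \<Rightarrow> 'b::{banach, second_countable_topology}"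
  assumes "test_function \<Omega> \<psi>" "g \<in> borel_measurable borel" "\<And>x. norm (g x) \<le> B"
    "\<And>x. x \<notin> closure {x. \<psi> x \<noteq> 0} \<Longrightarrow> g x = 0"
    and A: "A \<in> sets borel"
  shows "integrable lborel g" "integrable (lebesgue_on A) g"
proof -
  let ?S = "closure {x. \<psi> x \<noteq> 0}"
  have S: "compact ?S" using assms(1) by (simp add: test_function_def)
  then have fin: "emeasure lborel ?S < \<infinity>"
    by (intro emeasure_bounded_finite compact_imp_bounded)
  have "?S \<in> sets lborel" by (simp add: S borel_compact)
  have B: "B \<ge> 0" using assms(3)[of 0] norm_ge_zero order_trans by blast
  show int: "integrable lborel g"
  proof (rule Bochner_Integration.integrable_bound)
    show "integrable lborel (\<lambda>x. B * indicator ?S x)"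
      using fin S by (auto intro!: integrable_mult_right integrable_real_indicator borel_compact)
    show "AE x in lborel. norm (g x) \<le> norm (B * indicator ?S x)"
      using assms B by (auto simp: indicator_def intro!: AE_I2)
  qed (use assms in simp)
  have "A \<in> sets lebesgue" using A by (auto intro: sets_completionI_sets)
  moreover have "integrable lebesgue (\<lambda>x. indicator A x *\<^sub>R g x)"
    using int A by (simp add: integrable_completion integrable_mult_indicator)
  ultimately show "integrable (lebesgue_on A) g"
    by (subst integrable_restrict_space) auto
qed

lemma test_function_square_integrable:
  assumes "test_function \<Omega> \<psi>" "A \<in> sets borel"
  shows "square_integrable (lebesgue_on A) \<psi>" "square_integrable (lebesgue_on A) (gradient \<psi>)"
    "square_integrable lborel \<psi>" "square_integrable lborel (gradient \<psi>)"
proof -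
  obtain B where B: "B > 0" "\<And>x. \<bar>\<psi> x\<bar> \<le> B" "\<And>x. norm (gradient \<psi> x) \<le> B"
    using test_function_bounded[OF assms(1)] by blast
  have m: "(\<lambda>x. (norm (\<psi> x))\<^sup>2) \<in> borel_measurable borel" "(\<lambda>x. (norm (gradient \<psi> x))\<^sup>2) \<in> borel_measurable borel"
    using test_function_measurable[OF assms(1)] by measurable
  have b: "norm ((norm (\<psi> x))\<^sup>2) \<le> B\<^sup>2" "norm ((norm (gradient \<psi> x))\<^sup>2) \<le> B\<^sup>2" for x
    using B by (auto simp: abs_le_square_iff[symmetric] power_mono)
  have z: "(norm (\<psi> x))\<^sup>2 = 0" "(norm (gradient \<psi> x))\<^sup>2 = 0" if "x \<notin> closure {x. \<psi> x \<noteq> 0}" for x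
    using that gradient_eq_0_outside[OF that] closure_subset[of "{x. \<psi> x \<noteq> 0}"] by auto
  show "square_integrable (lebesgue_on A) \<psi>" "square_integrable (lebesgue_on A) (gradient \<psi>)"
    "square_integrable lborel \<psi>" "square_integrable lborel (gradient \<psi>)"
    unfolding square_integrable_def
    using test_function_measurable[OF assms(1)]
      test_function_integrable[OF assms(1) m(1) b(1) z(1) assms(2)]
      test_function_integrable[OF assms(1) m(2) b(2) z(2) assms(2)] by auto
qed

text \<open>The difference quotients of a compactly supported function have integral zero by
  translation invariance, and they are dominated.\<close>

lemma integral_gradient_nth_eq_0:
  fixes \<phi> :: "real^'n \<Rightarrow> real"
  assumes "test_function UNIV \<phi>"
  shows "(\<integral>x. gradient \<phi> x $ i \<partial>lborel) = 0"
proof -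
  obtain B where B: "B > 0" "\<And>x. \<bar>\<phi> x\<bar> \<le> B" "\<And>x. norm (gradient \<phi> x) \<le> B"
    using test_function_bounded[OF assms] by blast
  let ?S = "closure {x. \<phi> x \<noteq> 0}"
  let ?e = "axis i 1 :: real^'n"
  \<comment> \<open>A unit neighbourhood of the support. The increments have length at most 1, so
    every quotient \<open>q n\<close> vanishes off \<open>S'\<close>, and a constant times its
    indicator dominates them all.\<close>
  define S' where "S' = {x + y | x y. x \<in> ?S \<and> y \<in> cball 0 1}"
  have S: "compact ?S" using assms by (simp add: test_function_def)
  have S': "compact S'" unfolding S'_def by (intro compact_sums S compact_cball)
  define q where "q n x = real (Suc n) * (\<phi> (x + (1 / real (Suc n)) *\<^sub>R ?e) - \<phi> x)" for n x
  have meas [measurable]: "\<phi> \<in> borel_measurable borel" "gradient \<phi> \<in> borel_measurable borel"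
    using test_function_measurable[OF assms] by auto
  have z: "\<phi> x = 0" if "x \<notin> ?S" for x
    using that closure_subset[of "{x. \<phi> x \<noteq> 0}"] by auto
  have int\<phi>: "integrable lborel \<phi>"
  proof (rule test_function_integrable(1)[OF assms meas(1), where B=B and A=UNIV])
    show "norm (\<phi> x) \<le> B" for x using B(2) by simp
    show "\<phi> x = 0" if "x \<notin> ?S" for x using z that by blast
  qed simp
  have int_shift: "integrable lborel (\<lambda>x. \<phi> (x + a))" "(\<integral>x. \<phi> (x + a) \<partial>lborel) = (\<integral>x. \<phi> x \<partial>lborel)" for a
  proof -
    have *: "lborel = distr lborel borel (\<lambda>x. a + x)" by (rule lborel_distr_plus[symmetric])
    show "integrable lborel (\<lambda>x. \<phi> (x + a))"
      using int\<phi> by (subst (asm) *) (simp add: integrable_distr_eq add.commute)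
    show "(\<integral>x. \<phi> (x + a) \<partial>lborel) = (\<integral>x. \<phi> x \<partial>lborel)"
      by (subst (2) *) (simp add: integral_distr add.commute)
  qed
  have q0: "(\<integral>x. q n x \<partial>lborel) = 0" for n
    unfolding q_def using int\<phi> int_shift by simp
  have "(\<lambda>n. \<integral>x. q n x \<partial>lborel) \<longlonglongrightarrow> (\<integral>x. gradient \<phi> x $ i \<partial>lborel)"
  proof (rule integral_dominated_convergence[where w="\<lambda>x. B * indicator S' x"])
    show "(\<lambda>x. gradient \<phi> x $ i) \<in> borel_measurable lborel"
      using test_function_measurable(1)[OF test_function_gradient_nth[OF assms]] by simp
    show "q n \<in> borel_measurable lborel" for n unfolding q_def by simp
    show "integrable lborel (\<lambda>x. B * indicator S' x)"
      using S' by (auto intro!: integrable_mult_right integrable_real_indicator borel_compact emeasure_bounded_finite compact_imp_bounded)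
    show "AE x in lborel. (\<lambda>n. q n x) \<longlonglongrightarrow> gradient \<phi> x $ i"
    proof (rule AE_I2)
      fix x
      have d: "(\<phi> has_derivative (\<lambda>h. gradient \<phi> x \<bullet> h)) (at x)"
        using test_function_differentiable[OF assms] differentiable_iff_has_gradient by blast
      have "((\<lambda>t. x + t *\<^sub>R ?e) has_derivative (\<lambda>t. t *\<^sub>R ?e)) (at 0)"
        by (auto intro!: derivative_eq_intros)
      then have "((\<lambda>t. \<phi> (x + t *\<^sub>R ?e)) has_derivative (\<lambda>t. gradient \<phi> x \<bullet> (t *\<^sub>R ?e))) (at 0)"
        by (rule has_derivative_compose) (use d in simp)
      moreover have "(\<lambda>t. gradient \<phi> x \<bullet> (t *\<^sub>R ?e)) = (*) (gradient \<phi> x $ i)"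
        by (rule ext) (simp add: inner_axis)
      ultimately have "((\<lambda>t. \<phi> (x + t *\<^sub>R ?e)) has_real_derivative gradient \<phi> x $ i) (at 0)"
        by (simp only: has_field_derivative_def)
      then have "((\<lambda>h. (\<phi> (x + h *\<^sub>R ?e) - \<phi> x) / h) \<longlongrightarrow> gradient \<phi> x $ i) (at 0)"
        by (simp add: DERIV_def)
      moreover have "filterlim (\<lambda>n. 1 / real (Suc n)) (at 0) sequentially"
        unfolding filterlim_at using LIMSEQ_inverse_real_of_nat by (simp add: inverse_eq_divide)
      ultimately have "(\<lambda>n. (\<phi> (x + (1 / real (Suc n)) *\<^sub>R ?e) - \<phi> x) / (1 / real (Suc n))) \<longlonglongrightarrow> gradient \<phi> x $ i"
        by (rule filterlim_compose)
      then show "(\<lambda>n. q n x) \<longlonglongrightarrow> gradient \<phi> x $ i"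
        by (simp add: q_def mult.commute)
    qed
    show "AE x in lborel. norm (q n x) \<le> B * indicator S' x" for n
    proof (rule AE_I2)
      fix x
      let ?h = "(1 / real (Suc n)) *\<^sub>R ?e"
      have hn: "norm ?h \<le> 1" by (simp add: norm_axis_1)
      show "norm (q n x) \<le> B * indicator S' x"
      proof (cases "x \<in> S'")
        case True
        have "norm (\<phi> (x + ?h) - \<phi> x) \<le> B * norm (x + ?h - x)"
        proof (rule differentiable_bound[where S=UNIV])
          show "(\<phi> has_derivative (\<lambda>h. gradient \<phi> x \<bullet> h)) (at x within UNIV)" for x
            using test_function_differentiable[OF assms] differentiable_iff_has_gradient by auto
          show "onorm (\<lambda>h. gradient \<phi> x \<bullet> h) \<le> B" for x
          proof (rule onorm_le)
            show "norm (gradient \<phi> x \<bullet> h) \<le> B * norm h" for h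
              using Cauchy_Schwarz_ineq2[of "gradient \<phi> x" h] B(3)[of x]
              by (simp) (meson mult_right_mono norm_ge_zero order_trans)
          qed
        qed auto
        then have "norm (\<phi> (x + ?h) - \<phi> x) \<le> B * (1 / real (Suc n))"
          by (simp add: norm_axis_1)
        then have "real (Suc n) * norm (\<phi> (x + ?h) - \<phi> x) \<le> real (Suc n) * (B * (1 / real (Suc n)))"
          by (rule mult_left_mono) simp
        then show ?thesis using True by (simp add: q_def abs_mult del: of_nat_Suc)
      next
        case False
        have "x \<notin> ?S" using False by (force simp: S'_def intro: exI[of _ x] exI[of _ 0])
        moreover have "x + ?h \<notin> ?S"
        proof
          assume "x + ?h \<in> ?S"
          then have "(x + ?h) + (- ?h) \<in> S'"
            unfolding S'_def using hn by (intro CollectI exI[of _ "x + ?h"] exI[of _ "- ?h"]) auto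
          then show False using False by simp
        qed
        ultimately have "\<phi> x = 0" "\<phi> (x + ?h) = 0"
          using closure_subset[of "{x. \<phi> x \<noteq> 0}"] by auto
        then show ?thesis using False by (simp add: q_def)
      qed
    qed
  qed
  then show ?thesis unfolding q0 by (simp only: LIMSEQ_const_iff)
qed

text \<open>Expand the partial derivative of the product of \<phi> and \<psi>; the product is a test
  function, so the integral of its derivative is 0.\<close>

lemma integral_gradient_nth_by_parts:
  fixes \<phi> \<psi> :: "real^'n \<Rightarrow> real"
  assumes "test_function UNIV \<phi>" "test_function UNIV \<psi>"
  shows "(\<integral>x. \<phi> x * gradient \<psi> x $ i \<partial>lborel) = - (\<integral>x. \<psi> x * gradient \<phi> x $ i \<partial>lborel)"
proof -
  have s: "square_integrable lborel \<phi>" "square_integrable lborel \<psi>"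
    "square_integrable lborel (\<lambda>x. gradient \<phi> x $ i)" "square_integrable lborel (\<lambda>x. gradient \<psi> x $ i)"
    using assms test_function_gradient_nth[OF assms(1)] test_function_gradient_nth[OF assms(2)]
      test_function_square_integrable(3)[of UNIV _ UNIV] by auto
  have "test_function UNIV (\<lambda>x. \<phi> x * \<psi> x)"
    using test_function_mult[OF assms(1)] test_function_Ck[OF assms(2)] by blast
  from integral_gradient_nth_eq_0[OF this, of i]
  have "(\<integral>x. \<phi> x * gradient \<psi> x $ i + \<psi> x * gradient \<phi> x $ i \<partial>lborel) = 0"
    using assms by (simp add: gradient_mult test_function_differentiable)
  moreover have "integrable lborel (\<lambda>x. \<phi> x * gradient \<psi> x $ i)" "integrable lborel (\<lambda>x. \<psi> x * gradient \<phi> x $ i)"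
    using square_integrable_inner[OF s(1) s(4)] square_integrable_inner[OF s(2) s(3)] by auto
  ultimately show ?thesis by simp
qed

subsection \<open>Decomposition into cells\<close>

text \<open>Half-open, so that the cells around the lattice points
  \<open>\<epsilon> *\<^sub>R k\<close> tile the space without overlap and integrals add up
  exactly.\<close>

definition cell :: "real \<Rightarrow> real^'n \<Rightarrow> (real^'n) set" where
  "cell \<epsilon> z = {x. \<forall>i. - \<epsilon> / 2 \<le> x $ i - z $ i \<and> x $ i - z $ i < \<epsilon> / 2}"

lemma cell_borel [measurable]: "cell \<epsilon> z \<in> sets borel"
proof -
  have "cell \<epsilon> z = (\<Inter>i. {x. - \<epsilon> / 2 \<le> x $ i - z $ i} \<inter> {x. x $ i - z $ i < \<epsilon> / 2})"
    by (auto simp: cell_def)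
  also have "\<dots> \<in> sets borel"
    by (intro sets.countable_INT'' sets.Int borel_closed borel_open
        closed_Collect_le open_Collect_less) (auto intro!: continuous_intros)
  finally show ?thesis .
qed

lemma cell_lattice_unique:
  fixes x :: "real^'n"
  assumes "0 < \<epsilon>"
  shows "\<exists>!k. k \<in> int_lattice \<and> x \<in> cell \<epsilon> (\<epsilon> *\<^sub>R k)"
proof
  \<comment> \<open>Rounding to the nearest integer: the cells are centred at the lattice points,
    hence the shift by 1/2.\<close>
  let ?k = "(\<chi> i. of_int \<lfloor>x $ i / \<epsilon> + 1/2\<rfloor>) :: real^'n"
  have "- \<epsilon> / 2 \<le> x $ i - \<epsilon> * of_int \<lfloor>x $ i / \<epsilon> + 1/2\<rfloor>"
    "x $ i - \<epsilon> * of_int \<lfloor>x $ i / \<epsilon> + 1/2\<rfloor> < \<epsilon> / 2" for i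
  proof -
    have "of_int \<lfloor>x $ i / \<epsilon> + 1/2\<rfloor> \<le> x $ i / \<epsilon> + 1/2"
      "x $ i / \<epsilon> + 1/2 < of_int \<lfloor>x $ i / \<epsilon> + 1/2\<rfloor> + 1" by linarith+
    then have "\<epsilon> * of_int \<lfloor>x $ i / \<epsilon> + 1/2\<rfloor> \<le> \<epsilon> * (x $ i / \<epsilon> + 1/2)"
      "\<epsilon> * (x $ i / \<epsilon> + 1/2) < \<epsilon> * (of_int \<lfloor>x $ i / \<epsilon> + 1/2\<rfloor> + 1)" using assms by simp_all
    then show "- \<epsilon> / 2 \<le> x $ i - \<epsilon> * of_int \<lfloor>x $ i / \<epsilon> + 1/2\<rfloor>"
      "x $ i - \<epsilon> * of_int \<lfloor>x $ i / \<epsilon> + 1/2\<rfloor> < \<epsilon> / 2" using assms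
      by (simp_all add: distrib_left)
  qed
  then show "?k \<in> int_lattice \<and> x \<in> cell \<epsilon> (\<epsilon> *\<^sub>R ?k)"
    by (auto simp: int_lattice_def cell_def)
  fix k assume k: "k \<in> int_lattice \<and> x \<in> cell \<epsilon> (\<epsilon> *\<^sub>R k)"
  have "k $ i = of_int \<lfloor>x $ i / \<epsilon> + 1/2\<rfloor>" for i
  proof -
    have "k $ i \<in> \<int>" using k by (simp add: int_lattice_def)
    then obtain m where m: "k $ i = of_int m" using Ints_cases by metis
    have "- \<epsilon> / 2 \<le> x $ i - \<epsilon> * k $ i" "x $ i - \<epsilon> * k $ i < \<epsilon> / 2"
      using k by (auto simp: cell_def)
    then have "of_int m \<le> x $ i / \<epsilon> + 1/2" "x $ i / \<epsilon> + 1/2 < of_int m + 1"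
      using assms m by (simp_all add: field_simps)
    then have "\<lfloor>x $ i / \<epsilon> + 1/2\<rfloor> = m" by linarith
    then show ?thesis using m by simp
  qed
  then show "k = ?k" by (simp add: vec_eq_iff)
qed

lemma nn_integral_eq_sum_cells:
  fixes f :: "real^'n \<Rightarrow> ennreal"
  assumes [measurable]: "f \<in> borel_measurable borel" and "0 < \<epsilon>"
  shows "(\<integral>\<^sup>+x. f x \<partial>lborel) =
    (\<integral>\<^sup>+k. (\<integral>\<^sup>+x. f x * indicator (cell \<epsilon> (\<epsilon> *\<^sub>R k)) x \<partial>lborel) \<partial>count_space int_lattice)"
proof -
  have "f x = (\<integral>\<^sup>+k. f x * indicator (cell \<epsilon> (\<epsilon> *\<^sub>R k)) x \<partial>count_space int_lattice)" for x
  proof -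
    obtain k0 where k0: "k0 \<in> int_lattice" "x \<in> cell \<epsilon> (\<epsilon> *\<^sub>R k0)"
      and u: "\<And>k. k \<in> int_lattice \<Longrightarrow> x \<in> cell \<epsilon> (\<epsilon> *\<^sub>R k) \<Longrightarrow> k = k0"
      using cell_lattice_unique[OF assms(2), of x] by blast
    have "(\<integral>\<^sup>+k. f x * indicator (cell \<epsilon> (\<epsilon> *\<^sub>R k)) x \<partial>count_space int_lattice) =
      (\<integral>\<^sup>+k. f x * indicator {k0} k \<partial>count_space int_lattice)"
    proof (rule nn_integral_cong)
      fix k :: "real^'n" assume "k \<in> space (count_space int_lattice)"
      then have "x \<in> cell \<epsilon> (\<epsilon> *\<^sub>R k) \<longleftrightarrow> k \<in> {k0}" using k0 u[of k] by auto
      then show "f x * indicator (cell \<epsilon> (\<epsilon> *\<^sub>R k)) x = f x * indicator {k0} k"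
        by (simp only: indicator_def)
    qed
    also have "\<dots> = f x * emeasure (count_space int_lattice) {k0}"
      using k0 by (intro nn_integral_cmult_indicator) simp
    also have "\<dots> = f x" using k0 by simp
    finally show ?thesis by simp
  qed
  then have "(\<integral>\<^sup>+x. f x \<partial>lborel) = (\<integral>\<^sup>+x. (\<integral>\<^sup>+k. f x * indicator (cell \<epsilon> (\<epsilon> *\<^sub>R k)) x \<partial>count_space int_lattice) \<partial>lborel)"
    by (rule nn_integral_cong)
  also have "\<dots> = (\<integral>\<^sup>+k. (\<integral>\<^sup>+x. f x * indicator (cell \<epsilon> (\<epsilon> *\<^sub>R k)) x \<partial>lborel) \<partial>count_space int_lattice)"
    by (rule nn_integral_count_space_nn_integral[OF countable_int_lattice]) measurable
  finally show ?thesis .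
qed

text \<open>Sums over cells are integrals over \<open>count_space int_lattice\<close>, so a cellwise
  inequality passes to the whole space with its constant unchanged and without any summability
  question.\<close>

lemma nn_integral_mono_cells:
  fixes f g :: "real^'n \<Rightarrow> ennreal"
  assumes "f \<in> borel_measurable borel" "g \<in> borel_measurable borel" "0 < \<epsilon>"
    and "\<And>k. k \<in> int_lattice \<Longrightarrow> (\<integral>\<^sup>+x. f x * indicator (cell \<epsilon> (\<epsilon> *\<^sub>R k)) x \<partial>lborel) \<le>
        (\<integral>\<^sup>+x. g x * indicator (cell \<epsilon> (\<epsilon> *\<^sub>R k)) x \<partial>lborel)"
  shows "(\<integral>\<^sup>+x. f x \<partial>lborel) \<le> (\<integral>\<^sup>+x. g x \<partial>lborel)"
  unfolding nn_integral_eq_sum_cells[OF assms(1,3)] nn_integral_eq_sum_cells[OF assms(2,3)]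
  by (rule nn_integral_mono) (simp add: assms(4))

section \<open>The Poincare inequality\<close>

lemma nn_integral_lborel_affine:
  fixes f :: "'a::euclidean_space \<Rightarrow> ennreal"
  assumes [measurable]: "f \<in> borel_measurable borel" and "c \<noteq> 0"
  shows "(\<integral>\<^sup>+y. f y \<partial>lborel) = ennreal (\<bar>c\<bar> ^ DIM('a)) * (\<integral>\<^sup>+x. f (a + c *\<^sub>R x) \<partial>lborel)"
  by (subst lborel_affine[OF assms(2), of a])
     (simp add: nn_integral_density nn_integral_distr nn_integral_cmult)

lemma norm_cell_le:
  fixes x :: "real^'n"
  assumes "x \<in> cell \<epsilon> z" "0 < \<epsilon>"
  shows "(norm (x - z))\<^sup>2 \<le> real CARD('n) * (\<epsilon> / 2)\<^sup>2"
proof -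
  have "(norm (x - z))\<^sup>2 = (\<Sum>i\<in>UNIV. (x $ i - z $ i)\<^sup>2)"
    unfolding power2_norm_eq_inner by (simp add: inner_vec_def power2_eq_square)
  also have "\<dots> \<le> (\<Sum>i\<in>(UNIV::'n set). (\<epsilon> / 2)\<^sup>2)"
  proof (rule sum_mono)
    fix i
    have "- \<epsilon> / 2 \<le> x $ i - z $ i \<and> x $ i - z $ i < \<epsilon> / 2" using assms by (simp add: cell_def)
    then have "\<bar>x $ i - z $ i\<bar> \<le> \<bar>\<epsilon> / 2\<bar>" by linarith
    then show "(x $ i - z $ i)\<^sup>2 \<le> (\<epsilon> / 2)\<^sup>2" by (simp only: abs_le_square_iff)
  qed
  finally show ?thesis by simp
qed

text \<open>Cauchy-Schwarz with the weights w and 1/w, obtained by integrating the completed square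
  S a(t) \<le> S^2 / (2 \<kappa> w(t)) + \<kappa> w(t) a(t)^2 / 2; taking the total S as multiplier
  makes half of S^2 cancel.\<close>

lemma sq_le_weighted_integral:
  fixes a w :: "real \<Rightarrow> real"
  assumes a: "(a has_integral S) {s..1}" and w: "((\<lambda>t. 1 / w t) has_integral \<kappa>) {s..1}"
    and J: "((\<lambda>t. w t * (a t)\<^sup>2) has_integral J) {s..1}"
    and pos: "\<And>t. t \<in> {s..1} \<Longrightarrow> 0 < w t" "0 < \<kappa>"
  shows "S\<^sup>2 \<le> \<kappa> * J"
proof -
  have "S * S \<le> S\<^sup>2 / (2 * \<kappa>) * \<kappa> + \<kappa> / 2 * J"
  proof (rule has_integral_le)
    show "((\<lambda>t. S * a t) has_integral S * S) {s..1}" using a by (rule has_integral_mult_right)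
    show "((\<lambda>t. S\<^sup>2 / (2 * \<kappa>) * (1 / w t) + \<kappa> / 2 * (w t * (a t)\<^sup>2)) has_integral
        S\<^sup>2 / (2 * \<kappa>) * \<kappa> + \<kappa> / 2 * J) {s..1}"
      by (intro has_integral_add has_integral_mult_right w J)
    fix t assume "t \<in> {s..1}"
    then have wt: "0 < w t" using pos by blast
    have "0 \<le> (S - \<kappa> * w t * a t)\<^sup>2 / (2 * \<kappa> * w t)" using wt pos(2) by simp
    also have "\<dots> = S\<^sup>2 / (2 * \<kappa>) * (1 / w t) + \<kappa> / 2 * (w t * (a t)\<^sup>2) - S * a t"
      using wt pos(2) by (simp add: field_simps power2_eq_square)
    finally show "S * a t \<le> S\<^sup>2 / (2 * \<kappa>) * (1 / w t) + \<kappa> / 2 * (w t * (a t)\<^sup>2)" by simp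
  qed
  then show ?thesis using pos(2) by (simp add: power2_eq_square)
qed

text \<open>Integration along rays from the centre of the cell replaces polar coordinates; only a fraction
  \<open>1 - s\<close> of each ray is used because \<open>\<psi>\<close> vanishes near the centre.\<close>

lemma sq_le_ray_integral:
  fixes \<psi> :: "real^'n \<Rightarrow> real"
  assumes \<psi>: "Ck (Suc 0) \<psi>" and s: "0 < s" "s < 1" and zero: "\<psi> (z + s *\<^sub>R (x - z)) = 0"
    and \<kappa>: "((\<lambda>t. 1 / t ^ m) has_integral \<kappa>) {s..1}" "0 < \<kappa>"
  shows "ennreal ((\<psi> x)\<^sup>2) \<le> ennreal \<kappa> *
    (\<integral>\<^sup>+t. indicator {s..1} t * ennreal (t ^ m * ((norm (x - z))\<^sup>2 *
      (norm (gradient \<psi> (z + t *\<^sub>R (x - z))))\<^sup>2)) \<partial>lborel)"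
proof -
  let ?a = "\<lambda>t. gradient \<psi> (z + t *\<^sub>R (x - z)) \<bullet> (x - z)"
  let ?b = "\<lambda>t. t ^ m * ((norm (x - z))\<^sup>2 * (norm (gradient \<psi> (z + t *\<^sub>R (x - z))))\<^sup>2)"
  have cg: "continuous_on A (\<lambda>t. gradient \<psi> (z + t *\<^sub>R (x - z)))" for A
    by (rule continuous_on_compose2[OF continuous_gradient[OF \<psi>]]) (auto intro!: continuous_intros)
  have "((\<lambda>t. \<psi> (z + t *\<^sub>R (x - z))) has_vector_derivative ?a t) (at t within {s..1})" for t
  proof -
    have "((\<lambda>t. z + t *\<^sub>R (x - z)) has_derivative (\<lambda>h. h *\<^sub>R (x - z))) (at t within {s..1})"
      by (auto intro!: derivative_eq_intros)
    then have "((\<lambda>t. \<psi> (z + t *\<^sub>R (x - z))) has_derivative (\<lambda>h. gradient \<psi> (z + t *\<^sub>R (x - z)) \<bullet> (h *\<^sub>R (x - z))))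
      (at t within {s..1})"
      by (rule has_derivative_compose)
         (rule differentiable_iff_has_gradient[THEN iffD1, OF Ck_1_differentiable[OF \<psi>]])
    then show ?thesis by (simp add: has_vector_derivative_def)
  qed
  then have "(?a has_integral \<psi> (z + 1 *\<^sub>R (x - z)) - \<psi> (z + s *\<^sub>R (x - z))) {s..1}"
    using s by (intro fundamental_theorem_of_calculus) auto
  then have a: "(?a has_integral \<psi> x) {s..1}" using zero by simp
  have "(\<lambda>t. t ^ m * (?a t)\<^sup>2) integrable_on {s..1}"
    by (intro integrable_continuous_real continuous_intros cg)
  then obtain J where J: "((\<lambda>t. t ^ m * (?a t)\<^sup>2) has_integral J) {s..1}" by (auto simp: integrable_on_def)
  have "?b integrable_on {s..1}"
    by (intro integrable_continuous_real continuous_intros cg)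
  then obtain K where K: "(?b has_integral K) {s..1}" by (auto simp: integrable_on_def)
  \<comment> \<open>The weight is t^m, later with m = d - 1, to compensate the Jacobian of the
    dilation by t when the estimate is integrated over x.\<close>
  have "(\<psi> x)\<^sup>2 \<le> \<kappa> * J"
    by (rule sq_le_weighted_integral[OF a \<kappa>(1) J _ \<kappa>(2)]) (use s in auto)
  moreover have "J \<le> K"
  proof (rule has_integral_le[OF J K])
    fix t assume "t \<in> {s..1}"
    have "(?a t)\<^sup>2 \<le> (norm (x - z) * norm (gradient \<psi> (z + t *\<^sub>R (x - z))))\<^sup>2"
      using Cauchy_Schwarz_ineq2[of "gradient \<psi> (z + t *\<^sub>R (x - z))" "x - z"]
      by (metis abs_ge_zero mult.commute power2_abs power_mono)
    then show "t ^ m * (?a t)\<^sup>2 \<le> ?b t" using s \<open>t \<in> {s..1}\<close>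
      by (intro mult_left_mono) (auto simp: power_mult_distrib)
  qed
  moreover have "ennreal K = (\<integral>\<^sup>+t. indicator {s..1} t * ennreal (?b t) \<partial>lborel)"
  proof -
    let ?c = "\<lambda>t. indicator {s..1} t * ?b t"
    have [measurable]: "?b \<in> borel_measurable borel"
      by (intro borel_measurable_continuous_onI continuous_intros cg)
    have "(?c has_integral K) UNIV"
    proof (rule has_integral_eq[OF _ has_integral_restrict_UNIV[THEN iffD2, OF K]])
    qed auto
    then have "(\<integral>\<^sup>+t. ennreal (?c t) \<partial>lborel) = ennreal K"
      by (intro nn_integral_has_integral_lborel) (use s in \<open>auto simp: indicator_def\<close>)
    moreover have "ennreal (?c t) = indicator {s..1} t * ennreal (?b t)" for t
      by (auto simp: indicator_def)
    ultimately show ?thesis by simp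
  qed
  moreover have "ennreal (\<kappa> * K) = ennreal \<kappa> * ennreal K"
    using \<kappa>(2) by (intro ennreal_mult') simp
  moreover have "\<kappa> * J \<le> \<kappa> * K" using \<open>J \<le> K\<close> \<kappa>(2) by (intro mult_left_mono) simp_all
  ultimately show ?thesis
    using ennreal_leI[of "(\<psi> x)\<^sup>2" "\<kappa> * K"] by simp
qed

lemma nn_integral_inverse_cube:
  fixes \<tau> :: real
  assumes "0 < \<tau>"
  shows "(\<integral>\<^sup>+t. ennreal (1 / t ^ 3) * indicator {\<tau>..} t \<partial>lborel) = ennreal (1 / (2 * \<tau>\<^sup>2))"
proof -
  have "(\<integral>\<^sup>+t. ennreal (1 / t ^ 3) * indicator {\<tau>..} t \<partial>lborel) = ennreal (0 - (- 1 / (2 * \<tau>\<^sup>2)))"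
  proof (rule nn_integral_FTC_atLeast)
    show "((\<lambda>t. - 1 / (2 * t\<^sup>2)) has_real_derivative 1 / t ^ 3) (at t)" if "\<tau> \<le> t" for t
      using that assms by (auto intro!: derivative_eq_intros simp: field_simps power2_eq_square power3_eq_cube)
    show "((\<lambda>t::real. - 1 / (2 * t\<^sup>2)) \<longlongrightarrow> 0) at_top"
      by (intro tendsto_divide_0[OF tendsto_const] filterlim_at_top_imp_at_infinity
          filterlim_tendsto_pos_mult_at_top[OF tendsto_const] filterlim_pow_at_top filterlim_ident) auto
  qed (use assms in auto)
  then show ?thesis by simp
qed

text \<open>This kernel is what remains after the dilation. A point at distance r from the centre is
  reached only at times t \<ge> r / sqrt e, and the factor r^2 exactly offsets the growth of the
  integral of t^(-3) from there on, so the bound does not depend on r.\<close>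

lemma nn_integral_ray_weight:
  fixes r e :: real
  assumes "0 \<le> r" "0 < e"
  shows "(\<integral>\<^sup>+t. (if 0 < t \<and> r\<^sup>2 \<le> t\<^sup>2 * e then ennreal (r\<^sup>2 / t ^ 3) else 0) \<partial>lborel) \<le> ennreal (e / 2)"
proof (cases "r = 0")
  case False
  define \<tau> where "\<tau> = r / sqrt e"
  have \<tau>: "\<tau> > 0" "\<tau>\<^sup>2 = r\<^sup>2 / e" using assms False by (auto simp: \<tau>_def power_divide)
  have "(\<integral>\<^sup>+t. (if 0 < t \<and> r\<^sup>2 \<le> t\<^sup>2 * e then ennreal (r\<^sup>2 / t ^ 3) else 0) \<partial>lborel)
     \<le> (\<integral>\<^sup>+t. ennreal (r\<^sup>2) * (ennreal (1 / t ^ 3) * indicator {\<tau>..} t) \<partial>lborel)"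
  proof (rule nn_integral_mono)
    fix t :: real
    have "\<tau> \<le> t" if "0 < t" "r\<^sup>2 \<le> t\<^sup>2 * e"
    proof (rule power2_le_imp_le)
      show "\<tau>\<^sup>2 \<le> t\<^sup>2" using that assms by (simp add: \<tau>(2) divide_le_eq)
    qed (use that in simp)
    then show "(if 0 < t \<and> r\<^sup>2 \<le> t\<^sup>2 * e then ennreal (r\<^sup>2 / t ^ 3) else 0)
      \<le> ennreal (r\<^sup>2) * (ennreal (1 / t ^ 3) * indicator {\<tau>..} t)"
      by (auto simp: ennreal_mult[symmetric])
  qed
  also have "\<dots> = ennreal (r\<^sup>2) * ennreal (1 / (2 * \<tau>\<^sup>2))"
    using nn_integral_inverse_cube[OF \<tau>(1)] by (simp add: nn_integral_cmult)
  also have "\<dots> = ennreal (e / 2)"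
    using False assms by (simp add: ennreal_mult[symmetric] \<tau>(2))
  finally show ?thesis .
next
  case True
  have "(\<integral>\<^sup>+t. (if 0 < t \<and> r\<^sup>2 \<le> t\<^sup>2 * e then ennreal (r\<^sup>2 / t ^ 3) else 0) \<partial>lborel) = (\<integral>\<^sup>+(t::real). 0 \<partial>lborel)"
    using True by (intro nn_integral_cong) simp
  then show ?thesis by simp
qed

text \<open>Integrate the ray estimate over the cell and exchange the integrals. For fixed t the
  substitution y = z + t (x - z) maps the cell into itself; exchanging back leaves a kernel in t
  whose integral is bounded by half the squared circumradius \<open>e\<close> of the cell.\<close>

lemma poincare_cell:
  fixes \<psi> :: "real^'n \<Rightarrow> real"
  assumes \<psi>: "Ck (Suc 0) \<psi>" and s: "0 < s" "s < 1" and \<epsilon>: "0 < \<epsilon>"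
    and zero: "\<And>x. x \<in> cell \<epsilon> z \<Longrightarrow> \<psi> (z + s *\<^sub>R (x - z)) = 0"
    and \<kappa>: "((\<lambda>t. 1 / t ^ (CARD('n) - 1)) has_integral \<kappa>) {s..1}" "0 < \<kappa>"
  shows "(\<integral>\<^sup>+x. ennreal ((\<psi> x)\<^sup>2) * indicator (cell \<epsilon> z) x \<partial>lborel) \<le>
    ennreal (\<kappa> * (real CARD('n) * \<epsilon>\<^sup>2 / 8)) *
      (\<integral>\<^sup>+x. ennreal ((norm (gradient \<psi> x))\<^sup>2) * indicator (cell \<epsilon> z) x \<partial>lborel)"
proof -
  let ?Q = "cell \<epsilon> z" and ?m = "CARD('n) - 1" and ?I = "{s..1}"
  define e where "e = real CARD('n) * (\<epsilon> / 2)\<^sup>2"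
  have e: "e > 0" using \<epsilon> by (simp add: e_def)
  define g where "g y = (norm (gradient \<psi> y))\<^sup>2" for y
  have [measurable]: "g \<in> borel_measurable borel"
    unfolding g_def by (intro borel_measurable_continuous_onI continuous_intros continuous_gradient[OF \<psi>])
  define F where "F t x = indicator ?Q x * (indicator ?I t * ennreal (t ^ ?m * ((norm (x - z))\<^sup>2 *
      g (z + t *\<^sub>R (x - z)))))" for t x
  \<comment> \<open>\<open>F\<close> in the variable y: the weight t^(d-1), the Jacobian t^(-d) and
    the factor t^(-2) from |x - z|^2 combine to t^(-3). The condition that the preimage x lies in
    the cell is weakened to y in the cell with |y - z|^2 \<le> t^2 e.\<close>
  define H where "H t y = indicator ?I t * (indicator ?Q y * (ennreal (g y) *
    (if 0 < t \<and> (norm (y - z))\<^sup>2 \<le> t\<^sup>2 * e then ennreal ((norm (y - z))\<^sup>2 / t ^ 3) else 0)))" for t y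
  have [measurable]: "case_prod F \<in> borel_measurable (lborel \<Otimes>\<^sub>M lborel)"
    "case_prod H \<in> borel_measurable (lborel \<Otimes>\<^sub>M lborel)" unfolding F_def H_def by measurable
  have FH: "(\<integral>\<^sup>+x. F t x \<partial>lborel) \<le> (\<integral>\<^sup>+y. H t y \<partial>lborel)" for t
  proof (cases "t \<in> ?I")
    case True
    then have t: "0 < t" "t \<le> 1" using s by auto
    let ?f = "\<lambda>y. indicator ?Q (z + (1/t) *\<^sub>R (y - z)) * ennreal ((norm (y - z))\<^sup>2 / t ^ 3 * g y)"
    have "(\<integral>\<^sup>+y. ?f y \<partial>lborel) = ennreal (\<bar>t\<bar> ^ CARD('n)) * (\<integral>\<^sup>+x. ?f ((z - t *\<^sub>R z) + t *\<^sub>R x) \<partial>lborel)"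
      using t by (subst nn_integral_lborel_affine[where c=t and a="z - t *\<^sub>R z"]) simp_all
    also have "\<dots> = (\<integral>\<^sup>+x. ennreal (\<bar>t\<bar> ^ CARD('n)) * ?f ((z - t *\<^sub>R z) + t *\<^sub>R x) \<partial>lborel)"
      by (subst nn_integral_cmult) simp_all
    also have "\<dots> = (\<integral>\<^sup>+x. F t x \<partial>lborel)"
    proof (rule nn_integral_cong)
      fix x
      have 1: "(z - t *\<^sub>R z) + t *\<^sub>R x - z = t *\<^sub>R (x - z)" by (simp add: algebra_simps)
      have 2: "(z - t *\<^sub>R z) + t *\<^sub>R x = z + t *\<^sub>R (x - z)" by (simp add: algebra_simps)
      have 3: "z + (1/t) *\<^sub>R (t *\<^sub>R (x - z)) = x" using t by simp
      have C: "CARD('n) = Suc ?m" by simp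
      have 4: "t ^ CARD('n) * ((t * r)\<^sup>2 / t ^ 3 * h) = t ^ ?m * (r\<^sup>2 * h)" for r h
      proof -
        have "t ^ CARD('n) = t * t ^ ?m" using power_Suc[of t ?m] by (simp only: C[symmetric])
        then show ?thesis using t by (simp add: power2_eq_square power3_eq_cube)
      qed
      have "ennreal (\<bar>t\<bar> ^ CARD('n)) * ?f ((z - t *\<^sub>R z) + t *\<^sub>R x) =
        indicator ?Q x * (ennreal (t ^ CARD('n)) * ennreal ((t * norm (x - z))\<^sup>2 / t ^ 3 * g (z + t *\<^sub>R (x - z))))"
        unfolding 1 3 unfolding 2 using t by (simp add: mult_ac)
      also have "\<dots> = indicator ?Q x * ennreal (t ^ CARD('n) * ((t * norm (x - z))\<^sup>2 / t ^ 3 * g (z + t *\<^sub>R (x - z))))"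
        using t by (subst ennreal_mult[symmetric]) (simp_all add: g_def)
      also have "\<dots> = F t x" unfolding 4 F_def using True by simp
      finally show "ennreal (\<bar>t\<bar> ^ CARD('n)) * ?f ((z - t *\<^sub>R z) + t *\<^sub>R x) = F t x" .
    qed
    finally have "(\<integral>\<^sup>+x. F t x \<partial>lborel) = (\<integral>\<^sup>+y. ?f y \<partial>lborel)" by simp
    also have "\<dots> \<le> (\<integral>\<^sup>+y. H t y \<partial>lborel)"
    proof (rule nn_integral_mono)
      fix y
      show "?f y \<le> H t y"
      proof (cases "z + (1/t) *\<^sub>R (y - z) \<in> ?Q")
        case True
        \<comment> \<open>The cell is star-shaped about z, so shrinking by t \<le> 1 keeps y
          inside.\<close>
        have "- \<epsilon> / 2 \<le> y $ i - z $ i \<and> y $ i - z $ i < \<epsilon> / 2" for i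
        proof -
          have "- \<epsilon> / 2 \<le> (y $ i - z $ i) / t" "(y $ i - z $ i) / t < \<epsilon> / 2"
            using True by (auto simp: cell_def)
          then have "t * (- \<epsilon> / 2) \<le> y $ i - z $ i" "y $ i - z $ i < t * (\<epsilon> / 2)"
            using t by (simp_all add: field_simps)
          moreover have "t * (\<epsilon> / 2) \<le> \<epsilon> / 2" using t \<epsilon> by simp
          ultimately show ?thesis by auto
        qed
        then have yQ: "y \<in> ?Q" by (simp add: cell_def)
        have "(norm ((1/t) *\<^sub>R (y - z)))\<^sup>2 \<le> e"
          using norm_cell_le[OF True \<epsilon>] by (simp add: e_def)
        then have "(norm (y - z))\<^sup>2 \<le> t\<^sup>2 * e"
          using t by (simp add: power_mult_distrib power_divide divide_le_eq mult.commute)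
        then show ?thesis using True yQ t \<open>t \<in> ?I\<close>
          by (simp add: H_def ennreal_mult[symmetric] g_def mult.commute)
      qed simp
    qed
    finally show ?thesis .
  qed (simp add: F_def)
  have Hb: "(\<integral>\<^sup>+t. H t y \<partial>lborel) \<le> ennreal (e / 2) * (ennreal (g y) * indicator ?Q y)" for y
  proof -
    let ?h = "\<lambda>t. (if 0 < t \<and> (norm (y - z))\<^sup>2 \<le> t\<^sup>2 * e then ennreal ((norm (y - z))\<^sup>2 / t ^ 3) else 0)"
    have "(\<integral>\<^sup>+t. H t y \<partial>lborel) \<le> (\<integral>\<^sup>+t. (ennreal (g y) * indicator ?Q y) * ?h t \<partial>lborel)"
      by (rule nn_integral_mono) (auto simp: H_def indicator_def)
    also have "\<dots> = (ennreal (g y) * indicator ?Q y) * (\<integral>\<^sup>+t. ?h t \<partial>lborel)"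
      by (rule nn_integral_cmult) measurable
    also have "\<dots> \<le> (ennreal (g y) * indicator ?Q y) * ennreal (e / 2)"
      by (intro mult_left_mono nn_integral_ray_weight) (use e in auto)
    finally show ?thesis by (simp add: mult.commute)
  qed
  have "(\<integral>\<^sup>+x. ennreal ((\<psi> x)\<^sup>2) * indicator ?Q x \<partial>lborel) \<le> (\<integral>\<^sup>+x. ennreal \<kappa> * (\<integral>\<^sup>+t. F t x \<partial>lborel) \<partial>lborel)"
  proof (rule nn_integral_mono)
    fix x
    show "ennreal ((\<psi> x)\<^sup>2) * indicator ?Q x \<le> ennreal \<kappa> * (\<integral>\<^sup>+t. F t x \<partial>lborel)"
      using sq_le_ray_integral[OF \<psi> s zero \<kappa>, of x]
      by (cases "x \<in> ?Q") (simp_all add: F_def g_def)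
  qed
  also have "\<dots> = ennreal \<kappa> * (\<integral>\<^sup>+x. (\<integral>\<^sup>+t. F t x \<partial>lborel) \<partial>lborel)"
    by (rule nn_integral_cmult) measurable
  also have "(\<integral>\<^sup>+x. (\<integral>\<^sup>+t. F t x \<partial>lborel) \<partial>lborel) = (\<integral>\<^sup>+t. (\<integral>\<^sup>+x. F t x \<partial>lborel) \<partial>lborel)"
    by (rule lborel_pair.Fubini') simp
  also have "\<dots> \<le> (\<integral>\<^sup>+t. (\<integral>\<^sup>+y. H t y \<partial>lborel) \<partial>lborel)"
    by (rule nn_integral_mono) (rule FH)
  also have "\<dots> = (\<integral>\<^sup>+y. (\<integral>\<^sup>+t. H t y \<partial>lborel) \<partial>lborel)"
    by (rule lborel_pair.Fubini'[symmetric]) simp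
  also have "\<dots> \<le> (\<integral>\<^sup>+y. ennreal (e / 2) * (ennreal (g y) * indicator ?Q y) \<partial>lborel)"
    by (rule nn_integral_mono) (rule Hb)
  also have "\<dots> = ennreal (e / 2) * (\<integral>\<^sup>+y. ennreal (g y) * indicator ?Q y \<partial>lborel)"
    by (rule nn_integral_cmult) measurable
  finally have "(\<integral>\<^sup>+x. ennreal ((\<psi> x)\<^sup>2) * indicator ?Q x \<partial>lborel) \<le>
     ennreal \<kappa> * (ennreal (e / 2) * (\<integral>\<^sup>+y. ennreal (g y) * indicator ?Q y \<partial>lborel))"
    by (simp add: mult_left_mono)
  also have "\<dots> = ennreal (\<kappa> * (e / 2)) * (\<integral>\<^sup>+y. ennreal (g y) * indicator ?Q y \<partial>lborel)"
    using \<kappa>(2) e by (subst ennreal_mult) (auto simp: mult.assoc)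
  finally show ?thesis by (simp add: e_def g_def power_divide)
qed

text \<open>The Poincare length is \<epsilon> times this factor. Its square is, up to constants, the
  integral of t^(1-d) from \<eta> to 1, kept away from 0; for d = 2 that is the purpose of \<eta>/2
  in place of \<eta>, as the logarithm would vanish at \<eta> = 1.\<close>

definition scale_factor :: "nat \<Rightarrow> real \<Rightarrow> real" where
  "scale_factor d \<eta> = (if d = 2 then \<bar>ln (\<eta> / 2)\<bar> powr (1 / 2) else \<eta> powr ((2 - real d) / 2))"

lemma scale_factor_sq:
  assumes "2 \<le> d" "0 < \<eta>" "\<eta> \<le> 1"
  shows "(scale_factor d \<eta>)\<^sup>2 = (if d = 2 then ln 2 - ln \<eta> else 1 / \<eta> ^ (d - 2))"
proof (cases "d = 2")
  case True
  have "ln (\<eta> / 2) = ln \<eta> - ln 2" "ln \<eta> \<le> 0" using assms by (auto simp: ln_div)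
  moreover have "ln (2::real) > 0" by simp
  ultimately have "\<bar>ln (\<eta> / 2)\<bar> = ln 2 - ln \<eta>" by linarith
  then show ?thesis using True by (simp add: scale_factor_def powr_half_sqrt)
next
  case False
  have "(scale_factor d \<eta>)\<^sup>2 = \<eta> powr (2 - real d)"
    using False assms by (simp add: scale_factor_def power2_eq_square powr_add[symmetric])
  also have "2 - real d = - real (d - 2)" using assms by (simp add: of_nat_diff)
  also have "\<eta> powr (- real (d - 2)) = 1 / \<eta> ^ (d - 2)"
    unfolding powr_minus using assms by (subst powr_realpow) (auto simp: divide_inverse)
  finally show ?thesis using False by simp
qed

text \<open>This identifies the cost \<kappa> of the ray estimate: for rays starting at the relative
  distance c \<eta> it is controlled by the squared scale factor, with a constant chosen before
  \<eta>.\<close>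

lemma ray_weight_bound:
  assumes "2 \<le> d" "0 < c" "c < 1"
  obtains C where "C > 0"
    "\<And>\<eta>. 0 < \<eta> \<Longrightarrow> \<eta> \<le> 1 \<Longrightarrow> \<exists>\<kappa>. 0 < \<kappa> \<and> \<kappa> \<le> C * (scale_factor d \<eta>)\<^sup>2 \<and>
        ((\<lambda>t. 1 / t ^ (d - 1)) has_integral \<kappa>) {c * \<eta>..1}"
proof (cases "d = 2")
  case True
  \<comment> \<open>Chosen so that A ln 2 = - ln c; then - ln (c \<eta>) = A ln 2 - ln \<eta> is at
    most (1 + A) (ln 2 - ln \<eta>), also at \<eta> = 1.\<close>
  define A where "A = (- ln c) / ln 2"
  define C where "C = 1 + A"
  have lc: "A * ln 2 = - ln c" by (simp add: A_def)
  have "- ln c > 0" using assms by simp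
  then have A: "A > 0" unfolding A_def by (intro divide_pos_pos) simp_all
  show ?thesis
  proof (rule that[of C])
    show "C > 0" using A by (simp add: C_def)
    fix \<eta> :: real assume \<eta>: "0 < \<eta>" "\<eta> \<le> 1"
    have "c * \<eta> < 1" using \<eta> assms by (smt (verit) mult_left_le mult_pos_pos)
    then have s: "0 < c * \<eta>" "c * \<eta> < 1" using \<eta> assms by auto
    have "((\<lambda>t. 1 / t) has_integral ln 1 - ln (c * \<eta>)) {c * \<eta>..1}"
      using s by (intro fundamental_theorem_of_calculus)
         (auto intro!: derivative_eq_intros simp: has_real_derivative_iff_has_vector_derivative[symmetric])
    moreover have "- ln (c * \<eta>) > 0" using s by simp
    moreover have "- ln (c * \<eta>) \<le> C * (ln 2 - ln \<eta>)"
    proof -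
      have "- ln \<eta> \<ge> 0" using \<eta> by simp
      then have "A * (- ln \<eta>) \<ge> 0" using A by (intro mult_nonneg_nonneg) simp_all
      moreover have "C * (ln 2 - ln \<eta>) = ln 2 - ln \<eta> + A * ln 2 + A * (- ln \<eta>)"
        by (simp add: C_def algebra_simps)
      moreover have "ln (c * \<eta>) = ln c + ln \<eta>" using \<eta> assms by (simp add: ln_mult)
      moreover have "ln (2::real) > 0" by simp
      ultimately show ?thesis using lc by linarith
    qed
    ultimately show "\<exists>\<kappa>. 0 < \<kappa> \<and> \<kappa> \<le> C * (scale_factor d \<eta>)\<^sup>2 \<and>
        ((\<lambda>t. 1 / t ^ (d - 1)) has_integral \<kappa>) {c * \<eta>..1}"
      using True \<eta> scale_factor_sq[of 2 \<eta>] by (intro exI[of _ "- ln (c * \<eta>)"]) auto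
  qed
next
  case False
  \<comment> \<open>Here d \<ge> 3; with n = d - 3 the exponents d - 1 and d - 2 are n + 2 and n +
    1, free of truncated subtraction.\<close>
  define n where "n = d - 3"
  have d: "d - 1 = n + 2" "d - 2 = n + 1" using False assms by (auto simp: n_def)
  show ?thesis
  proof (rule that[of "1 / c ^ (n + 1)"])
    show "1 / c ^ (n + 1) > 0" using assms by simp
    fix \<eta> :: real assume \<eta>: "0 < \<eta>" "\<eta> \<le> 1"
    have "c * \<eta> < 1" using \<eta> assms by (smt (verit) mult_left_le mult_pos_pos)
    then have s: "0 < c * \<eta>" "c * \<eta> < 1" using \<eta> assms by auto
    let ?F = "\<lambda>t::real. - 1 / (real (n + 1) * t ^ (n + 1))"
    have "(?F has_real_derivative 1 / t ^ (n + 2)) (at t within {c * \<eta>..1})" if "t > 0" for t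
      using that by (auto intro!: derivative_eq_intros simp: divide_simps) (cases n; simp add: algebra_simps)
    then have "((\<lambda>t. 1 / t ^ (n + 2)) has_integral ?F 1 - ?F (c * \<eta>)) {c * \<eta>..1}"
      using s by (intro fundamental_theorem_of_calculus)
         (auto simp: has_real_derivative_iff_has_vector_derivative[symmetric])
    moreover have "?F 1 - ?F (c * \<eta>) = (1 / (c * \<eta>) ^ (n + 1) - 1) / real (n + 1)"
    proof -
      have "- 1 / (N * 1) - (- 1 / (N * X)) = (1 / X - 1) / N" for N X :: real
        by (simp add: diff_divide_distrib mult.commute)
      then show ?thesis unfolding power_one .
    qed
    moreover have "1 / (c * \<eta>) ^ (n + 1) > 1"
      using s by (simp add: power_less_one_iff del: power_Suc)
    moreover have "(1 / (c * \<eta>) ^ (n + 1) - 1) / real (n + 1) \<le> 1 / c ^ (n + 1) * (scale_factor d \<eta>)\<^sup>2"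
    proof -
      have "(1 / (c * \<eta>) ^ (n + 1) - 1) / real (n + 1) \<le> (1 / (c * \<eta>) ^ (n + 1) - 1) / 1"
        using \<open>1 / (c * \<eta>) ^ (n + 1) > 1\<close> by (intro divide_left_mono) auto
      also have "\<dots> \<le> 1 / (c * \<eta>) ^ (n + 1)" by simp
      also have "\<dots> = 1 / c ^ (n + 1) * (scale_factor d \<eta>)\<^sup>2"
        using scale_factor_sq[OF assms(1) \<eta>] False d by (simp add: power_mult_distrib)
      finally show ?thesis .
    qed
    ultimately show "\<exists>\<kappa>. 0 < \<kappa> \<and> \<kappa> \<le> 1 / c ^ (n + 1) * (scale_factor d \<eta>)\<^sup>2 \<and>
        ((\<lambda>t. 1 / t ^ (d - 1)) has_integral \<kappa>) {c * \<eta>..1}"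
      unfolding d by (intro exI[of _ "(1 / (c * \<eta>) ^ (n + 1) - 1) / real (n + 1)"]) auto
  qed
qed

theorem poincare_perforated:
  assumes d: "CARD('n) \<ge> 2" and c\<^sub>0: "0 < c\<^sub>0"
  obtains P where "P > 0"
    "\<And>\<epsilon> \<eta> \<psi> :: real^'n \<Rightarrow> real. 0 < \<epsilon> \<Longrightarrow> 0 < \<eta> \<Longrightarrow> \<eta> \<le> 1 \<Longrightarrow> Ck (Suc 0) \<psi> \<Longrightarrow>
      (\<And>k x. k \<in> int_lattice \<Longrightarrow> x \<in> ball (\<epsilon> *\<^sub>R k) (\<epsilon> * \<eta> * c\<^sub>0) \<Longrightarrow> \<psi> x = 0) \<Longrightarrow>
      (\<integral>\<^sup>+x. ennreal ((\<psi> x)\<^sup>2) \<partial>lborel) \<le>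
        ennreal (P * (\<epsilon> * scale_factor CARD('n) \<eta>)\<^sup>2) * (\<integral>\<^sup>+x. ennreal ((norm (gradient \<psi> x))\<^sup>2) \<partial>lborel)"
proof -
  \<comment> \<open>A point of the cell is within sqrt d \<epsilon> / 2 of the centre, so the
    fraction c \<eta> of its ray stays in the ball of radius
    \<open>\<epsilon> * \<eta> * c\<^sub>0\<close>. The minimum with 1/2 keeps c below 1, as
    \<open>ray_weight_bound\<close> requires.\<close>
  define c where "c = min c\<^sub>0 (1/2) / sqrt (real CARD('n))"
  have sq: "sqrt (real CARD('n)) \<ge> 1" using d by simp
  have "min c\<^sub>0 (1/2) < sqrt (real CARD('n))" using sq by linarith
  then have c: "0 < c" "c < 1" "c * sqrt (real CARD('n)) \<le> c\<^sub>0"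
    using c\<^sub>0 sq by (auto simp: c_def divide_less_eq)
  obtain C where C: "C > 0" "\<And>\<eta>. 0 < \<eta> \<Longrightarrow> \<eta> \<le> 1 \<Longrightarrow> \<exists>\<kappa>. 0 < \<kappa> \<and> \<kappa> \<le> C * (scale_factor CARD('n) \<eta>)\<^sup>2 \<and>
        ((\<lambda>t. 1 / t ^ (CARD('n) - 1)) has_integral \<kappa>) {c * \<eta>..1}"
    using ray_weight_bound[OF d c(1,2)] by metis
  show ?thesis
  proof (rule that[of "C * real CARD('n) / 8"])
    show "C * real CARD('n) / 8 > 0" using C by simp
    fix \<epsilon> \<eta> and \<psi> :: "real^'n \<Rightarrow> real"
    assume \<epsilon>: "0 < \<epsilon>" and \<eta>: "0 < \<eta>" "\<eta> \<le> 1" and \<psi>: "Ck (Suc 0) \<psi>"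
      and zero: "\<And>k x. k \<in> int_lattice \<Longrightarrow> x \<in> ball (\<epsilon> *\<^sub>R k) (\<epsilon> * \<eta> * c\<^sub>0) \<Longrightarrow> \<psi> x = 0"
    obtain \<kappa> where \<kappa>: "0 < \<kappa>" "\<kappa> \<le> C * (scale_factor CARD('n) \<eta>)\<^sup>2"
      "((\<lambda>t. 1 / t ^ (CARD('n) - 1)) has_integral \<kappa>) {c * \<eta>..1}"
      using C(2)[OF \<eta>] by blast
    have "c * \<eta> \<le> c * 1" using \<eta> c by (intro mult_left_mono) simp_all
    then have "c * \<eta> < 1" using c by linarith
    then have s: "0 < c * \<eta>" "c * \<eta> < 1" using \<eta> c by simp_all
    have meas: "(\<lambda>x. ennreal ((\<psi> x)\<^sup>2)) \<in> borel_measurable borel"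
      "(\<lambda>x. ennreal ((norm (gradient \<psi> x))\<^sup>2)) \<in> borel_measurable borel"
      using borel_measurable_continuous_onI[OF Ck_imp_continuous[OF \<psi>]]
        borel_measurable_continuous_onI[OF continuous_gradient[OF \<psi>]] by measurable
    let ?K = "\<kappa> * (real CARD('n) * \<epsilon>\<^sup>2 / 8)"
    have "(\<integral>\<^sup>+x. ennreal ((\<psi> x)\<^sup>2) \<partial>lborel) \<le> (\<integral>\<^sup>+x. ennreal ?K * ennreal ((norm (gradient \<psi> x))\<^sup>2) \<partial>lborel)"
    proof (rule nn_integral_mono_cells[OF meas(1) _ \<epsilon>])
      show "(\<lambda>x. ennreal ?K * ennreal ((norm (gradient \<psi> x))\<^sup>2)) \<in> borel_measurable borel"
        using meas(2) by measurable
      fix k :: "real^'n" assume k: "k \<in> int_lattice"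
      let ?z = "\<epsilon> *\<^sub>R k"
      have "(\<integral>\<^sup>+x. ennreal ((\<psi> x)\<^sup>2) * indicator (cell \<epsilon> ?z) x \<partial>lborel) \<le>
        ennreal ?K * (\<integral>\<^sup>+x. ennreal ((norm (gradient \<psi> x))\<^sup>2) * indicator (cell \<epsilon> ?z) x \<partial>lborel)"
      proof (rule poincare_cell[OF \<psi> s \<epsilon> _ \<kappa>(3,1)])
        fix x assume "x \<in> cell \<epsilon> ?z"
        from norm_cell_le[OF this \<epsilon>] have "(norm (x - ?z))\<^sup>2 \<le> (sqrt (real CARD('n)) * (\<epsilon> / 2))\<^sup>2"
          unfolding power_mult_distrib by simp
        then have "norm (x - ?z) \<le> sqrt (real CARD('n)) * (\<epsilon> / 2)"
          by (rule power2_le_imp_le) (use \<epsilon> in simp)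
        then have "norm ((c * \<eta>) *\<^sub>R (x - ?z)) \<le> (c * \<eta>) * (sqrt (real CARD('n)) * (\<epsilon> / 2))"
          unfolding norm_scaleR using s by (intro mult_mono) simp_all
        also have "\<dots> = (c * sqrt (real CARD('n))) * (\<epsilon> * \<eta> / 2)" by simp
        also have "\<dots> \<le> c\<^sub>0 * (\<epsilon> * \<eta> / 2)" using c \<epsilon> \<eta> by (intro mult_right_mono) auto
        also have "\<dots> < \<epsilon> * \<eta> * c\<^sub>0" using c\<^sub>0 \<epsilon> \<eta> by simp
        finally show "\<psi> (?z + (c * \<eta>) *\<^sub>R (x - ?z)) = 0"
          by (intro zero[OF k]) (simp add: dist_norm)
      qed
      also have "\<dots> = (\<integral>\<^sup>+x. ennreal ?K * ennreal ((norm (gradient \<psi> x))\<^sup>2) * indicator (cell \<epsilon> ?z) x \<partial>lborel)"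
        using meas(2) by (subst nn_integral_cmult[symmetric]) (auto simp: mult.assoc)
      finally show "(\<integral>\<^sup>+x. ennreal ((\<psi> x)\<^sup>2) * indicator (cell \<epsilon> ?z) x \<partial>lborel) \<le>
        (\<integral>\<^sup>+x. ennreal ?K * ennreal ((norm (gradient \<psi> x))\<^sup>2) * indicator (cell \<epsilon> ?z) x \<partial>lborel)" .
    qed
    also have "\<dots> = ennreal ?K * (\<integral>\<^sup>+x. ennreal ((norm (gradient \<psi> x))\<^sup>2) \<partial>lborel)"
      using meas(2) by (intro nn_integral_cmult) simp
    also have "\<dots> \<le> ennreal (C * real CARD('n) / 8 * (\<epsilon> * scale_factor CARD('n) \<eta>)\<^sup>2) *
        (\<integral>\<^sup>+x. ennreal ((norm (gradient \<psi> x))\<^sup>2) \<partial>lborel)"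
    proof (intro mult_right_mono ennreal_leI)
      have "?K \<le> C * (scale_factor CARD('n) \<eta>)\<^sup>2 * (real CARD('n) * \<epsilon>\<^sup>2 / 8)"
        by (intro mult_right_mono \<kappa>) simp
      then show "?K \<le> C * real CARD('n) / 8 * (\<epsilon> * scale_factor CARD('n) \<eta>)\<^sup>2"
        by (simp add: power_mult_distrib mult_ac)
    qed simp
    finally show "(\<integral>\<^sup>+x. ennreal ((\<psi> x)\<^sup>2) \<partial>lborel) \<le>
        ennreal (C * real CARD('n) / 8 * (\<epsilon> * scale_factor CARD('n) \<eta>)\<^sup>2) *
          (\<integral>\<^sup>+x. ennreal ((norm (gradient \<psi> x))\<^sup>2) \<partial>lborel)" .
  qed
qed

section \<open>The upper bound\<close>

text \<open>All that the estimates for solutions use of the geometry. The inequality is required for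
  C^1 functions vanishing off \<Omega>, not just for test functions: it will be applied to
  \<open>\<Psi> (\<psi> x)\<close>, where the antiderivative \<Psi> of a truncated power is in
  general only C^1.\<close>

definition poincare_domain :: "(real^'n) set \<Rightarrow> real \<Rightarrow> bool" where
  "poincare_domain \<Omega> K \<longleftrightarrow> \<Omega> \<in> sets borel \<and> 0 < K \<and>
    (\<forall>\<psi>. Ck (Suc 0) \<psi> \<longrightarrow> (\<forall>x. x \<notin> \<Omega> \<longrightarrow> \<psi> x = 0 \<and> gradient \<psi> x = 0) \<longrightarrow>
      (\<integral>\<^sup>+x. ennreal ((\<psi> x)\<^sup>2) \<partial>lebesgue_on \<Omega>) \<le>
        ennreal K * (\<integral>\<^sup>+x. ennreal ((norm (gradient \<psi> x))\<^sup>2) \<partial>lebesgue_on \<Omega>))"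

lemma square_integrable_nn_integral:
  "square_integrable M f \<Longrightarrow> (\<integral>\<^sup>+x. ennreal ((norm (f x))\<^sup>2) \<partial>M) = ennreal (\<integral>x. (norm (f x))\<^sup>2 \<partial>M)"
  by (intro nn_integral_eq_integral) (auto simp: square_integrable_def)

lemma poincare_domainD:
  assumes "poincare_domain \<Omega> K" "test_function \<Omega> \<psi>"
  shows "(\<integral>x. (\<psi> x)\<^sup>2 \<partial>lebesgue_on \<Omega>) \<le> K * (\<integral>x. (norm (gradient \<psi> x))\<^sup>2 \<partial>lebesgue_on \<Omega>)"
proof -
  have \<Omega>: "\<Omega> \<in> sets borel" and K: "0 < K" using assms by (auto simp: poincare_domain_def)
  note s = test_function_square_integrable(1,2)[OF assms(2) \<Omega>]
  have "(\<integral>\<^sup>+x. ennreal ((norm (\<psi> x))\<^sup>2) \<partial>lebesgue_on \<Omega>) \<le>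
        ennreal K * (\<integral>\<^sup>+x. ennreal ((norm (gradient \<psi> x))\<^sup>2) \<partial>lebesgue_on \<Omega>)"
    using assms(1)[unfolded poincare_domain_def, THEN conjunct2, THEN conjunct2, rule_format,
        OF test_function_Ck[OF assms(2)] test_function_zero[OF assms(2)]] by simp
  then show ?thesis
    unfolding s[THEN square_integrable_nn_integral] using K
    by (simp add: ennreal_mult'[symmetric] ennreal_le_iff)
qed

lemma test_function_power:
  assumes "test_function \<Omega> \<psi>"
  shows "test_function \<Omega> (\<lambda>x. \<psi> x ^ Suc n)"
  using test_function_mult[OF assms Ck_power[OF test_function_Ck[OF assms]]] by simp

lemma gradient_power:
  assumes "test_function \<Omega> \<psi>"
  shows "gradient (\<lambda>x. \<psi> x ^ Suc n) x = (real (Suc n) * \<psi> x ^ n) *\<^sub>R gradient \<psi> x"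
proof -
  have "((\<lambda>s. s ^ Suc n) has_real_derivative real (Suc n) * \<psi> x ^ n) (at (\<psi> x))"
    using DERIV_pow[of "Suc n" "\<psi> x"] by simp
  from gradient_compose_real(1)[OF test_function_differentiable[OF assms] this] show ?thesis .
qed

text \<open>Nonlinear test functions: the identity holds for powers of \<open>\<psi>\<close>, and the general case follows
  by Weierstrass approximation on the range of \<open>\<psi>\<close>.\<close>

lemma weak_test_nonlinear:
  fixes v :: "real^'n \<Rightarrow> real^'n" and h :: "real \<Rightarrow> real"
  assumes v: "square_integrable (lebesgue_on \<Omega>) v" and \<Omega>: "\<Omega> \<in> sets borel"
    and weak: "\<And>\<phi>. test_function \<Omega> \<phi> \<Longrightarrow> (\<integral>x. v x \<bullet> gradient \<phi> x \<partial>lebesgue_on \<Omega>) = 0"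
    and \<psi>: "test_function \<Omega> \<psi>" and h: "continuous_on UNIV h"
  shows "(\<integral>x. h (\<psi> x) * (v x \<bullet> gradient \<psi> x) \<partial>lebesgue_on \<Omega>) = 0"
proof -
  let ?M = "lebesgue_on \<Omega>" and ?w = "\<lambda>x. v x \<bullet> gradient \<psi> x"
  obtain B where B: "B > 0" "\<And>x. \<bar>\<psi> x\<bar> \<le> B" using test_function_bounded[OF \<psi>] by metis
  have int: "integrable ?M (\<lambda>x. k (\<psi> x) * ?w x)" if "continuous_on UNIV k" for k
  proof -
    have "bounded (k ` {-B..B})"
      by (intro compact_imp_bounded compact_continuous_image continuous_on_subset[OF that]) auto
    then obtain C where C: "\<forall>s\<in>{-B..B}. \<bar>k s\<bar> \<le> C" by (auto simp: bounded_iff)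
    have "square_integrable ?M (\<lambda>x. k (\<psi> x) *\<^sub>R v x)"
    proof (rule square_integrable_bounded_mult[OF v])
      have [measurable]: "k \<in> borel_measurable borel" using that by (rule borel_measurable_continuous_onI)
      show "(\<lambda>x. k (\<psi> x)) \<in> borel_measurable ?M" using test_function_measurable(3)[OF \<psi>] by measurable
      have "\<psi> x \<in> {-B..B}" for x using B(2)[of x] by auto
      then show "\<bar>k (\<psi> x)\<bar> \<le> C" for x using C by blast
    qed
    from square_integrable_inner[OF this test_function_square_integrable(2)[OF \<psi> \<Omega>]]
    show ?thesis by simp
  qed
  have mono: "(\<integral>x. \<psi> x ^ n * ?w x \<partial>?M) = 0" for n
  proof -
    have "0 = (\<integral>x. v x \<bullet> gradient (\<lambda>x. \<psi> x ^ Suc n) x \<partial>?M)"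
      using weak[OF test_function_power[OF \<psi>]] by simp
    also have "\<dots> = (\<integral>x. real (Suc n) * (\<psi> x ^ n * ?w x) \<partial>?M)"
      unfolding gradient_power[OF \<psi>] by (simp add: mult.assoc)
    also have "\<dots> = real (Suc n) * (\<integral>x. \<psi> x ^ n * ?w x \<partial>?M)" by simp
    finally show ?thesis by simp
  qed
  have poly: "(\<integral>x. q (\<psi> x) * ?w x \<partial>?M) = 0" if "real_polynomial_function q" for q
  proof -
    from real_polynomial_function_iff_sum[THEN iffD1, OF that]
    obtain a n where q: "q = (\<lambda>x. \<Sum>i\<le>n. a i * x ^ i)" by blast
    have "(\<integral>x. q (\<psi> x) * ?w x \<partial>?M) = (\<integral>x. (\<Sum>i\<le>n. a i * (\<psi> x ^ i * ?w x)) \<partial>?M)"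
      by (simp add: q sum_distrib_right mult.assoc)
    also have "\<dots> = (\<Sum>i\<le>n. a i * (\<integral>x. \<psi> x ^ i * ?w x \<partial>?M))"
      by (subst Bochner_Integration.integral_sum)
         (auto intro!: integrable_mult_right int[of "\<lambda>s. s ^ _"] continuous_intros)
    finally show ?thesis by (simp add: mono)
  qed
  let ?I = "\<integral>x. h (\<psi> x) * ?w x \<partial>?M" and ?W = "\<integral>x. \<bar>?w x\<bar> \<partial>?M"
  have iw: "integrable ?M (\<lambda>x. \<bar>?w x\<bar>)" using int[of "\<lambda>_. 1"] by auto
  have small: "\<bar>?I\<bar> \<le> e * ?W" if "e > 0" for e
  proof -
    obtain q where q: "real_polynomial_function q" "\<And>s. s \<in> {-B..B} \<Longrightarrow> \<bar>h s - q s\<bar> < e"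
      using Stone_Weierstrass_real_polynomial_function[of "{-B..B}" h e]
        continuous_on_subset[OF h] \<open>e > 0\<close> by auto
    have cq: "continuous_on UNIV q"
      using continuous_real_polymonial_function[OF q(1)] by (intro continuous_at_imp_continuous_on) simp
    have "?I = (\<integral>x. h (\<psi> x) * ?w x \<partial>?M) - (\<integral>x. q (\<psi> x) * ?w x \<partial>?M)" using poly[OF q(1)] by simp
    also have "\<dots> = (\<integral>x. (h (\<psi> x) - q (\<psi> x)) * ?w x \<partial>?M)"
      using int[OF h] int[OF cq] by (simp add: left_diff_distrib)
    finally have eq: "?I = (\<integral>x. (h (\<psi> x) - q (\<psi> x)) * ?w x \<partial>?M)" .
    have "\<bar>?I\<bar> \<le> (\<integral>x. \<bar>(h (\<psi> x) - q (\<psi> x)) * ?w x\<bar> \<partial>?M)"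
      unfolding eq by (rule integral_abs_bound)
    also have "\<dots> \<le> (\<integral>x. e * \<bar>?w x\<bar> \<partial>?M)"
    proof (rule integral_mono)
      show "integrable ?M (\<lambda>x. \<bar>(h (\<psi> x) - q (\<psi> x)) * ?w x\<bar>)"
        using int[OF continuous_on_diff[OF h cq]] by auto
      show "integrable ?M (\<lambda>x. e * \<bar>?w x\<bar>)" using iw by simp
      show "\<bar>(h (\<psi> x) - q (\<psi> x)) * ?w x\<bar> \<le> e * \<bar>?w x\<bar>" for x
      proof -
        have "\<psi> x \<in> {-B..B}" using B(2)[of x] by auto
        then show ?thesis unfolding abs_mult using q(2) by (intro mult_right_mono) (auto intro: less_imp_le)
      qed
    qed
    finally show ?thesis by simp
  qed
  have "?W \<ge> 0" by simp
  have "\<bar>?I\<bar> \<le> 0 + e" if "e > 0" for e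
  proof -
    \<comment> \<open>Dividing by W + 1 instead of W covers the case where the integral W is
      0.\<close>
    have "e / (?W + 1) > 0" using that \<open>?W \<ge> 0\<close> by (intro divide_pos_pos) linarith+
    then have "\<bar>?I\<bar> \<le> e / (?W + 1) * ?W" by (rule small)
    also have "\<dots> \<le> e"
    proof -
      have "e / (W + 1) * W \<le> e" if "0 \<le> W" for W :: real
        using that \<open>e > 0\<close> by (simp add: divide_le_eq mult_left_mono)
      then show ?thesis using \<open>?W \<ge> 0\<close> by blast
    qed
    finally show ?thesis by simp
  qed
  then have "\<bar>?I\<bar> \<le> 0" by (rule field_le_epsilon)
  then show ?thesis by simp
qed

text \<open>Formally this is the equation tested with an antiderivative of g^2 at the solution,
  followed by absorbing half of the gradient term. Since \<psi> only approximates the solution, the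
  mismatch between its gradient and G leaves the last term, which is controlled through the bound B
  on g.\<close>

lemma weak_energy_estimate:
  fixes f G :: "real^'n \<Rightarrow> real^'n" and g :: "real \<Rightarrow> real"
  assumes f: "square_integrable (lebesgue_on \<Omega>) f" and G: "square_integrable (lebesgue_on \<Omega>) G"
    and \<Omega>: "\<Omega> \<in> sets borel"
    and weak: "\<And>\<phi>. test_function \<Omega> \<phi> \<Longrightarrow> (\<integral>x. (G x + f x) \<bullet> gradient \<phi> x \<partial>lebesgue_on \<Omega>) = 0"
    and \<psi>: "test_function \<Omega> \<psi>" and g: "continuous_on UNIV g" "\<And>s. \<bar>g s\<bar> \<le> B"
  shows "(\<integral>x. (norm (g (\<psi> x) *\<^sub>R gradient \<psi> x))\<^sup>2 \<partial>lebesgue_on \<Omega>) \<le>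
     (\<integral>x. (norm (g (\<psi> x) *\<^sub>R f x))\<^sup>2 \<partial>lebesgue_on \<Omega>) +
      2 * B\<^sup>2 * sqrt ((\<integral>x. (norm (gradient \<psi> x))\<^sup>2 \<partial>lebesgue_on \<Omega>) *
         (\<integral>x. (norm (gradient \<psi> x - G x))\<^sup>2 \<partial>lebesgue_on \<Omega>))"
proof -
  let ?M = "lebesgue_on \<Omega>" and ?D = "gradient \<psi>" and ?g = "\<lambda>x. g (\<psi> x)"
  have D: "square_integrable ?M ?D" by (rule test_function_square_integrable(2)[OF \<psi> \<Omega>])
  have [measurable]: "g \<in> borel_measurable borel" "\<psi> \<in> borel_measurable ?M"
    using borel_measurable_continuous_onI[OF g(1)] test_function_measurable(3)[OF \<psi>] by auto
  have m: "(\<lambda>x. g (\<psi> x)) \<in> borel_measurable ?M" by measurable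
  have gs: "square_integrable ?M (\<lambda>x. ?g x *\<^sub>R k x)" if "square_integrable ?M k" for k
    by (rule square_integrable_bounded_mult[OF that m g(2)])
  have DG: "square_integrable ?M (\<lambda>x. ?D x - G x)" by (rule square_integrable_diff[OF D G])
  have ip: "integrable ?M (\<lambda>x. (?g x)\<^sup>2 * (a x \<bullet> b x))" if "square_integrable ?M a" "square_integrable ?M b" for a b
    using square_integrable_inner[OF gs[OF that(1)] gs[OF that(2)]] by (simp add: power2_eq_square mult.assoc)
  let ?E = "\<integral>x. (?g x)\<^sup>2 * ((?D x - G x) \<bullet> ?D x) \<partial>?M"
  have z: "(\<integral>x. (?g x)\<^sup>2 * ((G x + f x) \<bullet> ?D x) \<partial>?M) = 0"
    by (rule weak_test_nonlinear[OF square_integrable_add[OF G f] \<Omega> weak \<psi>, where h="\<lambda>s. (g s)\<^sup>2"])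
       (auto intro!: continuous_intros g)
  have "(\<integral>x. (?g x)\<^sup>2 * (?D x \<bullet> ?D x) \<partial>?M) =
     (\<integral>x. (?g x)\<^sup>2 * ((?D x - G x) \<bullet> ?D x) + (?g x)\<^sup>2 * ((G x + f x) \<bullet> ?D x) - (?g x)\<^sup>2 * (f x \<bullet> ?D x) \<partial>?M)"
    by (intro Bochner_Integration.integral_cong) (auto simp: inner_diff_left inner_add_left algebra_simps)
  also have "\<dots> = ?E + 0 - (\<integral>x. (?g x)\<^sup>2 * (f x \<bullet> ?D x) \<partial>?M)"
    using ip[OF DG D] ip[OF square_integrable_add[OF G f] D] ip[OF f D] z by simp
  finally have eq: "(\<integral>x. (?g x)\<^sup>2 * (?D x \<bullet> ?D x) \<partial>?M) = ?E - (\<integral>x. (?g x)\<^sup>2 * (f x \<bullet> ?D x) \<partial>?M)" by simp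
  \<comment> \<open>Expanding |f + grad \<psi>|^2 \<ge> 0 bounds the mixed term by half of each
    square; the gradient half is then absorbed on the left.\<close>
  have "- (\<integral>x. (?g x)\<^sup>2 * (f x \<bullet> ?D x) \<partial>?M) \<le>
     (\<integral>x. (1/2) * ((?g x)\<^sup>2 * (f x \<bullet> f x)) + (1/2) * ((?g x)\<^sup>2 * (?D x \<bullet> ?D x)) \<partial>?M)"
    unfolding integral_minus[symmetric]
  proof (rule integral_mono)
    show "integrable ?M (\<lambda>x. - ((?g x)\<^sup>2 * (f x \<bullet> ?D x)))" using ip[OF f D] by simp
    show "integrable ?M (\<lambda>x. (1/2) * ((?g x)\<^sup>2 * (f x \<bullet> f x)) + (1/2) * ((?g x)\<^sup>2 * (?D x \<bullet> ?D x)))"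
      using ip[OF f f] ip[OF D D] by simp
    fix x
    have "0 \<le> (f x + ?D x) \<bullet> (f x + ?D x)" by simp
    then have "- (f x \<bullet> ?D x) \<le> (1/2) * (f x \<bullet> f x) + (1/2) * (?D x \<bullet> ?D x)"
      by (simp add: inner_add inner_commute)
    then have "(?g x)\<^sup>2 * (- (f x \<bullet> ?D x)) \<le> (?g x)\<^sup>2 * ((1/2) * (f x \<bullet> f x) + (1/2) * (?D x \<bullet> ?D x))"
      by (rule mult_left_mono) simp
    then show "- ((?g x)\<^sup>2 * (f x \<bullet> ?D x)) \<le> (1/2) * ((?g x)\<^sup>2 * (f x \<bullet> f x)) + (1/2) * ((?g x)\<^sup>2 * (?D x \<bullet> ?D x))"
      by (simp add: algebra_simps)
  qed
  also have "\<dots> = (1/2) * (\<integral>x. (?g x)\<^sup>2 * (f x \<bullet> f x) \<partial>?M) + (1/2) * (\<integral>x. (?g x)\<^sup>2 * (?D x \<bullet> ?D x) \<partial>?M)"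
    using ip[OF f f] ip[OF D D] by simp
  finally have le: "(\<integral>x. (?g x)\<^sup>2 * (?D x \<bullet> ?D x) \<partial>?M) \<le> (\<integral>x. (?g x)\<^sup>2 * (f x \<bullet> f x) \<partial>?M) + 2 * ?E"
    using eq by linarith
  have "?E \<le> B\<^sup>2 * sqrt ((\<integral>x. (norm (?D x))\<^sup>2 \<partial>?M) * (\<integral>x. (norm (?D x - G x))\<^sup>2 \<partial>?M))"
  proof -
    let ?h = "\<lambda>x. (?g x)\<^sup>2 *\<^sub>R (?D x - G x)"
    have gB: "(?g x)\<^sup>2 \<le> B\<^sup>2" for x using g(2)[of "\<psi> x"] by (metis abs_ge_zero power2_abs power_mono)
    have hs: "square_integrable ?M ?h"
      by (rule square_integrable_bounded_mult[OF DG, where B="B\<^sup>2"]) (use gB m in auto)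
    have "?E\<^sup>2 = (\<integral>x. ?h x \<bullet> ?D x \<partial>?M)\<^sup>2" by simp
    also have "\<dots> \<le> (\<integral>x. (norm (?h x))\<^sup>2 \<partial>?M) * (\<integral>x. (norm (?D x))\<^sup>2 \<partial>?M)"
      by (rule Cauchy_Schwarz_integral[OF hs D])
    also have "\<dots> \<le> ((B\<^sup>2)\<^sup>2 * (\<integral>x. (norm (?D x - G x))\<^sup>2 \<partial>?M)) * (\<integral>x. (norm (?D x))\<^sup>2 \<partial>?M)"
    proof (rule mult_right_mono)
      have "(\<integral>x. (norm (?h x))\<^sup>2 \<partial>?M) \<le> (\<integral>x. (B\<^sup>2)\<^sup>2 * (norm (?D x - G x))\<^sup>2 \<partial>?M)"
      proof (rule integral_mono)
        show "(norm (?h x))\<^sup>2 \<le> (B\<^sup>2)\<^sup>2 * (norm (?D x - G x))\<^sup>2" for x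
          unfolding norm_scaleR power_mult_distrib using power_mono[OF gB[of x], of 2]
          by (intro mult_right_mono) auto
      qed (use hs DG in \<open>auto simp: square_integrable_def\<close>)
      then show "(\<integral>x. (norm (?h x))\<^sup>2 \<partial>?M) \<le> (B\<^sup>2)\<^sup>2 * (\<integral>x. (norm (?D x - G x))\<^sup>2 \<partial>?M)" by simp
    qed simp
    finally have "?E\<^sup>2 \<le> (B\<^sup>2)\<^sup>2 * ((\<integral>x. (norm (?D x))\<^sup>2 \<partial>?M) * (\<integral>x. (norm (?D x - G x))\<^sup>2 \<partial>?M))"
      by (simp add: mult_ac)
    then have "sqrt (?E\<^sup>2) \<le> sqrt ((B\<^sup>2)\<^sup>2 * ((\<integral>x. (norm (?D x))\<^sup>2 \<partial>?M) * (\<integral>x. (norm (?D x - G x))\<^sup>2 \<partial>?M)))"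
      by (rule real_sqrt_le_mono)
    also have "\<dots> = B\<^sup>2 * sqrt ((\<integral>x. (norm (?D x))\<^sup>2 \<partial>?M) * (\<integral>x. (norm (?D x - G x))\<^sup>2 \<partial>?M))"
      unfolding real_sqrt_mult[of "(B\<^sup>2)\<^sup>2"] real_sqrt_abs by simp
    finally show ?thesis by simp
  qed
  moreover have "(norm (?g x *\<^sub>R k x))\<^sup>2 = (?g x)\<^sup>2 * (k x \<bullet> k x)" for k :: "real^'n \<Rightarrow> real^'n" and x
    by (simp add: power_mult_distrib power2_norm_eq_inner)
  ultimately show ?thesis using le by simp
qed

section \<open>Truncated powers of test functions\<close>

text \<open>The square root of |s|^(p-2), truncated at height N. The case p = 2 is separate because
  \<open>0 powr 0 = 0\<close> would make the weight vanish at s = 0.\<close>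

definition trunc_weight :: "real \<Rightarrow> real \<Rightarrow> real \<Rightarrow> real" where
  "trunc_weight p N s = (if p = 2 then 1 else min \<bar>s\<bar> N powr ((p - 2) / 2))"

lemma continuous_trunc_weight:
  assumes "2 \<le> p" "0 < N"
  shows "continuous_on UNIV (trunc_weight p N)"
proof (cases "p = 2")
  case False
  then have "(p - 2) / 2 > 0" using assms by simp
  then have "continuous_on UNIV (\<lambda>s. min \<bar>s\<bar> N powr ((p - 2) / 2))"
    using assms(2) by (intro continuous_on_powr' continuous_intros) simp
  then show ?thesis using False by (simp add: trunc_weight_def)
qed (simp add: trunc_weight_def)

lemma trunc_weight_bounds:
  assumes "2 \<le> p" "0 < N"
  shows "0 \<le> trunc_weight p N s" "trunc_weight p N s \<le> (N + 1) powr ((p - 2) / 2)"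
proof -
  have "(1::real) \<le> (N + 1) powr ((p - 2) / 2)" using assms by (intro ge_one_powr_ge_zero) auto
  moreover have "min \<bar>s\<bar> N powr ((p - 2) / 2) \<le> (N + 1) powr ((p - 2) / 2)"
    using assms by (intro powr_mono2) auto
  ultimately show "trunc_weight p N s \<le> (N + 1) powr ((p - 2) / 2)"
    using assms by (simp add: trunc_weight_def)
qed (simp add: trunc_weight_def)

text \<open>An antiderivative of the weight replaces |s|^(p/2). Over the upper half of [0, w], with
  w the truncated |s|, the weight is at least (w/2)^((p-2)/2), so \<Psi> gains at least (w/2)^(p/2)
  there, uniformly in N. The derivative is assumed for |t| < A only, as \<Psi> will be an integral
  with a fixed lower end.\<close>

lemma antiderivative_lower_bound:
  assumes p: "2 \<le> p" and N: "0 < N" and A: "\<bar>s\<bar> < A"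
    and \<Psi>: "\<And>t. \<bar>t\<bar> < A \<Longrightarrow> (\<Psi> has_real_derivative trunc_weight p N t) (at t)" "\<Psi> 0 = 0"
  shows "(min \<bar>s\<bar> N / 2) powr p \<le> (\<Psi> s)\<^sup>2"
proof -
  have pos: "(min s N / 2) powr (p / 2) \<le> \<Phi> s"
    if s: "0 \<le> s" "s < A" and \<Phi>: "\<And>t. \<bar>t\<bar> < A \<Longrightarrow> (\<Phi> has_real_derivative trunc_weight p N t) (at t)" "\<Phi> 0 = 0"
    for \<Phi> s
  proof -
    have mono: "\<Phi> a \<le> \<Phi> b" if "0 \<le> a" "a \<le> b" "b \<le> s" for a b
    proof (rule DERIV_nonneg_imp_nondecreasing[OF that(2)])
      fix x assume "a \<le> x" "x \<le> b"
      then show "\<exists>y. (\<Phi> has_real_derivative y) (at x) \<and> 0 \<le> y"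
        using that s \<Phi>(1)[of x] trunc_weight_bounds(1)[OF p N] by auto
    qed
    let ?w = "min s N"
    show ?thesis
    proof (cases "s = 0")
      case False
      then have w: "?w > 0" "?w \<le> s" using s N by auto
      have "\<exists>z>?w / 2. z < ?w \<and> \<Phi> ?w - \<Phi> (?w / 2) = (?w - ?w / 2) * trunc_weight p N z"
      proof (rule MVT2)
        show "(\<Phi> has_real_derivative trunc_weight p N x) (at x)" if "?w / 2 \<le> x" "x \<le> ?w" for x
          by (rule \<Phi>(1)) (use that w s in linarith)
      qed (use w in linarith)
      then obtain \<xi> where \<xi>: "?w / 2 < \<xi>" "\<xi> < ?w" "\<Phi> ?w - \<Phi> (?w / 2) = (?w - ?w / 2) * trunc_weight p N \<xi>"
        by blast
      have "(?w / 2) powr ((p - 2) / 2) \<le> trunc_weight p N \<xi>"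
      proof (cases "p = 2")
        case False
        have "(?w / 2) powr ((p - 2) / 2) \<le> min \<bar>\<xi>\<bar> N powr ((p - 2) / 2)"
          using w \<xi> p by (intro powr_mono2) auto
        then show ?thesis using False by (simp add: trunc_weight_def)
      qed (use w in \<open>simp add: trunc_weight_def\<close>)
      then have "(?w / 2) * (?w / 2) powr ((p - 2) / 2) \<le> \<Phi> ?w - \<Phi> (?w / 2)"
        unfolding \<xi>(3) using w by (intro mult_mono) auto
      moreover have "(?w / 2) * (?w / 2) powr ((p - 2) / 2) = (?w / 2) powr (p / 2)"
      proof -
        have "(?w / 2) * (?w / 2) powr ((p - 2) / 2) = (?w / 2) powr (1 + (p - 2) / 2)"
          by (rule powr_mult_base) (use w in simp)
        also have "1 + (p - 2) / 2 = p / 2" by (simp add: field_simps)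
        finally show ?thesis .
      qed
      moreover have "\<Phi> 0 \<le> \<Phi> (?w / 2)" "\<Phi> ?w \<le> \<Phi> s" using w s by (auto intro!: mono)
      ultimately show ?thesis using \<Phi>(2) by linarith
    qed (use \<Phi>(2) N in simp)
  qed
  have "(min \<bar>s\<bar> N / 2) powr (p / 2) \<le> \<bar>\<Psi> s\<bar>"
  proof (cases "0 \<le> s")
    case True
    then show ?thesis using pos[OF True _ \<Psi>] A by simp
  next
    case False
    \<comment> \<open>The weight is even, so \<open>- \<Psi> (- t)\<close> is again an
      antiderivative vanishing at 0, and negative s reduces to positive s.\<close>
    have "((\<lambda>t. - \<Psi> (- t)) has_real_derivative trunc_weight p N t) (at t)" if "\<bar>t\<bar> < A" for t
    proof -
      have 1: "((\<lambda>t. - t) has_real_derivative -1) (at t)" by (auto intro!: derivative_eq_intros)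
      have "((\<lambda>t. \<Psi> (- t)) has_real_derivative trunc_weight p N (- t) * (-1)) (at t)"
        by (rule DERIV_chain2[OF \<Psi>(1) 1]) (use that in simp)
      moreover have "trunc_weight p N (- t) = trunc_weight p N t" by (simp add: trunc_weight_def)
      ultimately show ?thesis using DERIV_minus by fastforce
    qed
    from pos[OF _ _ this, of "-s"] show ?thesis using False A \<Psi>(2) by simp
  qed
  then have "((min \<bar>s\<bar> N / 2) powr (p / 2))\<^sup>2 \<le> \<bar>\<Psi> s\<bar>\<^sup>2" by (rule power_mono) simp
  moreover have "((min \<bar>s\<bar> N / 2) powr (p / 2))\<^sup>2 = (min \<bar>s\<bar> N / 2) powr p"
    by (simp add: power2_eq_square powr_add[symmetric])
  ultimately show ?thesis by simp
qed

text \<open>Young's inequality, done by comparing K a^2 with w^2 / 2^(p+1), where w is the truncated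
  |s|. If K a^2 is the smaller one, the left side is at most w^p / 2^(p+1) = (w/2)^p / 2, which can
  be absorbed; otherwise w is dominated by a, and the weight w^(p-2) is traded for powers of
  a.\<close>

lemma weight_absorption:
  assumes p: "2 \<le> p" and N: "0 < N" and K: "0 < K" and a: "0 \<le> a"
  shows "K * ((trunc_weight p N s)\<^sup>2 * a\<^sup>2) \<le>
    (min \<bar>s\<bar> N / 2) powr p / 2 + (2 powr (p + 1)) powr ((p - 2) / 2) * K powr (p / 2) * a powr p"
proof -
  define w where "w = min \<bar>s\<bar> N"
  have w: "0 \<le> w" using N by (simp add: w_def)
  define \<gamma> :: real where "\<gamma> = 2 powr (p + 1)"
  have \<gamma>: "\<gamma> > 0" by (simp add: \<gamma>_def)
  have rest: "0 \<le> \<gamma> powr ((p - 2) / 2) * K powr (p / 2) * a powr p" by simp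
  have "K * ((trunc_weight p N s)\<^sup>2 * a\<^sup>2) \<le> (w / 2) powr p / 2 + \<gamma> powr ((p - 2) / 2) * K powr (p / 2) * a powr p"
  proof (cases "p = 2")
    case True
    then show ?thesis using K a \<gamma> by (simp add: trunc_weight_def powr_numeral)
  next
    case False
    then have tw: "(trunc_weight p N s)\<^sup>2 = w powr (p - 2)"
      by (simp add: trunc_weight_def w_def power2_eq_square powr_add[symmetric])
    show ?thesis
    proof (cases "K * a\<^sup>2 \<le> w\<^sup>2 / \<gamma>")
      case True
      have "K * ((trunc_weight p N s)\<^sup>2 * a\<^sup>2) = w powr (p - 2) * (K * a\<^sup>2)" by (simp add: tw)
      also have "\<dots> \<le> w powr (p - 2) * (w\<^sup>2 / \<gamma>)" by (rule mult_left_mono[OF True]) simp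
      also have "\<dots> = (w / 2) powr p / 2"
      proof (cases "w = 0")
        case False
        have "w powr (p - 2) * w\<^sup>2 = w powr p"
          using w False by (simp add: powr_add[symmetric] flip: powr_numeral)
        then show ?thesis using w by (simp add: \<gamma>_def powr_divide powr_add)
      qed simp
      finally show ?thesis using rest by linarith
    next
      case False
      then have "w\<^sup>2 < \<gamma> * (K * a\<^sup>2)" using \<gamma> by (simp add: field_simps)
      then have "(w\<^sup>2) powr ((p - 2) / 2) \<le> (\<gamma> * (K * a\<^sup>2)) powr ((p - 2) / 2)"
        using p by (intro powr_mono2) auto
      moreover have sq: "(b\<^sup>2) powr ((p - 2) / 2) = b powr (p - 2)" if "0 \<le> b" for b :: real
      proof -
        have "(b\<^sup>2) powr ((p - 2) / 2) = (b powr 2) powr ((p - 2) / 2)"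
          using that by (simp add: powr_numeral)
        also have "\<dots> = b powr (2 * ((p - 2) / 2))" by (rule powr_powr)
        also have "2 * ((p - 2) / 2) = p - 2" by simp
        finally show ?thesis .
      qed
      ultimately have "w powr (p - 2) \<le> \<gamma> powr ((p - 2) / 2) * (K powr ((p - 2) / 2) * a powr (p - 2))"
        using w a K \<gamma> by (simp add: powr_mult)
      then have "(K * a\<^sup>2) * w powr (p - 2) \<le> (K * a\<^sup>2) * (\<gamma> powr ((p - 2) / 2) * (K powr ((p - 2) / 2) * a powr (p - 2)))"
        by (rule mult_left_mono) (use K in simp)
      also have "\<dots> = \<gamma> powr ((p - 2) / 2) * K powr (p / 2) * a powr p"
      proof -
        have "K * K powr ((p - 2) / 2) = K powr (1 + (p - 2) / 2)"
          by (rule powr_mult_base) (use K in simp)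
        also have "1 + (p - 2) / 2 = p / 2" by (simp add: field_simps)
        finally have e1: "K * K powr ((p - 2) / 2) = K powr (p / 2)" .
        have e2: "a\<^sup>2 * a powr (p - 2) = a powr p"
          using a by (cases "a = 0") (simp_all add: powr_add[symmetric] flip: powr_numeral)
        have "(K * a\<^sup>2) * (\<gamma> powr ((p - 2) / 2) * (K powr ((p - 2) / 2) * a powr (p - 2))) =
           \<gamma> powr ((p - 2) / 2) * (K * K powr ((p - 2) / 2)) * (a\<^sup>2 * a powr (p - 2))"
          by (simp only: mult_ac)
        then show ?thesis unfolding e1 e2 .
      qed
      finally have "K * ((trunc_weight p N s)\<^sup>2 * a\<^sup>2) \<le> \<gamma> powr ((p - 2) / 2) * K powr (p / 2) * a powr p"
        unfolding tw by (simp add: mult_ac)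
      moreover have "0 \<le> (w / 2) powr p / 2" by simp
      ultimately show ?thesis by linarith
    qed
  qed
  then show ?thesis by (simp add: w_def \<gamma>_def)
qed

text \<open>A chain for \<open>\<Psi> (\<psi> x)\<close>: lower bound for the antiderivative,
  Poincare, energy estimate, absorption. The integral of the truncated power is finite, so half of
  it can be subtracted. The constant in front of f does not involve N; only the error term
  does.\<close>

lemma truncated_estimate:
  fixes f G :: "real^'n \<Rightarrow> real^'n"
  assumes dom: "poincare_domain \<Omega> K" and p: "2 \<le> p" and N: "0 < N"
    and f: "square_integrable (lebesgue_on \<Omega>) f" and G: "square_integrable (lebesgue_on \<Omega>) G"
    and fp: "integrable (lebesgue_on \<Omega>) (\<lambda>x. norm (f x) powr p)"
    and weak: "\<And>\<phi>. test_function \<Omega> \<phi> \<Longrightarrow> (\<integral>x. (G x + f x) \<bullet> gradient \<phi> x \<partial>lebesgue_on \<Omega>) = 0"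
    and \<psi>: "test_function \<Omega> \<psi>"
  shows "(\<integral>\<^sup>+x. ennreal ((min \<bar>\<psi> x\<bar> N / 2) powr p) \<partial>lebesgue_on \<Omega>) \<le>
    ennreal (2 * ((2 powr (p + 1)) powr ((p - 2) / 2) * K powr (p / 2) * (\<integral>x. norm (f x) powr p \<partial>lebesgue_on \<Omega>)) +
      4 * K * ((N + 1) powr ((p - 2) / 2))\<^sup>2 * sqrt ((\<integral>x. (norm (gradient \<psi> x))\<^sup>2 \<partial>lebesgue_on \<Omega>) *
         (\<integral>x. (norm (gradient \<psi> x - G x))\<^sup>2 \<partial>lebesgue_on \<Omega>)))"
proof -
  let ?M = "lebesgue_on \<Omega>" and ?g = "trunc_weight p N" and ?D = "gradient \<psi>"
  let ?B = "(N + 1) powr ((p - 2) / 2)"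
  have \<Omega>: "\<Omega> \<in> sets borel" and K: "0 < K" using dom by (auto simp: poincare_domain_def)
  have cg: "continuous_on UNIV ?g" by (rule continuous_trunc_weight[OF p N])
  have gB: "\<bar>?g s\<bar> \<le> ?B" for s using trunc_weight_bounds[OF p N, of s] by simp
  obtain A where A: "A > 0" "\<And>x. \<bar>\<psi> x\<bar> \<le> A" using test_function_bounded[OF \<psi>] by metis
  \<comment> \<open>Normalised to vanish at 0 but integrated from -(A+1), with A a bound for \<psi>,
    so that the two-sided derivative exists on the whole range of \<psi>.\<close>
  define \<Psi> where "\<Psi> t = integral {-(A+1)..t} ?g - integral {-(A+1)..0} ?g" for t
  have d\<Psi>: "(\<Psi> has_real_derivative ?g t) (at t)" if "\<bar>t\<bar> < A + 1" for t
  proof -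
    have t: "t \<in> {-(A+1)<..<A+1}" using that by auto
    have "((\<lambda>x. integral {-(A+1)..x} ?g) has_real_derivative ?g t) (at t within {-(A+1)..A+1})"
      by (rule integral_has_real_derivative[OF continuous_on_subset[OF cg]]) (use t in auto)
    then have "((\<lambda>x. integral {-(A+1)..x} ?g) has_real_derivative ?g t) (at t)"
      using at_within_interior[of t "{-(A+1)..A+1}"] t by (simp add: interior_atLeastAtMost_real)
    then show ?thesis unfolding \<Psi>_def by (auto intro!: derivative_eq_intros)
  qed
  have \<Psi>0: "\<Psi> 0 = 0" by (simp add: \<Psi>_def)
  have \<psi>A: "\<bar>\<psi> x\<bar> < A + 1" for x using A(2)[of x] by linarith
  let ?\<chi> = "\<lambda>x. \<Psi> (\<psi> x)"
  have grad: "gradient ?\<chi> x = ?g (\<psi> x) *\<^sub>R ?D x" "?\<chi> differentiable (at x)" for x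
    using gradient_compose_real[OF test_function_differentiable[OF \<psi>] d\<Psi>[OF \<psi>A]] by blast+
  have "continuous_on UNIV \<psi>" using Ck_imp_continuous[OF test_function_Ck[OF \<psi>]] .
  then have cg\<psi>: "continuous_on UNIV (\<lambda>x. ?g (\<psi> x))"
    by (rule continuous_on_compose2[OF cg]) auto
  have cD: "continuous_on UNIV ?D" by (rule continuous_gradient[OF test_function_Ck[OF \<psi>]])
  have Ck\<chi>: "Ck (Suc 0) ?\<chi>"
  proof (rule Ck_SucI)
    show "(?\<chi> has_derivative (\<lambda>v. gradient ?\<chi> x \<bullet> v)) (at x)" for x
      using differentiable_iff_has_gradient grad(2) by blast
    show "Ck 0 (\<lambda>x. gradient ?\<chi> x \<bullet> v)" for v
      unfolding grad by (auto intro!: continuous_intros cg\<psi> cD)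
  qed
  have gm: "(\<lambda>x. ?g (\<psi> x)) \<in> borel_measurable ?M"
    by (intro borel_measurable_lebesgue_onI borel_measurable_continuous_onI cg\<psi>)
  have gD: "square_integrable ?M (\<lambda>x. ?g (\<psi> x) *\<^sub>R ?D x)"
    by (rule square_integrable_bounded_mult[OF test_function_square_integrable(2)[OF \<psi> \<Omega>] gm gB])
  have gf: "square_integrable ?M (\<lambda>x. ?g (\<psi> x) *\<^sub>R f x)"
    by (rule square_integrable_bounded_mult[OF f gm gB])
  let ?w = "\<lambda>x. (min \<bar>\<psi> x\<bar> N / 2) powr p"
  have wint: "integrable ?M ?w"
  proof (rule test_function_integrable(2)[OF \<psi> _ _ _ \<Omega>, where B="N powr p"])
    have [measurable]: "\<psi> \<in> borel_measurable borel" by (rule test_function_measurable(1)[OF \<psi>])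
    show "?w \<in> borel_measurable borel" by measurable
    show "norm (?w x) \<le> N powr p" for x using p N by (auto intro!: powr_mono2)
    show "?w x = 0" if "x \<notin> closure {x. \<psi> x \<noteq> 0}" for x
    proof -
      have "\<psi> x = 0" using that closure_subset[of "{x. \<psi> x \<noteq> 0}"] by auto
      then show ?thesis using N by simp
    qed
  qed
  have nnw: "(\<integral>\<^sup>+x. ennreal (?w x) \<partial>?M) = ennreal (\<integral>x. ?w x \<partial>?M)"
    by (rule nn_integral_eq_integral[OF wint]) simp
  have "(\<integral>\<^sup>+x. ennreal (?w x) \<partial>?M) \<le> (\<integral>\<^sup>+x. ennreal ((?\<chi> x)\<^sup>2) \<partial>?M)"
    by (intro nn_integral_mono ennreal_leI antiderivative_lower_bound[OF p N \<psi>A d\<Psi> \<Psi>0])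
  also have "\<dots> \<le> ennreal K * (\<integral>\<^sup>+x. ennreal ((norm (gradient ?\<chi> x))\<^sup>2) \<partial>?M)"
    by (rule dom[unfolded poincare_domain_def, THEN conjunct2, THEN conjunct2, rule_format, OF Ck\<chi>])
       (use test_function_zero[OF \<psi>] \<Psi>0 in \<open>simp add: grad\<close>)
  also have "\<dots> = ennreal (K * (\<integral>x. (norm (?g (\<psi> x) *\<^sub>R ?D x))\<^sup>2 \<partial>?M))"
    unfolding grad square_integrable_nn_integral[OF gD] using K by (intro ennreal_mult'[symmetric]) simp
  finally have le1: "(\<integral>x. ?w x \<partial>?M) \<le> K * (\<integral>x. (norm (?g (\<psi> x) *\<^sub>R ?D x))\<^sup>2 \<partial>?M)"
    unfolding nnw using K by (simp add: ennreal_le_iff)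
  let ?R = "?B\<^sup>2 * sqrt ((\<integral>x. (norm (?D x))\<^sup>2 \<partial>?M) * (\<integral>x. (norm (?D x - G x))\<^sup>2 \<partial>?M))"
  have "(\<integral>x. (norm (?g (\<psi> x) *\<^sub>R ?D x))\<^sup>2 \<partial>?M) \<le> (\<integral>x. (norm (?g (\<psi> x) *\<^sub>R f x))\<^sup>2 \<partial>?M) + 2 * ?R"
    using weak_energy_estimate[OF f G \<Omega> weak \<psi> cg gB] by (simp only: mult.assoc)
  then have "K * (\<integral>x. (norm (?g (\<psi> x) *\<^sub>R ?D x))\<^sup>2 \<partial>?M) \<le> K * ((\<integral>x. (norm (?g (\<psi> x) *\<^sub>R f x))\<^sup>2 \<partial>?M) + 2 * ?R)"
    by (rule mult_left_mono) (use K in simp)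
  then have le2: "(\<integral>x. ?w x \<partial>?M) \<le> K * (\<integral>x. (norm (?g (\<psi> x) *\<^sub>R f x))\<^sup>2 \<partial>?M) + 2 * (K * ?R)"
    using le1 by (simp add: distrib_left mult.left_commute)
  let ?C = "(2 powr (p + 1)) powr ((p - 2) / 2) * K powr (p / 2)"
  have "K * (\<integral>x. (norm (?g (\<psi> x) *\<^sub>R f x))\<^sup>2 \<partial>?M) = (\<integral>x. K * ((norm (?g (\<psi> x) *\<^sub>R f x))\<^sup>2) \<partial>?M)" by simp
  also have "\<dots> \<le> (\<integral>x. ?w x / 2 + ?C * (norm (f x) powr p) \<partial>?M)"
  proof (rule integral_mono)
    show "integrable ?M (\<lambda>x. K * ((norm (?g (\<psi> x) *\<^sub>R f x))\<^sup>2))" using gf by (simp add: square_integrable_def)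
    show "integrable ?M (\<lambda>x. ?w x / 2 + ?C * (norm (f x) powr p))" using wint fp by simp
    show "K * ((norm (?g (\<psi> x) *\<^sub>R f x))\<^sup>2) \<le> ?w x / 2 + ?C * (norm (f x) powr p)" for x
      using weight_absorption[OF p N K, of "norm (f x)" "\<psi> x"] by (simp add: power_mult_distrib)
  qed
  also have "\<dots> = (\<integral>x. ?w x \<partial>?M) / 2 + ?C * (\<integral>x. norm (f x) powr p \<partial>?M)" using wint fp by simp
  finally have "(\<integral>x. ?w x \<partial>?M) \<le> 2 * (?C * (\<integral>x. norm (f x) powr p \<partial>?M)) + 4 * (K * ?R)"
    using le2 by linarith
  then have "(\<integral>x. ?w x \<partial>?M) \<le> 2 * (?C * (\<integral>x. norm (f x) powr p \<partial>?M)) + 4 * K * ?B\<^sup>2 * sqrt ((\<integral>x. (norm (?D x))\<^sup>2 \<partial>?M) * (\<integral>x. (norm (?D x - G x))\<^sup>2 \<partial>?M))"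
    by (simp only: mult.assoc)
  then show ?thesis unfolding nnw by (rule ennreal_leI)
qed

section \<open>From approximating test functions to the solution\<close>

text \<open>With Lipschitz dependence of the truncated power, the L^1 convergence on compact sets
  that \<open>W012\<close> provides suffices to replace \<open>\<psi> n\<close> by u.\<close>

lemma truncated_powr_lipschitz:
  fixes a b p N :: real
  assumes p: "2 \<le> p" and N: "0 < N"
  shows "(min \<bar>a\<bar> N / 2) powr p \<le> (min \<bar>b\<bar> N / 2) powr p + p * N powr (p - 1) * \<bar>b - a\<bar>"
proof -
  define x where "x = min \<bar>b\<bar> N / 2"
  define y where "y = min \<bar>a\<bar> N / 2"
  have xy: "0 \<le> x" "0 \<le> y" "y \<le> N" "y - x \<le> \<bar>b - a\<bar>" using N by (auto simp: x_def y_def)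
  have nn: "0 \<le> p * N powr (p - 1) * \<bar>b - a\<bar>" using p by simp
  have "y powr p \<le> x powr p + p * N powr (p - 1) * \<bar>b - a\<bar>"
  proof (cases "x < y")
    case True
    have "y powr p - x powr p \<le> p * N powr (p - 1) * (y - x)"
    proof (cases "x = 0")
      case True
      have "y powr p = y * y powr (p - 1)" using xy by (simp add: powr_mult_base)
      also have "\<dots> \<le> y * N powr (p - 1)" using xy p by (intro mult_left_mono powr_mono2) auto
      also have "\<dots> \<le> p * (y * N powr (p - 1))" using p xy by (intro mult_right_mono[of 1 p, simplified]) auto
      finally show ?thesis using True p by (simp add: mult_ac)
    next
      case False
      then have "x > 0" using xy by simp
      have "\<exists>z>x. z < y \<and> y powr p - x powr p = (y - x) * (p * z powr (p - 1))"
        by (rule MVT2[OF True]) (use \<open>x > 0\<close> in \<open>auto intro!: has_real_derivative_powr\<close>)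
      then obtain z where z: "x < z" "z < y" "y powr p - x powr p = (y - x) * (p * z powr (p - 1))" by blast
      have "(y - x) * (p * z powr (p - 1)) \<le> (y - x) * (p * N powr (p - 1))"
        using z xy p True by (intro mult_left_mono powr_mono2) auto
      then show ?thesis using z(3) by (simp add: mult_ac)
    qed
    also have "\<dots> \<le> p * N powr (p - 1) * \<bar>b - a\<bar>" using xy p by (intro mult_left_mono) auto
    finally show ?thesis by simp
  next
    case False
    then have "y powr p \<le> x powr p" using xy p by (intro powr_mono2) auto
    then show ?thesis using nn by linarith
  qed
  then show ?thesis by (simp add: x_def y_def)
qed

lemma weak_solution_residual:
  assumes "weak_solution \<Omega> f u" "square_integrable (lebesgue_on \<Omega>) f" "\<Omega> \<in> sets borel"
  obtains G where "W012 \<Omega> u G" "square_integrable (lebesgue_on \<Omega>) G"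
    "\<forall>\<phi>. test_function \<Omega> \<phi> \<longrightarrow> (\<integral>x. (G x + f x) \<bullet> gradient \<phi> x \<partial>lebesgue_on \<Omega>) = 0"
proof -
  obtain G where G: "W012 \<Omega> u G" "\<And>\<phi>. test_function \<Omega> \<phi> \<Longrightarrow>
     (LINT x|lebesgue_on \<Omega>. G x \<bullet> gradient \<phi> x) = - (LINT x|lebesgue_on \<Omega>. f x \<bullet> gradient \<phi> x)"
    using assms(1) unfolding weak_solution_def by blast
  have s: "square_integrable (lebesgue_on \<Omega>) G" using G(1) by (simp add: W012_def Lp_space_2_iff)
  have "(\<integral>x. (G x + f x) \<bullet> gradient \<phi> x \<partial>lebesgue_on \<Omega>) = 0" if "test_function \<Omega> \<phi>" for \<phi>
    using G(2)[OF that] square_integrable_inner[OF s test_function_square_integrable(2)[OF that assms(3)]]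
      square_integrable_inner[OF assms(2) test_function_square_integrable(2)[OF that assms(3)]]
    by (simp add: inner_add_left)
  then show ?thesis using that G(1) s by blast
qed

lemma W012_approx:
  assumes "W012 \<Omega> u G"
  obtains \<psi> where "\<forall>n. test_function \<Omega> (\<psi> n)"
    "(\<lambda>n. \<integral>\<^sup>+x. ennreal ((norm (gradient (\<psi> n) x - G x))\<^sup>2) \<partial>lebesgue_on \<Omega>) \<longlonglongrightarrow> 0"
    "\<forall>C. compact C \<and> C \<subseteq> \<Omega> \<longrightarrow> (\<lambda>n. \<integral>\<^sup>+x. ennreal \<bar>\<psi> n x - u x\<bar> \<partial>lebesgue_on C) \<longlonglongrightarrow> 0"
  using assms unfolding W012_def Lp_norm_tendsto_0_iff[OF zero_less_one] Lp_norm_tendsto_0_iff[OF zero_less_numeral]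
  by (auto simp: norm_powr_2)

text \<open>\<open>W012\<close> controls u only on compact subsets. Up to a null set, a Lebesgue set
  is a countable union of compact sets, so monotone convergence along their finite unions recovers
  the integral over \<Omega>.\<close>

lemma nn_integral_le_of_compact:
  fixes g :: "real^'n \<Rightarrow> ennreal"
  assumes \<Omega>: "\<Omega> \<in> sets lebesgue" and g: "g \<in> borel_measurable (lebesgue_on \<Omega>)"
    and C: "\<And>C. compact C \<Longrightarrow> C \<subseteq> \<Omega> \<Longrightarrow> (\<integral>\<^sup>+x. g x \<partial>lebesgue_on C) \<le> c"
  shows "(\<integral>\<^sup>+x. g x \<partial>lebesgue_on \<Omega>) \<le> c"
proof -
  obtain S N where S: "fsigma S" "N \<in> null_sets lebesgue" "S \<union> N = \<Omega>"
    using lebesgue_set_almost_fsigma[OF \<Omega>] by metis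
  obtain F :: "nat \<Rightarrow> (real^'n) set" where F: "range F \<subseteq> Collect compact" "S = \<Union>(F ` UNIV)"
    using S(1)[unfolded fsigma_Union_compact] by blast
  define E where "E n = (\<Union>i\<le>n. F i)" for n
  have E: "compact (E n)" "E n \<subseteq> \<Omega>" for n using F S by (auto simp: E_def intro!: compact_UN)
  have El: "E n \<in> sets lebesgue" for n
    by (intro fmeasurableD lmeasurable_compact E(1))
  have gm: "(\<lambda>x. g x * indicator \<Omega> x) \<in> borel_measurable lebesgue"
    using g \<Omega> by (simp add: borel_measurable_restrict_space_iff_ennreal)
  have "(\<integral>\<^sup>+x. g x \<partial>lebesgue_on \<Omega>) = (\<integral>\<^sup>+x. g x * indicator \<Omega> x \<partial>lebesgue)"
    using \<Omega> by (intro nn_integral_restrict_space) auto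
  also have "\<dots> = (\<integral>\<^sup>+x. (SUP n. g x * indicator \<Omega> x * indicator (E n) x) \<partial>lebesgue)"
  proof (rule nn_integral_cong_AE)
    have "AE x in lebesgue. x \<notin> N" using AE_not_in S(2) by blast
    then show "AE x in lebesgue. g x * indicator \<Omega> x = (SUP n. g x * indicator \<Omega> x * indicator (E n) x)"
    proof (rule AE_mp, intro AE_I2 impI)
      fix x assume x: "x \<notin> N"
      show "g x * indicator \<Omega> x = (SUP n. g x * indicator \<Omega> x * indicator (E n) x)"
      proof (cases "x \<in> \<Omega>")
        case True
        then obtain i where "x \<in> F i" using x S F by auto
        then have "x \<in> E i" by (auto simp: E_def)
        then have "g x * indicator \<Omega> x \<le> (SUP n. g x * indicator \<Omega> x * indicator (E n) x)"
          by (intro SUP_upper2[of i]) auto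
        moreover have "(SUP n. g x * indicator \<Omega> x * indicator (E n) x) \<le> g x * indicator \<Omega> x"
          by (intro SUP_least) (auto simp: indicator_def)
        ultimately show ?thesis by simp
      qed simp
    qed
  qed
  also have "\<dots> = (SUP n. \<integral>\<^sup>+x. g x * indicator \<Omega> x * indicator (E n) x \<partial>lebesgue)"
  proof (rule nn_integral_monotone_convergence_SUP)
    show "incseq (\<lambda>n x. g x * indicator \<Omega> x * indicator (E n) x)"
      by (rule incseq_SucI) (auto simp: le_fun_def E_def indicator_def)
    show "(\<lambda>x. g x * indicator \<Omega> x * indicator (E n) x) \<in> borel_measurable lebesgue" for n
      by (rule borel_measurable_times_ennreal[OF gm borel_measurable_indicator[OF El]])
  qed
  also have "\<dots> \<le> c"
  proof (rule SUP_least)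
    fix n
    have "(\<integral>\<^sup>+x. g x * indicator \<Omega> x * indicator (E n) x \<partial>lebesgue) = (\<integral>\<^sup>+x. g x * indicator (E n) x \<partial>lebesgue)"
      using E(2) by (intro nn_integral_cong) (auto simp: indicator_def)
    also have "\<dots> = (\<integral>\<^sup>+x. g x \<partial>lebesgue_on (E n))"
      using El by (intro nn_integral_restrict_space[symmetric]) auto
    finally show "(\<integral>\<^sup>+x. g x * indicator \<Omega> x * indicator (E n) x \<partial>lebesgue) \<le> c"
      using C[OF E] by simp
  qed
  finally show ?thesis .
qed

theorem weak_solution_Lp_estimate:
  fixes f :: "real^'n \<Rightarrow> real^'n"
  assumes dom: "poincare_domain \<Omega> K" and p: "2 \<le> p" and u: "weak_solution \<Omega> f u"
    and f2: "square_integrable (lebesgue_on \<Omega>) f"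
    and fp: "integrable (lebesgue_on \<Omega>) (\<lambda>x. norm (f x) powr p)"
  shows "(\<integral>\<^sup>+x. ennreal (\<bar>u x\<bar> powr p) \<partial>lebesgue_on \<Omega>) \<le>
    ennreal (2 powr p * (2 * ((2 powr (p + 1)) powr ((p - 2) / 2) * K powr (p / 2) *
      (\<integral>x. norm (f x) powr p \<partial>lebesgue_on \<Omega>))))"
proof -
  let ?M = "lebesgue_on \<Omega>"
  define A where "A = 2 * ((2 powr (p + 1)) powr ((p - 2) / 2) * K powr (p / 2) * (\<integral>x. norm (f x) powr p \<partial>?M))"
  have A: "A \<ge> 0" by (simp add: A_def)
  have \<Omega>: "\<Omega> \<in> sets borel" and K: "0 < K" using dom by (auto simp: poincare_domain_def)
  have \<Omega>l: "\<Omega> \<in> sets lebesgue" using \<Omega> by (auto intro: sets_completionI_sets)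
  obtain G where W: "W012 \<Omega> u G" and G: "square_integrable ?M G"
    and weak: "\<forall>\<phi>. test_function \<Omega> \<phi> \<longrightarrow> (\<integral>x. (G x + f x) \<bullet> gradient \<phi> x \<partial>?M) = 0"
    by (rule weak_solution_residual[OF u f2 \<Omega>])
  have um: "u \<in> borel_measurable ?M" using W by (simp add: W012_def)
  obtain \<psi> where \<psi>': "\<forall>n. test_function \<Omega> (\<psi> n)"
    and lim: "(\<lambda>n. \<integral>\<^sup>+x. ennreal ((norm (gradient (\<psi> n) x - G x))\<^sup>2) \<partial>?M) \<longlonglongrightarrow> 0"
    and limC: "\<forall>C. compact C \<and> C \<subseteq> \<Omega> \<longrightarrow> (\<lambda>n. \<integral>\<^sup>+x. ennreal \<bar>\<psi> n x - u x\<bar> \<partial>lebesgue_on C) \<longlonglongrightarrow> 0"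
    by (rule W012_approx[OF W])
  have \<psi>: "test_function \<Omega> (\<psi> n)" for n using \<psi>' by blast
  define \<delta> where "\<delta> n = (\<integral>x. (norm (gradient (\<psi> n) x - G x))\<^sup>2 \<partial>?M)" for n
  have D: "square_integrable ?M (gradient (\<psi> n))" for n
    by (rule test_function_square_integrable(2)[OF \<psi> \<Omega>])
  have \<delta>0: "\<delta> n \<ge> 0" for n by (simp add: \<delta>_def)
  have "(\<lambda>n. ennreal (\<delta> n)) \<longlonglongrightarrow> ennreal 0"
    using lim unfolding square_integrable_nn_integral[OF square_integrable_diff[OF D G]] \<delta>_def by simp
  then have \<delta>: "\<delta> \<longlonglongrightarrow> 0" using \<delta>0 by (subst (asm) tendsto_ennreal_iff) auto
  \<comment> \<open>The gradients stay bounded in L^2, so the error of the truncated estimate tends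
    to 0 together with \<delta>.\<close>
  have Dn: "(\<integral>x. (norm (gradient (\<psi> n) x))\<^sup>2 \<partial>?M) \<le> 2 * (\<integral>x. (norm (G x))\<^sup>2 \<partial>?M) + 2 * \<delta> n" for n
  proof -
    have i: "integrable ?M (\<lambda>x. (norm (G x))\<^sup>2)" "integrable ?M (\<lambda>x. (norm (gradient (\<psi> n) x - G x))\<^sup>2)"
      "integrable ?M (\<lambda>x. (norm (gradient (\<psi> n) x))\<^sup>2)"
      using G D[of n] square_integrable_diff[OF D[of n] G] by (auto simp: square_integrable_def)
    have "(\<integral>x. (norm (gradient (\<psi> n) x))\<^sup>2 \<partial>?M) \<le> (\<integral>x. 2 * (norm (G x))\<^sup>2 + 2 * (norm (gradient (\<psi> n) x - G x))\<^sup>2 \<partial>?M)"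
    proof (rule integral_mono)
      fix x
      have "norm (gradient (\<psi> n) x) \<le> norm (G x) + norm (gradient (\<psi> n) x - G x)"
        using norm_triangle_sub by blast
      then have "(norm (gradient (\<psi> n) x))\<^sup>2 \<le> (norm (G x) + norm (gradient (\<psi> n) x - G x))\<^sup>2"
        by (rule power_mono) simp
      also have "\<dots> \<le> 2 * (norm (G x))\<^sup>2 + 2 * (norm (gradient (\<psi> n) x - G x))\<^sup>2"
        using sum_squares_bound[of "norm (G x)" "norm (gradient (\<psi> n) x - G x)"] by (simp add: power2_sum)
      finally show "(norm (gradient (\<psi> n) x))\<^sup>2 \<le> 2 * (norm (G x))\<^sup>2 + 2 * (norm (gradient (\<psi> n) x - G x))\<^sup>2" .
    qed (use i in auto)
    then show ?thesis using i by (simp add: \<delta>_def)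
  qed
  have trunc: "(\<integral>\<^sup>+x. ennreal ((min \<bar>u x\<bar> N / 2) powr p) \<partial>?M) \<le> ennreal A" if N: "0 < N" for N
  proof (rule nn_integral_le_of_compact[OF \<Omega>l])
    show "(\<lambda>x. ennreal ((min \<bar>u x\<bar> N / 2) powr p)) \<in> borel_measurable ?M" using um by measurable
    fix C assume C: "compact C" "C \<subseteq> \<Omega>"
    have Cl: "C \<in> sets lebesgue" by (intro fmeasurableD lmeasurable_compact C(1))
    have uC: "u \<in> borel_measurable (lebesgue_on C)" by (rule measurable_restrict_mono[OF um C(2)])
    let ?c = "p * N powr (p - 1)"
    let ?E = "\<lambda>n. 4 * K * ((N + 1) powr ((p - 2) / 2))\<^sup>2 * sqrt ((2 * (\<integral>x. (norm (G x))\<^sup>2 \<partial>?M) + 2 * \<delta> n) * \<delta> n)"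
    have c: "?c \<ge> 0" using p by simp
    have bound: "(\<integral>\<^sup>+x. ennreal ((min \<bar>u x\<bar> N / 2) powr p) \<partial>lebesgue_on C) \<le>
      ennreal (A + ?E n) + ennreal ?c * (\<integral>\<^sup>+x. ennreal \<bar>\<psi> n x - u x\<bar> \<partial>lebesgue_on C)" for n
    proof -
      have \<psi>C: "\<psi> n \<in> borel_measurable (lebesgue_on C)" by (rule test_function_measurable(3)[OF \<psi>])
      have "(\<integral>\<^sup>+x. ennreal ((min \<bar>u x\<bar> N / 2) powr p) \<partial>lebesgue_on C) \<le>
        (\<integral>\<^sup>+x. ennreal ((min \<bar>\<psi> n x\<bar> N / 2) powr p) + ennreal ?c * ennreal \<bar>\<psi> n x - u x\<bar> \<partial>lebesgue_on C)"
      proof (rule nn_integral_mono)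
        fix x
        have "ennreal ((min \<bar>u x\<bar> N / 2) powr p) \<le> ennreal ((min \<bar>\<psi> n x\<bar> N / 2) powr p + ?c * \<bar>\<psi> n x - u x\<bar>)"
          by (rule ennreal_leI[OF truncated_powr_lipschitz[OF p N]])
        also have "\<dots> = ennreal ((min \<bar>\<psi> n x\<bar> N / 2) powr p) + ennreal ?c * ennreal \<bar>\<psi> n x - u x\<bar>"
          using c by (subst ennreal_plus) (auto simp: ennreal_mult')
        finally show "ennreal ((min \<bar>u x\<bar> N / 2) powr p) \<le>
          ennreal ((min \<bar>\<psi> n x\<bar> N / 2) powr p) + ennreal ?c * ennreal \<bar>\<psi> n x - u x\<bar>" .
      qed
      also have "\<dots> = (\<integral>\<^sup>+x. ennreal ((min \<bar>\<psi> n x\<bar> N / 2) powr p) \<partial>lebesgue_on C) +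
         ennreal ?c * (\<integral>\<^sup>+x. ennreal \<bar>\<psi> n x - u x\<bar> \<partial>lebesgue_on C)"
        using uC \<psi>C by (subst nn_integral_add) (auto simp: nn_integral_cmult)
      also have "(\<integral>\<^sup>+x. ennreal ((min \<bar>\<psi> n x\<bar> N / 2) powr p) \<partial>lebesgue_on C) \<le>
         (\<integral>\<^sup>+x. ennreal ((min \<bar>\<psi> n x\<bar> N / 2) powr p) \<partial>?M)"
        by (rule nn_integral_lebesgue_on_mono_set[OF \<Omega>l Cl C(2)])
      also have "\<dots> \<le> ennreal (A + 4 * K * ((N + 1) powr ((p - 2) / 2))\<^sup>2 *
         sqrt ((\<integral>x. (norm (gradient (\<psi> n) x))\<^sup>2 \<partial>?M) * \<delta> n))"
        unfolding A_def \<delta>_def by (rule truncated_estimate[OF dom p N f2 G fp weak[rule_format] \<psi>])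
      also have "\<dots> \<le> ennreal (A + ?E n)"
        using Dn[of n] \<delta>0[of n] K
        by (intro ennreal_leI add_left_mono mult_left_mono real_sqrt_le_mono mult_right_mono) auto
      finally show ?thesis by (simp add: add_right_mono)
    qed
    \<comment> \<open>For fixed N and C both errors vanish as n grows: the first with
      \<open>\<delta> n\<close>, the second by the L^1 convergence on C.\<close>
    have "(\<lambda>n. ennreal (A + ?E n) + ennreal ?c * (\<integral>\<^sup>+x. ennreal \<bar>\<psi> n x - u x\<bar> \<partial>lebesgue_on C)) \<longlonglongrightarrow>
      ennreal (A + 4 * K * ((N + 1) powr ((p - 2) / 2))\<^sup>2 * sqrt ((2 * (\<integral>x. (norm (G x))\<^sup>2 \<partial>?M) + 2 * 0) * 0)) + ennreal ?c * 0"
      by (intro tendsto_add tendsto_ennrealI ennreal_tendsto_cmult limC[rule_format] conjI C tendsto_intros \<delta>) simp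
    then have "(\<lambda>n. ennreal (A + ?E n) + ennreal ?c * (\<integral>\<^sup>+x. ennreal \<bar>\<psi> n x - u x\<bar> \<partial>lebesgue_on C)) \<longlonglongrightarrow> ennreal A"
      by simp
    then show "(\<integral>\<^sup>+x. ennreal ((min \<bar>u x\<bar> N / 2) powr p) \<partial>lebesgue_on C) \<le> ennreal A"
      by (rule LIMSEQ_le_const) (use bound in blast)
  qed
  \<comment> \<open>Only now is the truncation lifted, along the heights N = n + 1; the bound A does
    not depend on them.\<close>
  let ?t = "\<lambda>n x. ennreal ((min \<bar>u x\<bar> (real (Suc n)) / 2) powr p)"
  have "(\<integral>\<^sup>+x. ennreal ((\<bar>u x\<bar> / 2) powr p) \<partial>?M) = (\<integral>\<^sup>+x. (SUP n. ?t n x) \<partial>?M)"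
  proof (rule nn_integral_cong)
    fix x
    obtain n where n: "\<bar>u x\<bar> \<le> real n" using real_arch_simple by blast
    have "ennreal ((\<bar>u x\<bar> / 2) powr p) \<le> (SUP n. ?t n x)"
      by (rule SUP_upper2[of n]) (use n in \<open>auto simp: min_def\<close>)
    moreover have "(SUP n. ?t n x) \<le> ennreal ((\<bar>u x\<bar> / 2) powr p)"
      by (rule SUP_least) (use p in \<open>auto intro!: ennreal_leI powr_mono2\<close>)
    ultimately show "ennreal ((\<bar>u x\<bar> / 2) powr p) = (SUP n. ?t n x)" by simp
  qed
  also have "\<dots> = (SUP n. \<integral>\<^sup>+x. ?t n x \<partial>?M)"
  proof (rule nn_integral_monotone_convergence_SUP)
    show "incseq ?t" using p by (intro incseq_SucI le_funI ennreal_leI powr_mono2) auto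
    show "?t n \<in> borel_measurable ?M" for n using um by measurable
  qed
  also have "\<dots> \<le> ennreal A" by (rule SUP_least) (rule trunc, simp)
  finally have fin: "(\<integral>\<^sup>+x. ennreal ((\<bar>u x\<bar> / 2) powr p) \<partial>?M) \<le> ennreal A" .
  have "(\<integral>\<^sup>+x. ennreal (\<bar>u x\<bar> powr p) \<partial>?M) = (\<integral>\<^sup>+x. ennreal (2 powr p) * ennreal ((\<bar>u x\<bar> / 2) powr p) \<partial>?M)"
    by (intro nn_integral_cong) (simp add: ennreal_mult'[symmetric] powr_divide)
  also have "\<dots> = ennreal (2 powr p) * (\<integral>\<^sup>+x. ennreal ((\<bar>u x\<bar> / 2) powr p) \<partial>?M)"
    using um by (intro nn_integral_cmult) measurable
  also have "\<dots> \<le> ennreal (2 powr p) * ennreal A" using fin by (rule mult_left_mono) simp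
  also have "\<dots> = ennreal (2 powr p * A)" by (simp add: ennreal_mult')
  finally show ?thesis by (simp add: A_def)
qed

section \<open>Existence of weak solutions\<close>

text \<open>Completeness of L^2 in function form. The rate 4^(-n) is split: a factor 2^n is spent on
  pointwise control of the increments, and what is left, 2^(-n), still sums. Almost everywhere the
  increments then decay geometrically, and Fatou's lemma carries the rate over to the limit.\<close>

lemma square_integrable_fast_Cauchy:
  fixes g :: "nat \<Rightarrow> 'a \<Rightarrow> 'b::euclidean_space"
  assumes g: "\<And>n. square_integrable M (g n)"
    and C: "\<And>n m. n \<le> m \<Longrightarrow> (\<integral>x. (norm (g m x - g n x))\<^sup>2 \<partial>M) \<le> C * (1/4) ^ n"
  obtains G where "square_integrable M G"
    "\<forall>n. (\<integral>\<^sup>+x. ennreal ((norm (g n x - G x))\<^sup>2) \<partial>M) \<le> ennreal (C * (1/4) ^ n)"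
proof -
  have C0: "C \<ge> 0"
    using C[of 0 0] by simp
  have gm [measurable]: "g n \<in> borel_measurable M" for n
    using g by (rule square_integrable_measurable)
  have nn: "(\<integral>\<^sup>+x. ennreal ((norm (g m x - g n x))\<^sup>2) \<partial>M) \<le> ennreal (C * (1/4) ^ n)" if "n \<le> m" for n m
    unfolding square_integrable_nn_integral[OF square_integrable_diff[OF g g]]
    by (rule ennreal_leI[OF C[OF that]])
  let ?d = "\<lambda>n x. ennreal (2 ^ n * (norm (g (Suc n) x - g n x))\<^sup>2)"
  have "(\<integral>\<^sup>+x. (\<Sum>n. ?d n x) \<partial>M) = (\<Sum>n. \<integral>\<^sup>+x. ?d n x \<partial>M)"
    by (rule nn_integral_suminf) measurable
  also have "\<dots> \<le> (\<Sum>n. ennreal (C * (1/2) ^ n))"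
  proof (rule suminf_le)
    fix n
    have "(\<integral>\<^sup>+x. ?d n x \<partial>M) = (\<integral>\<^sup>+x. ennreal (2 ^ n) * ennreal ((norm (g (Suc n) x - g n x))\<^sup>2) \<partial>M)"
      by (intro nn_integral_cong) (simp add: ennreal_mult')
    also have "\<dots> = ennreal (2 ^ n) * (\<integral>\<^sup>+x. ennreal ((norm (g (Suc n) x - g n x))\<^sup>2) \<partial>M)"
      by (rule nn_integral_cmult) measurable
    also have "\<dots> \<le> ennreal (2 ^ n) * ennreal (C * (1/4) ^ n)"
      by (intro mult_left_mono nn) auto
    also have "\<dots> = ennreal (2 ^ n * (C * (1/4) ^ n))" by (rule ennreal_mult'[symmetric]) simp
    also have "2 ^ n * (C * (1/4) ^ n) = C * (1/2) ^ n"
      by (simp add: power_mult_distrib[symmetric] mult.left_commute)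
    finally show "(\<integral>\<^sup>+x. ?d n x \<partial>M) \<le> ennreal (C * (1/2) ^ n)" .
  qed auto
  also have "\<dots> < \<infinity>"
    using C0 by (subst suminf_ennreal_eq[where x="C * 2"])
      (auto intro!: sums_mult geometric_sums[of "1/2::real", simplified])
  finally have "(\<integral>\<^sup>+x. (\<Sum>n. ?d n x) \<partial>M) \<noteq> \<infinity>" by simp
  then have ae: "AE x in M. (\<Sum>n. ?d n x) \<noteq> \<infinity>"
    by (intro nn_integral_PInf_AE) measurable
  define G where "G x = lim (\<lambda>n. g n x)" for x
  have conv: "AE x in M. (\<lambda>n. g n x) \<longlonglongrightarrow> G x"
    using ae
  proof (rule AE_mp, intro AE_I2 impI)
    fix x assume fin: "(\<Sum>n. ?d n x) \<noteq> \<infinity>"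
    define S where "S = enn2real (\<Sum>n. ?d n x)"
    have "(\<Sum>n. ?d n x) < top" using fin by (simp only: less_top infinity_ennreal_def)
    then have S: "S \<ge> 0" "(\<Sum>n. ?d n x) = ennreal S"
      unfolding S_def by (simp_all only: enn2real_nonneg ennreal_enn2real)
    have b: "norm (g (Suc n) x - g n x) \<le> sqrt S * (sqrt (1/2)) ^ n" for n
    proof -
      have "?d n x = (\<Sum>n\<in>{n}. ?d n x)" by simp
      also have "\<dots> \<le> (\<Sum>n. ?d n x)" by (rule sum_le_suminf) auto
      also have "\<dots> = ennreal S" by (rule S(2))
      finally have "2 ^ n * (norm (g (Suc n) x - g n x))\<^sup>2 \<le> S" using S(1) by (simp only: ennreal_le_iff)
      then have "(norm (g (Suc n) x - g n x))\<^sup>2 \<le> S * (1/2) ^ n"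
        by (simp add: field_simps power_divide)
      then have "sqrt ((norm (g (Suc n) x - g n x))\<^sup>2) \<le> sqrt (S * (1/2) ^ n)"
        by (rule real_sqrt_le_mono)
      then show ?thesis by (simp add: real_sqrt_mult real_sqrt_power)
    qed
    have "summable (\<lambda>n. sqrt S * (sqrt (1/2)) ^ n)"
      by (intro summable_mult summable_geometric) (simp add: real_sqrt_divide)
    then have "summable (\<lambda>n. g (Suc n) x - g n x)"
      by (rule summable_comparison_test') (rule b)
    then have "convergent (\<lambda>n. \<Sum>i<n. g (Suc i) x - g i x)"
      by (simp add: summable_iff_convergent)
    then have "convergent (\<lambda>n. g n x - g 0 x)" by (simp only: sum_lessThan_telescope[of "\<lambda>i. g i x"])
    then have "convergent (\<lambda>n. (g n x - g 0 x) + g 0 x)" by (intro convergent_add convergent_const)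
    then show "(\<lambda>n. g n x) \<longlonglongrightarrow> G x" by (simp add: convergent_LIMSEQ_iff G_def)
  qed
  have Gm [measurable]: "G \<in> borel_measurable M"
    unfolding G_def by (rule borel_measurable_lim_metric) (rule gm)
  have bound: "(\<integral>\<^sup>+x. ennreal ((norm (g n x - G x))\<^sup>2) \<partial>M) \<le> ennreal (C * (1/4) ^ n)" for n
  proof -
    let ?h = "\<lambda>m x. ennreal ((norm (g m x - g n x))\<^sup>2)"
    have "(\<integral>\<^sup>+x. ennreal ((norm (g n x - G x))\<^sup>2) \<partial>M) = (\<integral>\<^sup>+x. liminf (\<lambda>m. ?h m x) \<partial>M)"
    proof (rule nn_integral_cong_AE)
      show "AE x in M. ennreal ((norm (g n x - G x))\<^sup>2) = liminf (\<lambda>m. ?h m x)"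
        using conv
      proof (rule AE_mp, intro AE_I2 impI)
        fix x assume "(\<lambda>n. g n x) \<longlonglongrightarrow> G x"
        then have "(\<lambda>m. ?h m x) \<longlonglongrightarrow> ennreal ((norm (G x - g n x))\<^sup>2)"
          by (intro tendsto_ennrealI tendsto_intros)
        then have "liminf (\<lambda>m. ?h m x) = ennreal ((norm (G x - g n x))\<^sup>2)"
          by (intro lim_imp_Liminf) auto
        then show "ennreal ((norm (g n x - G x))\<^sup>2) = liminf (\<lambda>m. ?h m x)"
          by (simp add: norm_minus_commute)
      qed
    qed
    also have "\<dots> \<le> liminf (\<lambda>m. \<integral>\<^sup>+x. ?h m x \<partial>M)"
      by (rule nn_integral_liminf) measurable
    also have "\<dots> \<le> ennreal (C * (1/4) ^ n)"
    proof -
      have "liminf (\<lambda>m. \<integral>\<^sup>+x. ?h m x \<partial>M) \<le> limsup (\<lambda>m. \<integral>\<^sup>+x. ?h m x \<partial>M)"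
        by (rule Liminf_le_Limsup) simp
      also have "\<dots> \<le> ennreal (C * (1/4) ^ n)"
        by (rule Limsup_bounded) (use nn in \<open>auto intro!: eventually_sequentiallyI[of n]\<close>)
      finally show ?thesis .
    qed
    finally show ?thesis .
  qed
  have "square_integrable M (\<lambda>x. g 0 x - G x)"
    unfolding square_integrable_iff_nn using bound[of 0] by (auto intro: le_less_trans)
  from square_integrable_diff[OF g[of 0] this] have "square_integrable M G" by simp
  then show ?thesis using that bound by blast
qed

text \<open>Dirichlet's principle before completion: take test functions within 4^(-n) of the
  infimum of the energy of grad \<psi> + f. The parallelogram law makes their gradients Cauchy, and
  near minimality makes the first variation nearly zero.\<close>

lemma gradient_energy_minimising_sequence:
  fixes f :: "real^'n \<Rightarrow> real^'n"
  assumes \<Omega>: "\<Omega> \<in> sets borel" and f: "square_integrable (lebesgue_on \<Omega>) f"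
  obtains \<psi> where "\<forall>n. test_function \<Omega> (\<psi> n)"
    "\<forall>n m. n \<le> m \<longrightarrow> (\<integral>x. (norm (gradient (\<psi> m) x - gradient (\<psi> n) x))\<^sup>2 \<partial>lebesgue_on \<Omega>) \<le> 4 * (1/4) ^ n"
    "\<forall>n \<phi>. test_function \<Omega> \<phi> \<longrightarrow> (\<integral>x. (gradient (\<psi> n) x + f x) \<bullet> gradient \<phi> x \<partial>lebesgue_on \<Omega>)\<^sup>2
      \<le> (1/4) ^ n * (\<integral>x. (norm (gradient \<phi> x))\<^sup>2 \<partial>lebesgue_on \<Omega>)"
proof -
  let ?M = "lebesgue_on \<Omega>"
  define I where "I \<psi> = (\<integral>x. (norm (gradient \<psi> x + f x))\<^sup>2 \<partial>?M)" for \<psi>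
  define m where "m = (INF \<psi>\<in>Collect (test_function \<Omega>). I \<psi>)"
  have bdd: "bdd_below (I ` Collect (test_function \<Omega>))"
    by (rule bdd_belowI[of _ 0]) (auto simp: I_def)
  have m: "m \<le> I \<psi>" if "test_function \<Omega> \<psi>" for \<psi>
    unfolding m_def by (rule cINF_lower[OF bdd]) (use that in simp)
  have ne: "Collect (test_function \<Omega>) \<noteq> {}" using test_function_zero_fun by blast
  have "\<exists>\<psi>. test_function \<Omega> \<psi> \<and> I \<psi> \<le> m + (1/4) ^ n" for n :: nat
  proof -
    have "m < m + (1/4) ^ n" by simp
    then obtain \<psi> where "\<psi> \<in> Collect (test_function \<Omega>)" "I \<psi> < m + (1/4) ^ n"
      unfolding m_def cINF_less_iff[OF ne bdd] by blast
    then show ?thesis by auto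
  qed
  then obtain \<psi> where \<psi>: "\<And>n. test_function \<Omega> (\<psi> n)" "\<And>n. I (\<psi> n) \<le> m + (1/4) ^ n" by metis
  have D: "square_integrable ?M (gradient \<phi>)" if "test_function \<Omega> \<phi>" for \<phi>
    by (rule test_function_square_integrable(2)[OF that \<Omega>])
  have Df: "square_integrable ?M (\<lambda>x. gradient \<phi> x + f x)" if "test_function \<Omega> \<phi>" for \<phi>
    by (rule square_integrable_add[OF D[OF that] f])
  show ?thesis
  proof (rule that[of \<psi>]; intro allI impI)
    show "test_function \<Omega> (\<psi> n)" for n by (rule \<psi>)
    fix n k :: nat assume nk: "n \<le> k"
    let ?a = "gradient (\<psi> k)" and ?b = "gradient (\<psi> n)"
    \<comment> \<open>The midpoint competes too: its energy is at least m, which forces two near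
      minimisers to be close.\<close>
    define \<phi> where "\<phi> x = (1/2) * (\<psi> k x + \<psi> n x)" for x
    have t: "test_function \<Omega> \<phi>"
      unfolding \<phi>_def by (intro test_function_cmult test_function_add \<psi>)
    have g\<phi>: "gradient \<phi> x = (1/2) *\<^sub>R (?a x + ?b x)" for x
      unfolding \<phi>_def test_function_gradient_cmult[OF test_function_add[OF \<psi>(1) \<psi>(1)]]
        test_function_gradient_add[OF \<psi>(1) \<psi>(1)] ..
    have "(norm (?a x - ?b x))\<^sup>2 =
       2 * (norm (?a x + f x))\<^sup>2 + 2 * (norm (?b x + f x))\<^sup>2 - 4 * (norm (gradient \<phi> x + f x))\<^sup>2" for x
      unfolding g\<phi> power2_norm_eq_inner
      by (simp add: inner_add inner_diff inner_commute algebra_simps)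
    then have "(\<integral>x. (norm (?a x - ?b x))\<^sup>2 \<partial>?M) = 2 * I (\<psi> k) + 2 * I (\<psi> n) - 4 * I \<phi>"
      using Df[OF \<psi>(1)[of k]] Df[OF \<psi>(1)[of n]] Df[OF t] by (simp add: square_integrable_def I_def)
    also have "\<dots> \<le> 2 * (m + (1/4) ^ n) + 2 * (m + (1/4) ^ n) - 4 * m"
    proof -
      have "(1/4::real) ^ k \<le> (1/4) ^ n" using nk by (intro power_decreasing) auto
      moreover have "2 * a + 2 * b - 4 * c \<le> 2 * (m + e) + 2 * (m + e) - 4 * m"
        if "e' \<le> e" "a \<le> m + e'" "b \<le> m + e" "m \<le> c" for a b c e e' :: real
        using that by (smt (verit))
      ultimately show ?thesis using \<psi>(2)[of k] \<psi>(2)[of n] m[OF t] by blast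
    qed
    finally show "(\<integral>x. (norm (?a x - ?b x))\<^sup>2 \<partial>?M) \<le> 4 * (1/4) ^ n" by simp
  next
    fix n :: nat and \<phi> assume t: "test_function \<Omega> \<phi>"
    let ?e = "(1/4) ^ n :: real" and ?a = "\<lambda>x. gradient (\<psi> n) x + f x"
    define q where "q = (\<integral>x. ?a x \<bullet> gradient \<phi> x \<partial>?M)"
    define F where "F = (\<integral>x. (norm (gradient \<phi> x))\<^sup>2 \<partial>?M)"
    have F: "F \<ge> 0" by (simp add: F_def)
    \<comment> \<open>Moving from \<open>\<psi> n\<close> in direction \<phi> can lower the energy
      by at most 4^(-n); the claim is the discriminant condition of this quadratic in s.\<close>
    have quad: "0 \<le> ?e + 2 * s * q + s\<^sup>2 * F" for s
    proof -
      have ts: "test_function \<Omega> (\<lambda>x. \<psi> n x + s * \<phi> x)"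
        by (intro test_function_add test_function_cmult \<psi> t)
      have eq: "gradient (\<lambda>x. \<psi> n x + s * \<phi> x) x + f x = ?a x + s *\<^sub>R gradient \<phi> x" for x
        using test_function_gradient_add[OF \<psi>(1) test_function_cmult[OF t]] test_function_gradient_cmult[OF t]
        by simp
      have "I (\<lambda>x. \<psi> n x + s * \<phi> x) = I (\<psi> n) + 2 * s * q + s\<^sup>2 * F"
        unfolding I_def q_def F_def eq by (rule square_integral_expand[OF Df[OF \<psi>(1)] D[OF t]])
      then show ?thesis using m[OF ts] \<psi>(2)[of n] by linarith
    qed
    have "q\<^sup>2 \<le> ?e * F"
    proof (cases "F = 0")
      case True
      have "q\<^sup>2 \<le> I (\<psi> n) * F"
        unfolding q_def I_def F_def by (rule Cauchy_Schwarz_integral[OF Df[OF \<psi>(1)] D[OF t]])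
      then show ?thesis using True by simp
    next
      case False
      then have F: "F > 0" using F by simp
      have "0 \<le> ?e - q\<^sup>2 / F"
        using quad[of "- q / F"] F by (simp add: power2_eq_square field_simps)
      then show ?thesis using F by (simp add: field_simps)
    qed
    then show "(\<integral>x. ?a x \<bullet> gradient \<phi> x \<partial>?M)\<^sup>2 \<le> ?e * (\<integral>x. (norm (gradient \<phi> x))\<^sup>2 \<partial>?M)"
      unfolding q_def F_def .
  qed
qed

text \<open>Gradients converge by completeness, and the Poincare inequality transfers the Cauchy
  property to the functions themselves. The approximating sequence and its global L^2 convergence
  belong to the conclusion because the lower bound inserts u into its own equation through
  them.\<close>

theorem weak_solution_exists:
  fixes f :: "real^'n \<Rightarrow> real^'n"
  assumes dom: "poincare_domain \<Omega> K" and f: "square_integrable (lebesgue_on \<Omega>) f"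
  obtains u G \<psi> where "weak_solution \<Omega> f u" "square_integrable (lebesgue_on \<Omega>) u"
    "square_integrable (lebesgue_on \<Omega>) G"
    "\<forall>\<phi>. test_function \<Omega> \<phi> \<longrightarrow> (\<integral>x. (G x + f x) \<bullet> gradient \<phi> x \<partial>lebesgue_on \<Omega>) = 0"
    "\<forall>n. test_function \<Omega> (\<psi> n)"
    "(\<lambda>n. \<integral>x. (norm (\<psi> n x - u x))\<^sup>2 \<partial>lebesgue_on \<Omega>) \<longlonglongrightarrow> 0"
    "(\<lambda>n. \<integral>x. (norm (gradient (\<psi> n) x - G x))\<^sup>2 \<partial>lebesgue_on \<Omega>) \<longlonglongrightarrow> 0"
proof -
  let ?M = "lebesgue_on \<Omega>"
  have \<Omega>: "\<Omega> \<in> sets borel" and K: "0 < K" using dom by (auto simp: poincare_domain_def)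
  have \<Omega>l: "\<Omega> \<in> sets lebesgue" using \<Omega> by (auto intro: sets_completionI_sets)
  obtain \<psi> where \<psi>': "\<forall>n. test_function \<Omega> (\<psi> n)"
    and cauchy: "\<forall>n m. n \<le> m \<longrightarrow> (\<integral>x. (norm (gradient (\<psi> m) x - gradient (\<psi> n) x))\<^sup>2 \<partial>?M) \<le> 4 * (1/4) ^ n"
    and almost: "\<forall>n \<phi>. test_function \<Omega> \<phi> \<longrightarrow> (\<integral>x. (gradient (\<psi> n) x + f x) \<bullet> gradient \<phi> x \<partial>?M)\<^sup>2
      \<le> (1/4) ^ n * (\<integral>x. (norm (gradient \<phi> x))\<^sup>2 \<partial>?M)"
    by (rule gradient_energy_minimising_sequence[OF \<Omega> f])
  have \<psi>: "test_function \<Omega> (\<psi> n)" for n using \<psi>' by blast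
  note D = test_function_square_integrable(2)[OF _ \<Omega>] and S = test_function_square_integrable(1)[OF _ \<Omega>]
  obtain G where G: "square_integrable ?M G"
    and GC: "\<forall>n. (\<integral>\<^sup>+x. ennreal ((norm (gradient (\<psi> n) x - G x))\<^sup>2) \<partial>?M) \<le> ennreal (4 * (1/4) ^ n)"
    by (rule square_integrable_fast_Cauchy[OF D[OF \<psi>] cauchy[rule_format]])
  have c\<psi>: "(\<integral>x. (norm (\<psi> m x - \<psi> n x))\<^sup>2 \<partial>?M) \<le> (4 * K) * (1/4) ^ n" if "n \<le> m" for n m
  proof -
    have "(\<integral>x. (norm (\<psi> m x - \<psi> n x))\<^sup>2 \<partial>?M) \<le> K * (\<integral>x. (norm (gradient (\<lambda>x. \<psi> m x - \<psi> n x) x))\<^sup>2 \<partial>?M)"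
      using poincare_domainD[OF dom test_function_diff[OF \<psi> \<psi>]] by simp
    also have "\<dots> \<le> K * (4 * (1/4) ^ n)"
      unfolding test_function_gradient_diff[OF \<psi> \<psi>]
      by (rule mult_left_mono) (use cauchy that K in auto)
    finally show ?thesis by simp
  qed
  obtain u where u: "square_integrable ?M u"
    and uC: "\<forall>n. (\<integral>\<^sup>+x. ennreal ((norm (\<psi> n x - u x))\<^sup>2) \<partial>?M) \<le> ennreal ((4 * K) * (1/4) ^ n)"
    by (rule square_integrable_fast_Cauchy[OF S[OF \<psi>] c\<psi>])
  have qG: "(\<integral>x. (norm (gradient (\<psi> n) x - G x))\<^sup>2 \<partial>?M) \<le> 4 * (1/4) ^ n" for n
    using GC[rule_format, of n] unfolding square_integrable_nn_integral[OF square_integrable_diff[OF D[OF \<psi>] G]]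
    by (subst (asm) ennreal_le_iff) auto
  have qu: "(\<integral>x. (norm (\<psi> n x - u x))\<^sup>2 \<partial>?M) \<le> (4 * K) * (1/4) ^ n" for n
    using uC[rule_format, of n] K unfolding square_integrable_nn_integral[OF square_integrable_diff[OF S[OF \<psi>] u]]
    by (subst (asm) ennreal_le_iff) auto
  have z4: "(\<lambda>n. c * (1/4::real) ^ n) \<longlonglongrightarrow> 0" for c
    using tendsto_mult[OF tendsto_const[of c] LIMSEQ_power_zero[of "1/4::real"]] by simp
  have limG: "(\<lambda>n. \<integral>x. (norm (gradient (\<psi> n) x - G x))\<^sup>2 \<partial>?M) \<longlonglongrightarrow> 0"
    by (rule tendsto_sandwich[OF _ _ tendsto_const z4[of 4]]) (use qG in auto)
  have limu: "(\<lambda>n. \<integral>x. (norm (\<psi> n x - u x))\<^sup>2 \<partial>?M) \<longlonglongrightarrow> 0"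
    by (rule tendsto_sandwich[OF _ _ tendsto_const z4[of "4 * K"]]) (use qu in auto)
  have weak: "(\<integral>x. (G x + f x) \<bullet> gradient \<phi> x \<partial>?M) = 0" if t: "test_function \<Omega> \<phi>" for \<phi>
  proof -
    let ?F = "\<integral>x. (norm (gradient \<phi> x))\<^sup>2 \<partial>?M" and ?q = "\<integral>x. (G x + f x) \<bullet> gradient \<phi> x \<partial>?M"
    have F: "?F \<ge> 0" by simp
    \<comment> \<open>10 = 2 + 8: q is the first variation at \<open>\<psi> n\<close>, of square at
      most 4^(-n) F, minus the error from replacing the gradient of \<open>\<psi> n\<close> by G,
      whose square is at most 4 times as large.\<close>
    have "?q\<^sup>2 \<le> (10 * ?F) * (1/4) ^ n" for n
    proof -
      let ?a = "\<integral>x. (gradient (\<psi> n) x + f x) \<bullet> gradient \<phi> x \<partial>?M"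
      let ?b = "\<integral>x. (gradient (\<psi> n) x - G x) \<bullet> gradient \<phi> x \<partial>?M"
      have DG: "square_integrable ?M (\<lambda>x. gradient (\<psi> n) x - G x)"
        by (rule square_integrable_diff[OF D[OF \<psi>] G])
      have "(\<integral>x. ((gradient (\<psi> n) x + f x) \<bullet> gradient \<phi> x) - ((gradient (\<psi> n) x - G x) \<bullet> gradient \<phi> x) \<partial>?M) = ?a - ?b"
        by (intro Bochner_Integration.integral_diff square_integrable_inner square_integrable_add DG f D[OF t] D[OF \<psi>])
      then have "?q = ?a - ?b" by (simp add: inner_add_left inner_diff_left add.commute)
      then have "?q\<^sup>2 \<le> 2 * ?a\<^sup>2 + 2 * ?b\<^sup>2"
        using zero_le_power2[of "?a + ?b"] by (simp add: power2_sum power2_diff)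
      moreover have "?a\<^sup>2 \<le> (1/4) ^ n * ?F" using almost t by blast
      moreover have "?b\<^sup>2 \<le> 4 * (1/4) ^ n * ?F"
        using Cauchy_Schwarz_integral[OF DG D[OF t]] mult_right_mono[OF qG[of n] F] by linarith
      ultimately show ?thesis by (simp add: algebra_simps)
    qed
    then have "?q\<^sup>2 \<le> 0" by (intro LIMSEQ_le_const[OF z4[of "10 * ?F"]]) blast
    then show ?thesis by simp
  qed
  have W: "W012 \<Omega> u G"
    unfolding W012_def
  proof (intro conjI exI[of _ \<psi>] allI impI)
    show "u \<in> borel_measurable ?M" using u by (rule square_integrable_measurable)
    show "G \<in> Lp_space 2 \<Omega>" using G by (simp add: Lp_space_2_iff)
    show "test_function \<Omega> (\<psi> n)" for n by (rule \<psi>)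
    have "(\<lambda>n. ennreal (\<integral>x. (norm (gradient (\<psi> n) x - G x))\<^sup>2 \<partial>?M)) \<longlonglongrightarrow> ennreal 0"
      by (rule tendsto_ennrealI[OF limG])
    then show "(\<lambda>n. Lp_norm 2 \<Omega> (\<lambda>x. gradient (\<psi> n) x - G x)) \<longlonglongrightarrow> 0"
      unfolding Lp_norm_tendsto_0_iff[OF zero_less_numeral] norm_powr_2
        square_integrable_nn_integral[OF square_integrable_diff[OF D[OF \<psi>] G]] by simp
    fix C assume C: "compact C \<and> C \<subseteq> \<Omega>"
    have Cl: "C \<in> lmeasurable" using C by (intro lmeasurable_compact) simp
    have Cs: "C \<in> sets lebesgue" using Cl by (rule fmeasurableD)
    have uC': "u \<in> borel_measurable (lebesgue_on C)"
      using measurable_restrict_mono[OF square_integrable_measurable[OF u]] C by blast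
    define c where "c = measure lebesgue C"
    have emC: "emeasure (lebesgue_on C) C = ennreal c"
      using Cl Cs by (simp add: c_def emeasure_restrict_space emeasure_eq_measure2)
    have b: "(\<integral>\<^sup>+x. ennreal \<bar>\<psi> n x - u x\<bar> \<partial>lebesgue_on C) \<le> ennreal ((c + 4 * K) * (1/2) ^ n)" for n
    proof -
      have \<psi>m: "\<psi> n \<in> borel_measurable (lebesgue_on C)" by (rule test_function_measurable(3)[OF \<psi>])
      have "(\<integral>\<^sup>+x. ennreal \<bar>\<psi> n x - u x\<bar> \<partial>lebesgue_on C) \<le>
         (\<integral>\<^sup>+x. ennreal ((1/2) ^ n) + ennreal (2 ^ n) * ennreal ((norm (\<psi> n x - u x))\<^sup>2) \<partial>lebesgue_on C)"
      proof (rule nn_integral_mono)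
        fix x
        let ?a = "\<bar>\<psi> n x - u x\<bar>"
        \<comment> \<open>Young's inequality at scale 2^n: a \<le> 2^(-n) + 2^n a^2 turns the L^2
          rate 4^(-n) into an L^1 rate 2^(-n) on a set of finite measure.\<close>
        have "2 * ?a * 2 ^ n \<le> 1 + (2 ^ n * ?a)\<^sup>2"
          using sum_squares_bound[of 1 "2 ^ n * ?a"] by (simp add: mult_ac)
        then have "2 * ?a * 2 ^ n * (1/2) ^ n \<le> (1 + (2 ^ n * ?a)\<^sup>2) * (1/2) ^ n"
          by (rule mult_right_mono) simp
        moreover have "2 ^ n * (1/2::real) ^ n = 1" by (simp add: power_mult_distrib[symmetric])
        ultimately have "2 * ?a \<le> (1/2) ^ n + 2 ^ n * ?a\<^sup>2"
          by (simp add: power2_eq_square algebra_simps power_divide)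
        moreover have "a \<le> b" if "2 * a \<le> b" "0 \<le> a" for a b :: real using that by linarith
        ultimately have "?a \<le> (1/2) ^ n + 2 ^ n * ?a\<^sup>2" using abs_ge_zero by blast
        then have "ennreal ?a \<le> ennreal ((1/2) ^ n + 2 ^ n * ?a\<^sup>2)" by (rule ennreal_leI)
        also have "\<dots> = ennreal ((1/2) ^ n) + ennreal (2 ^ n * ?a\<^sup>2)" by (rule ennreal_plus) auto
        also have "ennreal (2 ^ n * ?a\<^sup>2) = ennreal (2 ^ n) * ennreal ((norm (\<psi> n x - u x))\<^sup>2)"
          by (subst ennreal_mult') auto
        finally show "ennreal ?a \<le> ennreal ((1/2) ^ n) + ennreal (2 ^ n) * ennreal ((norm (\<psi> n x - u x))\<^sup>2)" .
      qed
      also have "\<dots> = (\<integral>\<^sup>+x. ennreal ((1/2) ^ n) \<partial>lebesgue_on C) +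
          ennreal (2 ^ n) * (\<integral>\<^sup>+x. ennreal ((norm (\<psi> n x - u x))\<^sup>2) \<partial>lebesgue_on C)"
        using uC' \<psi>m by (subst nn_integral_add) (auto simp: nn_integral_cmult)
      also have "\<dots> \<le> ennreal ((1/2) ^ n) * ennreal c + ennreal (2 ^ n) * ennreal ((4 * K) * (1/4) ^ n)"
      proof (intro add_mono mult_left_mono)
        show "(\<integral>\<^sup>+x. ennreal ((1/2) ^ n) \<partial>lebesgue_on C) \<le> ennreal ((1/2) ^ n) * ennreal c"
          using emC by simp
        show "(\<integral>\<^sup>+x. ennreal ((norm (\<psi> n x - u x))\<^sup>2) \<partial>lebesgue_on C) \<le> ennreal ((4 * K) * (1/4) ^ n)"
          using nn_integral_lebesgue_on_mono_set[OF \<Omega>l Cs] C uC order_trans by blast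
      qed auto
      also have "\<dots> = ennreal ((1/2) ^ n * c + 2 ^ n * ((4 * K) * (1/4) ^ n))"
        using K by (simp add: ennreal_mult'[symmetric] ennreal_plus[symmetric] c_def del: ennreal_plus)
      also have "(1/2) ^ n * c + 2 ^ n * ((4 * K) * (1/4) ^ n) = (c + 4 * K) * (1/2) ^ n"
      proof -
        have "2 ^ n * (1/4::real) ^ n = (1/2) ^ n" by (simp add: power_mult_distrib[symmetric])
        then show ?thesis by (simp add: algebra_simps)
      qed
      finally show ?thesis .
    qed
    have "(\<lambda>n. ennreal ((c + 4 * K) * (1/2) ^ n)) \<longlonglongrightarrow> ennreal 0"
      using tendsto_mult[OF tendsto_const[of "c + 4 * K"] LIMSEQ_power_zero[of "1/2::real"]]
      by (intro tendsto_ennrealI) simp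
    then have h: "(\<lambda>n. ennreal ((c + 4 * K) * (1/2) ^ n)) \<longlonglongrightarrow> 0" by (simp only: ennreal_0)
    have "(\<lambda>n. \<integral>\<^sup>+x. ennreal \<bar>\<psi> n x - u x\<bar> \<partial>lebesgue_on C) \<longlonglongrightarrow> 0"
    proof (rule tendsto_sandwich[OF _ _ tendsto_const h])
      show "\<forall>\<^sub>F n in sequentially. (0::ennreal) \<le> (\<integral>\<^sup>+x. ennreal \<bar>\<psi> n x - u x\<bar> \<partial>lebesgue_on C)"
        by (intro always_eventually allI zero_le)
      show "\<forall>\<^sub>F n in sequentially. (\<integral>\<^sup>+x. ennreal \<bar>\<psi> n x - u x\<bar> \<partial>lebesgue_on C) \<le> ennreal ((c + 4 * K) * (1/2) ^ n)"
        by (intro always_eventually allI) (rule b)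
    qed
    then show "(\<lambda>n. Lp_norm 1 C (\<lambda>x. \<psi> n x - u x)) \<longlonglongrightarrow> 0"
      unfolding Lp_norm_tendsto_0_iff[OF zero_less_one] by simp
  qed
  have "weak_solution \<Omega> f u"
    unfolding weak_solution_def
  proof (intro exI[of _ G] conjI W allI impI)
    fix \<phi> assume t: "test_function \<Omega> \<phi>"
    have "(\<integral>x. G x \<bullet> gradient \<phi> x + f x \<bullet> gradient \<phi> x \<partial>?M) =
        (\<integral>x. G x \<bullet> gradient \<phi> x \<partial>?M) + (\<integral>x. f x \<bullet> gradient \<phi> x \<partial>?M)"
      by (intro Bochner_Integration.integral_add square_integrable_inner f G D[OF t])
    then show "(\<integral>x. G x \<bullet> gradient \<phi> x \<partial>?M) = - (\<integral>x. f x \<bullet> gradient \<phi> x \<partial>?M)"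
      using weak[OF t] by (simp add: inner_add_left)
  qed
  from that[OF this u G _ \<psi>' limu limG] show ?thesis using weak by blast
qed

section \<open>Cutoff functions\<close>

text \<open>An interior point could be moved a little further along the axis. The sign \<sigma>
  treats both directions, and the lemma serves the hole as well as the unit cell.\<close>

lemma frontier_coordinate_maximum:
  fixes w :: "real^'n"
  assumes w: "w \<in> S" "\<forall>y\<in>S. \<sigma> * y $ i \<le> \<sigma> * w $ i" and \<sigma>: "\<sigma> = 1 \<or> \<sigma> = -1"
  shows "w \<in> frontier S"
proof -
  have "w \<notin> interior S"
  proof
    assume "w \<in> interior S"
    then obtain e where e: "e > 0" "ball w e \<subseteq> S" using mem_interior by blast
    let ?y = "w + (\<sigma> * (e/2)) *\<^sub>R axis i 1"
    have "dist w ?y < e" using e(1) \<sigma> by (auto simp: dist_norm norm_axis_1)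
    then have "?y \<in> S" using e(2) by auto
    then have "\<sigma> * ?y $ i \<le> \<sigma> * w $ i" using w(2) by blast
    then show False using e(1) \<sigma> by (auto simp: axis_def)
  qed
  then show ?thesis using w(1) closure_subset by (auto simp: frontier_def)
qed

text \<open>The distance assumption speaks of frontiers, so it is evaluated where T reaches furthest
  in a coordinate direction: this point lies on the frontier of T, and its projection to the face of
  the unit cell lies on the other frontier. The cap 1/8 on c leaves room for the nested cubes of the
  cutoff.\<close>

lemma admissible_hole_in_cube:
  fixes T :: "(real^'n) set"
  assumes "admissible_hole T"
  obtains c where "0 < c" "c \<le> 1/8" "compact T" "ball 0 c \<subseteq> T" "\<forall>x\<in>T. \<forall>i. \<bar>x $ i\<bar> \<le> 1/2 - c"
proof -
  obtain D c\<^sub>0 where D: "bounded_lipschitz_domain D" "D \<subseteq> unit_cell" "T = closure D"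
    and c: "c\<^sub>0 > 0" "ball 0 c\<^sub>0 \<subseteq> T" "c\<^sub>0 \<le> setdist (frontier T) (frontier unit_cell)"
    using assms unfolding admissible_hole_def by blast
  have compT: "compact T" using D(1,3) by (simp add: bounded_lipschitz_domain_def compact_closure)
  have TU: "T \<subseteq> unit_cell"
    unfolding D(3) by (rule closure_minimal[OF D(2)]) (unfold unit_cell_def, rule closed_cbox)
  have ne: "T \<noteq> {}" using c(1,2) by (metis centre_in_ball empty_iff subset_iff)
  have unit: "y \<in> unit_cell \<longleftrightarrow> (\<forall>j. - 1/2 \<le> y $ j \<and> y $ j \<le> 1/2)" for y :: "real^'n"
    by (simp add: unit_cell_def mem_box_cart)
  have bound: "\<sigma> * x $ i \<le> 1/2 - c\<^sub>0" if x: "x \<in> T" and \<sigma>: "\<sigma> = 1 \<or> \<sigma> = -1" for x \<sigma> i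
  proof -
    have "continuous_on T (\<lambda>x. \<sigma> * x $ i)" by (intro continuous_intros)
    from continuous_attains_sup[OF compT ne this]
    obtain w where w: "w \<in> T" "\<forall>y\<in>T. \<sigma> * y $ i \<le> \<sigma> * w $ i" by blast
    have wU: "- 1/2 \<le> w $ j \<and> w $ j \<le> 1/2" for j using w(1) TU unit by blast
    have w2: "\<sigma> * w $ i \<le> 1/2" using \<sigma> wU[of i] by auto
    have wF: "w \<in> frontier T" by (rule frontier_coordinate_maximum[OF w \<sigma>])
    define q where "q = w + (\<sigma> * (1/2 - \<sigma> * w $ i)) *\<^sub>R axis i 1"
    have qj: "q $ j = (if j = i then \<sigma> / 2 else w $ j)" for j
      using \<sigma> by (auto simp: q_def axis_def algebra_simps)
    have "q \<in> unit_cell" unfolding unit qj using wU \<sigma> by auto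
    moreover have "\<forall>y\<in>unit_cell. \<sigma> * y $ i \<le> \<sigma> * q $ i"
    proof
      fix y :: "real^'n" assume "y \<in> unit_cell"
      then have "- 1/2 \<le> y $ i \<and> y $ i \<le> 1/2" using unit by blast
      then show "\<sigma> * y $ i \<le> \<sigma> * q $ i" using \<sigma> qj[of i] by auto
    qed
    ultimately have qF: "q \<in> frontier unit_cell" using frontier_coordinate_maximum \<sigma> by blast
    have "c\<^sub>0 \<le> dist w q" using c(3) setdist_le_dist[OF wF qF] by linarith
    also have "dist w q = \<bar>1/2 - \<sigma> * w $ i\<bar>" using \<sigma> by (auto simp: q_def dist_norm norm_axis_1)
    finally show ?thesis using w2 w(2) x by fastforce
  qed
  define c where "c = min c\<^sub>0 (1/8)"
  have "\<bar>x $ i\<bar> \<le> 1/2 - c" if "x \<in> T" for x i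
    using bound[OF that, of 1 i] bound[OF that, of "-1" i] unfolding c_def by auto
  moreover have "ball 0 c \<subseteq> T" using c(2) by (auto simp: c_def)
  ultimately show ?thesis using that[of c] c(1) compT by (auto simp: c_def)
qed

lemma perforated_domain_subset:
  assumes "0 < \<epsilon>" "0 < \<eta>" "ball 0 c \<subseteq> T" "k \<in> int_lattice" "x \<in> ball (\<epsilon> *\<^sub>R k) (\<epsilon> * \<eta> * c)"
  shows "x \<notin> perforated_domain T \<epsilon> \<eta>"
proof -
  let ?y = "(1 / (\<epsilon> * \<eta>)) *\<^sub>R (x - \<epsilon> *\<^sub>R k)"
  have "norm ?y < c"
    using assms by (simp add: dist_norm norm_minus_commute divide_less_eq mult.commute)
  then have "?y \<in> T" using assms(3) by auto
  moreover have "x = \<epsilon> *\<^sub>R (k + \<eta> *\<^sub>R ?y)"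
    using assms(1,2) by (simp add: scaleR_add_right)
  ultimately show ?thesis using assms(4) unfolding perforated_domain_def by blast
qed

text \<open>P is fixed before \<epsilon> and \<eta>: a function vanishing off the perforated domain
  vanishes on a ball of radius \<open>\<epsilon> * \<eta> * c\<close> in every cell, and only this
  ball enters the constant.\<close>

lemma poincare_perforated_domain:
  fixes T :: "(real^'n) set"
  assumes "CARD('n) \<ge> 2" "compact T" "0 < c" "ball 0 c \<subseteq> T"
  obtains P where "P > 0" "\<forall>\<epsilon> \<eta>. 0 < \<epsilon> \<and> 0 < \<eta> \<and> \<eta> \<le> 1 \<and> scale_factor CARD('n) \<eta> \<noteq> 0 \<longrightarrow>
    poincare_domain (perforated_domain T \<epsilon> \<eta>) (P * (\<epsilon> * scale_factor CARD('n) \<eta>)\<^sup>2)"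
proof -
  obtain P where P: "P > 0"
    "\<And>\<epsilon> \<eta> \<psi> :: real^'n \<Rightarrow> real. 0 < \<epsilon> \<Longrightarrow> 0 < \<eta> \<Longrightarrow> \<eta> \<le> 1 \<Longrightarrow> Ck (Suc 0) \<psi> \<Longrightarrow>
      (\<And>k x. k \<in> int_lattice \<Longrightarrow> x \<in> ball (\<epsilon> *\<^sub>R k) (\<epsilon> * \<eta> * c) \<Longrightarrow> \<psi> x = 0) \<Longrightarrow>
      (\<integral>\<^sup>+x. ennreal ((\<psi> x)\<^sup>2) \<partial>lborel) \<le>
        ennreal (P * (\<epsilon> * scale_factor CARD('n) \<eta>)\<^sup>2) * (\<integral>\<^sup>+x. ennreal ((norm (gradient \<psi> x))\<^sup>2) \<partial>lborel)"
    using poincare_perforated[OF assms(1,3)] by metis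
  show ?thesis
  proof (rule that[OF P(1)]; intro allI impI)
    fix \<epsilon> \<eta> :: real assume H: "0 < \<epsilon> \<and> 0 < \<eta> \<and> \<eta> \<le> 1 \<and> scale_factor CARD('n) \<eta> \<noteq> 0"
    let ?\<Omega> = "perforated_domain T \<epsilon> \<eta>"
    have \<Omega>: "?\<Omega> \<in> sets borel" by (rule perforated_domain_borel[OF assms(2)])
    show "poincare_domain ?\<Omega> (P * (\<epsilon> * scale_factor CARD('n) \<eta>)\<^sup>2)"
      unfolding poincare_domain_def
    proof (intro conjI \<Omega> allI impI)
      show "0 < P * (\<epsilon> * scale_factor CARD('n) \<eta>)\<^sup>2" using P(1) H by simp
      fix \<psi> :: "real^'n \<Rightarrow> real"
      assume Ck: "Ck (Suc 0) \<psi>" and z: "\<forall>x. x \<notin> ?\<Omega> \<longrightarrow> \<psi> x = 0 \<and> gradient \<psi> x = 0"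
      have "(\<integral>\<^sup>+x. ennreal ((\<psi> x)\<^sup>2) \<partial>lborel) \<le>
        ennreal (P * (\<epsilon> * scale_factor CARD('n) \<eta>)\<^sup>2) * (\<integral>\<^sup>+x. ennreal ((norm (gradient \<psi> x))\<^sup>2) \<partial>lborel)"
      proof (rule P(2)[OF _ _ _ Ck])
        show "\<psi> x = 0" if "k \<in> int_lattice" "x \<in> ball (\<epsilon> *\<^sub>R k) (\<epsilon> * \<eta> * c)" for k x
          using perforated_domain_subset[OF _ _ assms(4) that] H z by blast
      qed (use H in auto)
      then show "(\<integral>\<^sup>+x. ennreal ((\<psi> x)\<^sup>2) \<partial>lebesgue_on ?\<Omega>) \<le>
        ennreal (P * (\<epsilon> * scale_factor CARD('n) \<eta>)\<^sup>2) *
          (\<integral>\<^sup>+x. ennreal ((norm (gradient \<psi> x))\<^sup>2) \<partial>lebesgue_on ?\<Omega>)"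
        using z by (subst (1 2) nn_integral_lebesgue_on_eq_lborel[OF \<Omega>]) auto
    qed
  qed
qed

section \<open>Volumes of cubes, cells and slabs\<close>

lemma emeasure_lborel_cbox_cart:
  fixes l u :: "real^'n"
  assumes "\<And>i. l $ i \<le> u $ i"
  shows "emeasure lborel (cbox l u) = ennreal (\<Prod>i\<in>UNIV. u $ i - l $ i)"
    and "emeasure lborel (box l u) = ennreal (\<Prod>i\<in>UNIV. u $ i - l $ i)"
proof -
  have ne: "cbox l u \<noteq> {}" unfolding interval_ne_empty_cart using assms by blast
  have "emeasure lborel (cbox l u) = ennreal (measure lborel (cbox l u))"
    by (intro emeasure_eq_ennreal_measure) (simp add: emeasure_lborel_cbox_eq)
  also have "measure lborel (cbox l u) = (\<Prod>i\<in>UNIV. u $ i - l $ i)"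
    using content_cbox_cart[OF ne] by simp
  finally show 1: "emeasure lborel (cbox l u) = ennreal (\<Prod>i\<in>UNIV. u $ i - l $ i)" .
  have "emeasure lborel (box l u) = emeasure lborel (cbox l u)"
    by (simp add: emeasure_lborel_box_eq emeasure_lborel_cbox_eq)
  with 1 show "emeasure lborel (box l u) = ennreal (\<Prod>i\<in>UNIV. u $ i - l $ i)" by simp
qed

definition cube :: "real \<Rightarrow> (real^'n) set" where
  "cube r = {x. \<forall>i. \<bar>x $ i\<bar> \<le> r}"

lemma cube_eq_cbox: "cube r = (cbox (\<chi> i. - r) (\<chi> i. r) :: (real^'n) set)"
  by (auto simp: cube_def mem_box_cart abs_le_iff minus_le_iff)

lemma cube_borel [measurable]: "cube r \<in> sets borel"
  by (simp add: cube_eq_cbox)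

lemma emeasure_cube:
  assumes "0 \<le> r"
  shows "emeasure lborel (cube r :: (real^'n) set) = ennreal ((2 * r) ^ CARD('n))"
  unfolding cube_eq_cbox using assms by (subst emeasure_lborel_cbox_cart) auto

lemma emeasure_cell:
  fixes z :: "real^'n"
  assumes "0 < \<epsilon>"
  shows "emeasure lborel (cell \<epsilon> z) = ennreal (\<epsilon> ^ CARD('n))"
proof (rule antisym)
  let ?l = "\<chi> i. z $ i - \<epsilon> / 2" and ?u = "\<chi> i. z $ i + \<epsilon> / 2"
  have e: "emeasure lborel (cbox ?l ?u) = ennreal (\<epsilon> ^ CARD('n))" "emeasure lborel (box ?l ?u) = ennreal (\<epsilon> ^ CARD('n))"
    using assms by (subst emeasure_lborel_cbox_cart; simp)+
  have "cell \<epsilon> z \<subseteq> cbox ?l ?u"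
  proof
    fix x assume "x \<in> cell \<epsilon> z"
    then have x: "- \<epsilon> / 2 \<le> x $ i - z $ i \<and> x $ i - z $ i < \<epsilon> / 2" for i by (simp add: cell_def)
    have "z $ i - \<epsilon> / 2 \<le> x $ i \<and> x $ i \<le> z $ i + \<epsilon> / 2" for i using x[of i] by linarith
    then show "x \<in> cbox ?l ?u" by (simp add: mem_box_cart)
  qed
  then show "emeasure lborel (cell \<epsilon> z) \<le> ennreal (\<epsilon> ^ CARD('n))"
    unfolding e(1)[symmetric] by (rule emeasure_mono) simp
  have "box ?l ?u \<subseteq> cell \<epsilon> z"
  proof
    fix x assume "x \<in> box ?l ?u"
    then have x: "z $ i - \<epsilon> / 2 < x $ i \<and> x $ i < z $ i + \<epsilon> / 2" for i by (simp add: mem_box_cart)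
    have "- \<epsilon> / 2 \<le> x $ i - z $ i \<and> x $ i - z $ i < \<epsilon> / 2" for i using x[of i] by linarith
    then show "x \<in> cell \<epsilon> z" by (simp add: cell_def)
  qed
  then show "ennreal (\<epsilon> ^ CARD('n)) \<le> emeasure lborel (cell \<epsilon> z)"
    unfolding e(2)[symmetric] by (rule emeasure_mono) simp
qed

text \<open>A thin slab along one face of the cell lies outside the support of the cell cutoff. It
  carries a fixed fraction of the volume, on which the test function of the lower bound keeps its
  full size.\<close>

lemma emeasure_cell_slab:
  fixes z :: "real^'n"
  assumes "0 < \<epsilon>" "0 \<le> c" "c \<le> 1"
  shows "ennreal (c * \<epsilon> ^ CARD('n)) \<le> emeasure lborel {x \<in> cell \<epsilon> z. (1/2 - c) * \<epsilon> \<le> x $ j - z $ j}"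
proof -
  let ?l = "\<chi> i. z $ i + (if i = j then (1/2 - c) * \<epsilon> else - \<epsilon> / 2)" and ?u = "\<chi> i. z $ i + \<epsilon> / 2"
  let ?S = "{x \<in> cell \<epsilon> z. (1/2 - c) * \<epsilon> \<le> x $ j - z $ j}"
  have ce: "0 \<le> c * \<epsilon>" "c * \<epsilon> \<le> \<epsilon>" using assms by (auto intro: mult_left_le_one_le)
  have "emeasure lborel (box ?l ?u) = ennreal (\<Prod>i\<in>UNIV. if i = j then c * \<epsilon> else \<epsilon>)"
    using assms ce
    by (subst emeasure_lborel_cbox_cart) (auto simp: algebra_simps intro!: arg_cong[where f=ennreal] prod.cong)
  also have "(\<Prod>i\<in>UNIV. if i = j then c * \<epsilon> else \<epsilon>) = (c * \<epsilon>) * (\<Prod>i\<in>UNIV - {j}. \<epsilon>)"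
    by (subst prod.remove[of UNIV j]) (auto intro!: prod.cong arg_cong2[where f="(*)"])
  also have "\<dots> = c * \<epsilon> ^ CARD('n)"
  proof -
    have "\<epsilon> ^ CARD('n) = \<epsilon> * \<epsilon> ^ (CARD('n) - 1)" by (rule power_eq_if[THEN trans]) simp
    then show ?thesis by (simp add: card_Diff_singleton)
  qed
  finally have "ennreal (c * \<epsilon> ^ CARD('n)) = emeasure lborel (box ?l ?u)" by simp
  also have "\<dots> \<le> emeasure lborel ?S"
  proof (rule emeasure_mono)
    show "box ?l ?u \<subseteq> ?S"
    proof
      fix x assume x: "x \<in> box ?l ?u"
      have j: "(1/2 - c) * \<epsilon> < x $ j - z $ j" using x by (auto simp: mem_box_cart dest!: spec[of _ j])
      have "- \<epsilon> / 2 \<le> x $ i - z $ i \<and> x $ i - z $ i < \<epsilon> / 2" for i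
      proof -
        have "z $ i + (if i = j then (1/2 - c) * \<epsilon> else - \<epsilon> / 2) < x $ i \<and> x $ i < z $ i + \<epsilon> / 2"
          using x by (simp add: mem_box_cart)
        moreover have "- \<epsilon> / 2 \<le> (1/2 - c) * \<epsilon>" using ce by (simp add: algebra_simps)
        ultimately show ?thesis by (cases "i = j") auto
      qed
      then show "x \<in> ?S" using j by (simp add: cell_def)
    qed
    have "{x. (1/2 - c) * \<epsilon> \<le> x $ j - z $ j} \<in> sets borel"
      by (intro borel_closed closed_Collect_le continuous_intros)
    then have "cell \<epsilon> z \<inter> {x. (1/2 - c) * \<epsilon> \<le> x $ j - z $ j} \<in> sets borel" by (intro sets.Int) auto
    moreover have "?S = cell \<epsilon> z \<inter> {x. (1/2 - c) * \<epsilon> \<le> x $ j - z $ j}" by blast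
    ultimately show "?S \<in> sets lborel" by (simp only: sets_lborel)
  qed
  finally show ?thesis .
qed

lemma gradient_eq_0_locally_const:
  assumes "open U" "x \<in> U" "\<And>y. y \<in> U \<Longrightarrow> f y = c"
  shows "gradient f x = 0"
proof (rule has_derivative_imp_gradient)
  have "((\<lambda>x. c) has_derivative (\<lambda>h. 0 \<bullet> h)) (at x)" by simp
  then show "(f has_derivative (\<lambda>h. 0 \<bullet> h)) (at x)"
    by (rule has_derivative_transform_within_open[OF _ assms(1,2)]) (simp add: assms(3))
qed

lemma open_coord_less: "open {x :: real^'n. \<forall>i. \<bar>x $ i\<bar> < r}"
proof -
  have "{x :: real^'n. \<forall>i. \<bar>x $ i\<bar> < r} = (\<Inter>i. {x. \<bar>x $ i\<bar> < r})" by auto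
  also have "open \<dots>" by (intro open_INT) (auto intro!: open_Collect_less continuous_intros)
  finally show ?thesis .
qed

lemma open_coord_greater: "open {x :: real^'n. r < \<bar>x $ i\<bar>}"
  by (intro open_Collect_less continuous_intros)

lemma norm_sum_sq_disjoint:
  fixes g :: "'i \<Rightarrow> 'b::real_inner"
  assumes "finite I" "\<And>i j. i \<in> I \<Longrightarrow> j \<in> I \<Longrightarrow> i \<noteq> j \<Longrightarrow> g i = 0 \<or> g j = 0"
  shows "(norm (\<Sum>i\<in>I. g i))\<^sup>2 = (\<Sum>i\<in>I. (norm (g i))\<^sup>2)"
proof (cases "\<exists>i\<in>I. g i \<noteq> 0")
  case True
  then obtain i where i: "i \<in> I" "g i \<noteq> 0" by blast
  then have z: "g j = 0" if "j \<in> I - {i}" for j using assms(2) that by blast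
  have "(\<Sum>j\<in>I. g j) = g i" "(\<Sum>j\<in>I. (norm (g j))\<^sup>2) = (norm (g i))\<^sup>2"
    using z i assms(1) by (simp_all add: sum.remove[of I i])
  then show ?thesis by simp
qed simp

text \<open>N is the first exponent with 2^N \<eta> > 1, hence N ln 2 > - ln \<eta>; the extra ln 2
  is covered by N \<ge> 1, which gives the factor 2.\<close>

lemma dyadic_scales:
  assumes "0 < \<eta>" "\<eta> \<le> 1"
  obtains N :: nat where "N \<ge> 1" "\<forall>j<N. 2 ^ j * \<eta> \<le> 1" "ln 2 - ln \<eta> \<le> 2 * (real N * ln 2)"
proof -
  let ?P = "\<lambda>n::nat. 1 < 2 ^ n * \<eta>"
  obtain n :: nat where "1 / \<eta> < 2 ^ n" using real_arch_pow[of 2 "1/\<eta>"] by auto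
  then have ex: "?P n" using assms by (simp add: divide_less_eq)
  define N where "N = (LEAST n. ?P n)"
  have PN: "?P N" unfolding N_def by (rule LeastI[of ?P, OF ex])
  have less: "2 ^ j * \<eta> \<le> 1" if "j < N" for j
    using not_less_Least[of j ?P] that by (auto simp: N_def)
  have N1: "N \<ge> 1"
  proof (rule ccontr)
    assume "\<not> N \<ge> 1"
    then have "N = 0" by simp
    then show False using PN assms by simp
  qed
  have "0 < ln (2 ^ N * \<eta>)" using PN by (rule ln_gt_zero)
  then have "0 < real N * ln 2 + ln \<eta>" using assms by (simp add: ln_mult ln_realpow)
  moreover have "ln (2::real) \<le> real N * ln 2" using N1 by simp
  ultimately have "ln 2 - ln \<eta> \<le> 2 * (real N * ln 2)" by linarith
  then show ?thesis using that N1 less by blast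
qed

text \<open>In the plane the energy of a dilated bump does not depend on the scale; averaging over the
  dyadic scales between \<open>\<eta>\<close> and \<open>1\<close>, whose gradients have disjoint supports, gains the
  logarithm.  In higher dimensions a single scale suffices.\<close>

lemma hole_cutoff:
  fixes c :: real
  assumes d: "CARD('n) \<ge> 2" and c: "0 < c" "c \<le> 1/8"
  obtains E where "E > 0"
    "\<forall>\<eta>. 0 < \<eta> \<and> \<eta> \<le> 1 \<longrightarrow> (\<exists>W :: real^'n \<Rightarrow> real. (\<forall>k. Ck k W) \<and> (\<forall>y. 0 \<le> W y \<and> W y \<le> 1) \<and>
      (\<forall>y. (\<forall>i. \<bar>y $ i\<bar> \<le> \<eta> * (1/2 - c/2)) \<longrightarrow> W y = 1) \<and>
      (\<forall>y. (\<exists>i. 1/2 - c/4 \<le> \<bar>y $ i\<bar>) \<longrightarrow> W y = 0) \<and>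
      (\<integral>\<^sup>+y. ennreal ((norm (gradient W y))\<^sup>2) \<partial>lborel) \<le> ennreal (E / (scale_factor CARD('n) \<eta>)\<^sup>2))"
proof -
  \<comment> \<open>Nested cubes, by half-side: the hole will lie within 1/2 - c, the plateau of the
    bump is 1/2 - c/2 and its support 1/2 - c/4, inside the cell. The gaps keep the final support
    away from the holes and the cutoffs of neighbouring cells apart.\<close>
  let ?d = "CARD('n)" and ?a = "1/2 - c/2" and ?b = "1/2 - c/4"
  obtain \<beta> :: "real^'n \<Rightarrow> real" where \<beta>: "\<And>k. Ck k \<beta>" "\<And>x. 0 \<le> \<beta> x \<and> \<beta> x \<le> 1"
    "\<And>x. (\<And>i. \<bar>x $ i\<bar> \<le> ?a) \<Longrightarrow> \<beta> x = 1" "\<And>x i. ?b \<le> \<bar>x $ i\<bar> \<Longrightarrow> \<beta> x = 0" "test_function UNIV \<beta>"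
    using test_function_box_bump[of ?a ?b] c by auto
  obtain B where B: "B > 0" "\<And>x. norm (gradient \<beta> x) \<le> B" using test_function_bounded[OF \<beta>(5)] by metis
  have grad_out: "gradient \<beta> x = 0" if "?b < \<bar>x $ i\<bar>" for x i
    by (rule gradient_eq_0_locally_const[OF open_coord_greater[of ?b i], where c=0])
       (use that \<beta>(4)[of _ i] in \<open>auto intro: less_imp_le\<close>)
  have grad_in: "gradient \<beta> x = 0" if "\<forall>i. \<bar>x $ i\<bar> < ?a" for x
  proof (rule gradient_eq_0_locally_const[OF open_coord_less[of ?a], where c=1])
    show "\<beta> y = 1" if "y \<in> {x. \<forall>i. \<bar>x $ i\<bar> < ?a}" for y
      by (rule \<beta>(3)) (use that in \<open>simp add: less_imp_le\<close>)
  qed (use that in simp)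
  \<comment> \<open>The Dirichlet energy of the bump dilated by s scales like s^(d-2): independent
    of s in the plane, and of order \<eta>^(d-2) at s = \<eta> otherwise.\<close>
  have energy: "(\<integral>\<^sup>+y. ennreal ((norm ((1/s) *\<^sub>R gradient \<beta> ((1/s) *\<^sub>R y)))\<^sup>2) \<partial>lborel) \<le> ennreal (B\<^sup>2 * s ^ (?d - 2))"
    if s: "s > 0" for s
  proof -
    have "(\<integral>\<^sup>+y. ennreal ((norm ((1/s) *\<^sub>R gradient \<beta> ((1/s) *\<^sub>R y)))\<^sup>2) \<partial>lborel) \<le>
       (\<integral>\<^sup>+y. ennreal ((B / s)\<^sup>2) * indicator (cube (s / 2)) y \<partial>(lborel :: (real^'n) measure))"
    proof (rule nn_integral_mono)
      fix y :: "real^'n"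
      show "ennreal ((norm ((1/s) *\<^sub>R gradient \<beta> ((1/s) *\<^sub>R y)))\<^sup>2) \<le> ennreal ((B / s)\<^sup>2) * indicator (cube (s / 2)) y"
      proof (cases "y \<in> cube (s / 2)")
        case True
        have "norm ((1/s) *\<^sub>R gradient \<beta> ((1/s) *\<^sub>R y)) \<le> B / s"
          using s B(2) by (simp add: divide_right_mono)
        then show ?thesis using True by (auto intro!: ennreal_leI power_mono)
      next
        case False
        then obtain i where "s / 2 < \<bar>y $ i\<bar>" by (auto simp: cube_def not_le)
        then have "1/2 < \<bar>((1/s) *\<^sub>R y) $ i\<bar>" using s by (simp add: abs_mult field_simps)
        then have "?b < \<bar>((1/s) *\<^sub>R y) $ i\<bar>" using c by linarith
        then show ?thesis using grad_out by simp
      qed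
    qed
    also have "\<dots> = ennreal ((B / s)\<^sup>2) * ennreal (s ^ ?d)"
      using s emeasure_cube[where 'n='n, of "s/2"] by (simp add: nn_integral_cmult_indicator)
    also have "\<dots> = ennreal ((B / s)\<^sup>2 * s ^ ?d)" by (rule ennreal_mult'[symmetric]) simp
    also have "(B / s)\<^sup>2 * s ^ ?d = B\<^sup>2 * s ^ (?d - 2)"
    proof -
      have "s ^ ?d = s\<^sup>2 * s ^ (?d - 2)" using power_add[of s 2 "?d - 2"] d by (simp only: le_add_diff_inverse)
      then show ?thesis using s by (simp add: power_divide)
    qed
    finally show ?thesis .
  qed
  have pos: "2 * B\<^sup>2 > 0" using B by simp
  show ?thesis
  proof (rule that[OF pos]; intro allI impI)
    fix \<eta> :: real assume H: "0 < \<eta> \<and> \<eta> \<le> 1"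
    then have \<eta>: "0 < \<eta>" "\<eta> \<le> 1" by auto
    \<comment> \<open>The number of scales averaged. For d \<ge> 3 there is one scale, s = \<eta>;
      for d = 2 the N equal energy bounds enter with the factor 1/N^2, leaving 1/N, which is at most
      of the order of the inverse logarithm.\<close>
    obtain N :: nat where N: "N \<ge> 1" "\<forall>j<N. 2 ^ j * \<eta> \<le> 1"
      "B\<^sup>2 / (real N)\<^sup>2 * (\<Sum>j<N. (2 ^ j * \<eta>) ^ (?d - 2)) \<le> 2 * B\<^sup>2 / (scale_factor ?d \<eta>)\<^sup>2"
    proof (cases "?d = 2")
      case False
      show ?thesis
      proof (rule that[of 1])
        show "B\<^sup>2 / (real 1)\<^sup>2 * (\<Sum>j<1. (2 ^ j * \<eta>) ^ (?d - 2)) \<le> 2 * B\<^sup>2 / (scale_factor ?d \<eta>)\<^sup>2"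
          unfolding scale_factor_sq[OF d \<eta>] using False B \<eta> by simp
      qed (use \<eta> in auto)
    next
      case True
      obtain N :: nat where N: "N \<ge> 1" "\<forall>j<N. 2 ^ j * \<eta> \<le> 1" "ln 2 - ln \<eta> \<le> 2 * (real N * ln 2)"
        by (rule dyadic_scales[OF \<eta>])
      have pos: "0 < ln 2 - ln \<eta>" using \<eta> by (smt (verit) ln_gt_zero ln_le_zero_iff)
      have "ln (2::real) \<le> 1" using ln_le_minus_one[of 2] by simp
      then have "real N * ln 2 \<le> real N * 1" by (intro mult_left_mono) auto
      then have le: "ln 2 - ln \<eta> \<le> 2 * real N" using N(3) by linarith
      show ?thesis
      proof (rule that[OF N(1,2)])
        have "B\<^sup>2 / (real N)\<^sup>2 * (\<Sum>j<N. (2 ^ j * \<eta>) ^ (?d - 2)) = B\<^sup>2 / real N"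
          using True N(1) by (simp add: power2_eq_square)
        also have "\<dots> = 2 * B\<^sup>2 / (2 * real N)" by simp
        also have "\<dots> \<le> 2 * B\<^sup>2 / (ln 2 - ln \<eta>)"
          by (rule divide_left_mono[OF le]) (use pos N(1) in simp_all)
        finally show "B\<^sup>2 / (real N)\<^sup>2 * (\<Sum>j<N. (2 ^ j * \<eta>) ^ (?d - 2)) \<le> 2 * B\<^sup>2 / (scale_factor ?d \<eta>)\<^sup>2"
          unfolding scale_factor_sq[OF d \<eta>] using True by simp
      qed
    qed
    define s where "s j = 2 ^ j * \<eta>" for j :: nat
    have s: "0 < s j" "j < N \<Longrightarrow> s j \<le> 1" "\<eta> \<le> s j" for j
      using \<eta> N(2) by (auto simp: s_def)
    let ?w = "\<lambda>j y. \<beta> ((1 / s j) *\<^sub>R y)"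
    define W where "W y = (1 / real N) * (\<Sum>j<N. ?w j y)" for y
    have Ckw: "Ck k (?w j)" for k j using Ck_scale_shift[OF \<beta>(1), of k "1 / s j" 0] by simp
    have 1: "Ck k W" for k unfolding W_def by (intro Ck_mult Ck_const Ck_sum Ckw)
    have 2: "0 \<le> W y \<and> W y \<le> 1" for y
    proof -
      have "0 \<le> (\<Sum>j<N. ?w j y)" using \<beta>(2) by (intro sum_nonneg) blast
      moreover have "(\<Sum>j<N. ?w j y) \<le> (\<Sum>j<N. 1)" using \<beta>(2) by (intro sum_mono) blast
      ultimately show ?thesis using N(1) by (simp add: W_def divide_le_eq)
    qed
    have 3: "W y = 1" if "\<forall>i. \<bar>y $ i\<bar> \<le> \<eta> * ?a" for y
    proof -
      have "?w j y = 1" for j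
      proof (rule \<beta>(3))
        fix i
        have "\<bar>y $ i\<bar> \<le> \<eta> * ?a" using that by blast
        also have "\<dots> \<le> s j * ?a" using s(3)[of j] c by (intro mult_right_mono) auto
        finally have "\<bar>y $ i\<bar> \<le> s j * ?a" .
        then show "\<bar>((1 / s j) *\<^sub>R y) $ i\<bar> \<le> ?a" using s(1)[of j]
          by (simp add: abs_mult divide_le_eq mult.commute)
      qed
      then show ?thesis using N(1) by (simp add: W_def)
    qed
    have 4: "W y = 0" if "?b \<le> \<bar>y $ i\<bar>" for y i
    proof -
      have "?w j y = 0" if "j < N" for j
      proof (rule \<beta>(4))
        have "0 \<le> ?b" using c by simp
        from mult_left_mono[OF s(2)[OF that] this] have "?b * s j \<le> ?b" by (simp only: mult_1_right)
        then have "?b * s j \<le> \<bar>y $ i\<bar>" using \<open>?b \<le> \<bar>y $ i\<bar>\<close> by (rule order_trans)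
        then show "?b \<le> \<bar>((1 / s j) *\<^sub>R y) $ i\<bar>" using s(1)[of j]
          by (simp add: abs_mult le_divide_eq)
      qed
      then show ?thesis by (simp add: W_def)
    qed
    have gw: "gradient (?w j) y = (1 / s j) *\<^sub>R gradient \<beta> ((1 / s j) *\<^sub>R y)" for j y
      using gradient_scale_shift[of \<beta> "1 / s j" y 0] Ck_1_differentiable[OF \<beta>(1)] by simp
    \<comment> \<open>The gradient at scale s lives where the largest coordinate is between s a and
      s b. Different scales have ratio at least 2, and b < 2 a, so these shells are
      disjoint.\<close>
    have disj: "gradient (?w i) y = 0 \<or> gradient (?w j) y = 0" if "i < j" for i j y
    proof (rule ccontr)
      assume "\<not> ?thesis"
      then have ne: "gradient \<beta> ((1 / s i) *\<^sub>R y) \<noteq> 0" "gradient \<beta> ((1 / s j) *\<^sub>R y) \<noteq> 0" by (auto simp: gw)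
      obtain l where l: "?a \<le> \<bar>((1 / s j) *\<^sub>R y) $ l\<bar>" using grad_in[of "(1 / s j) *\<^sub>R y"] ne(2) not_less by blast
      have u: "\<bar>((1 / s i) *\<^sub>R y) $ l\<bar> \<le> ?b" using grad_out[of "(1 / s i) *\<^sub>R y" l] ne(1) not_less by blast
      have "?a * s j \<le> \<bar>y $ l\<bar>" using l s(1)[of j] by (simp add: abs_mult le_divide_eq)
      moreover have "\<bar>y $ l\<bar> \<le> ?b * s i" using u s(1)[of i] by (simp add: abs_mult divide_le_eq)
      moreover have "2 * s i \<le> s j"
      proof -
        have "(2::real) ^ Suc i \<le> 2 ^ j" using that by (intro power_increasing) auto
        then show ?thesis using \<eta> by (simp add: s_def)
      qed
      then have "?a * (2 * s i) \<le> ?a * s j" using c by (intro mult_left_mono) auto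
      ultimately have "?a * (2 * s i) \<le> ?b * s i" by (meson order_trans)
      then have "(2 * ?a) * s i \<le> ?b * s i" by (simp only: mult_ac)
      then have "2 * ?a \<le> ?b" using s(1)[of i] by simp
      then show False using c by simp
    qed
    have gW: "gradient W y = (1 / real N) *\<^sub>R (\<Sum>j<N. gradient (?w j) y)" for y
      unfolding W_def gradient_cmult[OF Ck_1_differentiable[OF Ck_sum[of "{..<N}", OF Ckw]]]
        gradient_sum[of "{..<N}", OF Ck_1_differentiable[OF Ckw]] ..
    have cw: "continuous_on UNIV (gradient (?w j))" for j by (rule continuous_gradient[OF Ckw])
    have mw: "(\<lambda>y. ennreal ((norm (gradient (?w j) y))\<^sup>2)) \<in> borel_measurable lborel" for j
      using borel_measurable_continuous_onI[OF cw[of j]] by measurable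
    have "(\<integral>\<^sup>+y. ennreal ((norm (gradient W y))\<^sup>2) \<partial>lborel) =
       (\<integral>\<^sup>+y. ennreal (1 / (real N)\<^sup>2) * (\<Sum>j<N. ennreal ((norm (gradient (?w j) y))\<^sup>2)) \<partial>lborel)"
    proof (rule nn_integral_cong)
      fix y :: "real^'n"
      have "(norm (\<Sum>j<N. gradient (?w j) y))\<^sup>2 = (\<Sum>j<N. (norm (gradient (?w j) y))\<^sup>2)"
      proof (rule norm_sum_sq_disjoint)
        fix i j :: nat assume "i \<noteq> j"
        then show "gradient (?w i) y = 0 \<or> gradient (?w j) y = 0"
          using disj[of i j y] disj[of j i y] by (meson nat_neq_iff)
      qed simp
      then have eq: "(norm (gradient W y))\<^sup>2 = 1 / (real N)\<^sup>2 * (\<Sum>j<N. (norm (gradient (?w j) y))\<^sup>2)"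
        unfolding gW norm_scaleR power_mult_distrib by (simp add: power_divide)
      have "(\<Sum>j<N. ennreal ((norm (gradient (?w j) y))\<^sup>2)) = ennreal (\<Sum>j<N. (norm (gradient (?w j) y))\<^sup>2)"
        by (rule sum_ennreal) simp
      then show "ennreal ((norm (gradient W y))\<^sup>2) = ennreal (1 / (real N)\<^sup>2) * (\<Sum>j<N. ennreal ((norm (gradient (?w j) y))\<^sup>2))"
        unfolding eq by (simp only:) (rule ennreal_mult', simp)
    qed
    also have "\<dots> = ennreal (1 / (real N)\<^sup>2) * (\<integral>\<^sup>+y. (\<Sum>j<N. ennreal ((norm (gradient (?w j) y))\<^sup>2)) \<partial>lborel)"
      by (rule nn_integral_cmult) (intro borel_measurable_sum mw)
    also have "(\<integral>\<^sup>+y. (\<Sum>j<N. ennreal ((norm (gradient (?w j) y))\<^sup>2)) \<partial>lborel) =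
        (\<Sum>j<N. \<integral>\<^sup>+y. ennreal ((norm (gradient (?w j) y))\<^sup>2) \<partial>lborel)"
      by (rule nn_integral_sum) (rule mw)
    also have "\<dots> \<le> (\<Sum>j<N. ennreal (B\<^sup>2 * s j ^ (?d - 2)))"
      unfolding gw by (intro sum_mono energy s)
    also have "\<dots> = ennreal (\<Sum>j<N. B\<^sup>2 * s j ^ (?d - 2))"
      by (rule sum_ennreal) (simp add: less_imp_le[OF s(1)])
    finally have "(\<integral>\<^sup>+y. ennreal ((norm (gradient W y))\<^sup>2) \<partial>lborel) \<le>
       ennreal (1 / (real N)\<^sup>2) * ennreal (\<Sum>j<N. B\<^sup>2 * s j ^ (?d - 2))"
      by (simp add: mult_left_mono)
    also have "\<dots> = ennreal (B\<^sup>2 / (real N)\<^sup>2 * (\<Sum>j<N. (2 ^ j * \<eta>) ^ (?d - 2)))"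
      by (subst ennreal_mult'[symmetric]) (simp_all add: s_def sum_distrib_left)
    also have "\<dots> \<le> ennreal (2 * B\<^sup>2 / (scale_factor ?d \<eta>)\<^sup>2)" by (rule ennreal_leI[OF N(3)])
    finally show "\<exists>W :: real^'n \<Rightarrow> real. (\<forall>k. Ck k W) \<and> (\<forall>y. 0 \<le> W y \<and> W y \<le> 1) \<and>
      (\<forall>y. (\<forall>i. \<bar>y $ i\<bar> \<le> \<eta> * ?a) \<longrightarrow> W y = 1) \<and>
      (\<forall>y. (\<exists>i. ?b \<le> \<bar>y $ i\<bar>) \<longrightarrow> W y = 0) \<and>
      (\<integral>\<^sup>+y. ennreal ((norm (gradient W y))\<^sup>2) \<partial>lborel) \<le> ennreal (2 * B\<^sup>2 / (scale_factor ?d \<eta>)\<^sup>2)"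
      by (intro exI[of _ W] conjI allI impI 1 2 3; (blast intro: 4)?)
  qed
qed

section \<open>The lower bound\<close>

lemma finite_int_lattice_cube: "finite {k :: real^'n. k \<in> int_lattice \<and> (\<forall>i. \<bar>k $ i\<bar> \<le> M)}"
proof (rule finite_subset)
  let ?F = "PiE (UNIV :: 'n set) (\<lambda>_. {- \<lceil>M\<rceil>..\<lceil>M\<rceil>})"
  show "finite ((\<lambda>f. \<chi> i. real_of_int (f i)) ` ?F :: (real^'n) set)"
    by (intro finite_imageI finite_PiE) auto
  show "{k :: real^'n. k \<in> int_lattice \<and> (\<forall>i. \<bar>k $ i\<bar> \<le> M)} \<subseteq> (\<lambda>f. \<chi> i. real_of_int (f i)) ` ?F"
  proof
    fix k :: "real^'n" assume "k \<in> {k. k \<in> int_lattice \<and> (\<forall>i. \<bar>k $ i\<bar> \<le> M)}"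
    then have k: "k $ i \<in> \<int>" "\<bar>k $ i\<bar> \<le> M" for i by (auto simp: int_lattice_def)
    have eq: "real_of_int \<lfloor>k $ i\<rfloor> = k $ i" for i using k(1) by simp
    have "\<lfloor>k $ i\<rfloor> \<in> {- \<lceil>M\<rceil>..\<lceil>M\<rceil>}" for i
      using k(2)[of i] eq[of i] by (auto simp: abs_le_iff) linarith+
    then show "k \<in> (\<lambda>f. \<chi> i. real_of_int (f i)) ` ?F"
      by (intro image_eqI[of _ _ "\<lambda>i. \<lfloor>k $ i\<rfloor>"]) (auto simp: vec_eq_iff eq)
  qed
qed

lemma cell_diff_less:
  assumes "x \<in> cell \<epsilon> z" "y \<in> cell \<epsilon> z"
  shows "\<bar>x $ i - y $ i\<bar> < \<epsilon>"
proof -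
  have "- \<epsilon> / 2 \<le> x $ i - z $ i \<and> x $ i - z $ i < \<epsilon> / 2" "- \<epsilon> / 2 \<le> y $ i - z $ i \<and> y $ i - z $ i < \<epsilon> / 2"
    using assms by (simp_all add: cell_def)
  then show ?thesis by linarith
qed

text \<open>Distinct lattice points differ by at least 1 in some coordinate. Hence a point of one
  cell lies, after rescaling, outside the support of the cutoff of every other cell.\<close>

lemma cell_lattice_far:
  fixes x :: "real^'n"
  assumes "0 < \<epsilon>" "x \<in> cell \<epsilon> (\<epsilon> *\<^sub>R k)" "k \<in> int_lattice" "l \<in> int_lattice" "l \<noteq> k"
  obtains i where "1/2 \<le> \<bar>((1 / \<epsilon>) *\<^sub>R (x - \<epsilon> *\<^sub>R l)) $ i\<bar>"
proof -
  obtain i where i: "l $ i \<noteq> k $ i" using assms(5) by (auto simp: vec_eq_iff)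
  have "l $ i \<in> \<int>" "k $ i \<in> \<int>" using assms by (auto simp: int_lattice_def)
  then have "l $ i - k $ i \<in> \<int>" by simp
  then have "1 \<le> \<bar>l $ i - k $ i\<bar>" using i by (intro Ints_nonzero_abs_ge1) auto
  then have "\<epsilon> * 1 \<le> \<epsilon> * \<bar>l $ i - k $ i\<bar>" using assms(1) by (intro mult_left_mono) auto
  then have "\<epsilon> \<le> \<bar>\<epsilon> * l $ i - \<epsilon> * k $ i\<bar>"
    using assms(1) by (simp add: abs_mult flip: right_diff_distrib)
  moreover have "- \<epsilon> / 2 \<le> x $ i - \<epsilon> * k $ i \<and> x $ i - \<epsilon> * k $ i < \<epsilon> / 2"
    using assms(2) by (simp add: cell_def)
  ultimately have "\<epsilon> / 2 \<le> \<bar>x $ i - \<epsilon> * l $ i\<bar>" by linarith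
  then have "1/2 \<le> \<bar>((1 / \<epsilon>) *\<^sub>R (x - \<epsilon> *\<^sub>R l)) $ i\<bar>"
    using assms(1) by (simp add: abs_mult field_simps)
  then show ?thesis by (rule that)
qed

lemma norm_add_sq_le: "(norm (a + b :: 'a::real_normed_vector))\<^sup>2 \<le> 2 * (norm a)\<^sup>2 + 2 * (norm b)\<^sup>2"
proof -
  have "(norm (a + b))\<^sup>2 \<le> (norm a + norm b)\<^sup>2" by (intro power_mono norm_triangle_ineq) simp
  also have "\<dots> \<le> 2 * (norm a)\<^sup>2 + 2 * (norm b)\<^sup>2"
    using sum_squares_bound[of "norm a" "norm b"] by (simp add: power2_sum)
  finally show ?thesis .
qed

text \<open>v is the rescaled profile m times \<xi>, which is 1 minus the sum of the cell cutoffs.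
  In each cell only its own cutoff acts, so energy and mass are compared with constants cell by
  cell: up to the factor 2 B^2, \<xi> contributes E \<epsilon>^d / L^2 to the energy and the profile
  \<epsilon>^d / L^2, while a slab at a face keeps the mass. With m itself as a factor of v, the
  pairing with m is a square times \<xi>, hence nonnegative.\<close>

lemma test_function_perforated:
  fixes m W :: "real^'n \<Rightarrow> real" and T :: "(real^'n) set"
  assumes m: "test_function UNIV m" "\<And>x. \<bar>m x\<bar> \<le> B" "\<And>x. norm (gradient m x) \<le> B"
      "\<And>x i. 4 < \<bar>x $ i\<bar> \<Longrightarrow> m x = 0" "\<And>x. \<forall>i. \<bar>x $ i\<bar> < 3 \<Longrightarrow> m x = 1"
    and c: "0 < c" "c \<le> 1/8" and T: "\<forall>x\<in>T. \<forall>i. \<bar>x $ i\<bar> \<le> 1/2 - c"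
    and W: "\<And>k. Ck k W" "\<And>y. 0 \<le> W y \<and> W y \<le> 1" "\<And>y. \<forall>i. \<bar>y $ i\<bar> \<le> \<eta> * (1/2 - c/2) \<Longrightarrow> W y = 1"
      "\<And>y i. 1/2 - c/4 \<le> \<bar>y $ i\<bar> \<Longrightarrow> W y = 0"
    and energy: "(\<integral>\<^sup>+y. ennreal ((norm (gradient W y))\<^sup>2) \<partial>lborel) \<le> ennreal (E * (\<epsilon> / L)\<^sup>2)"
    and E: "0 \<le> E" and \<epsilon>: "0 < \<epsilon>" and \<eta>: "0 < \<eta>" "\<eta> \<le> 1" and L: "0 < L" "\<epsilon> \<le> 2 * L"
  obtains v where "test_function (perforated_domain T \<epsilon> \<eta>) v"
    "(\<integral>\<^sup>+x. ennreal ((norm (gradient v x))\<^sup>2) \<partial>lborel) \<le> ennreal (2 * B\<^sup>2 * (E + 1) / L\<^sup>2 * (12 * L) ^ CARD('n))"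
    "\<forall>x. 0 \<le> v x * m ((1 / L) *\<^sub>R x)"
    "ennreal (c / 4 * (2 * L) ^ CARD('n)) \<le> (\<integral>\<^sup>+x. ennreal (v x * m ((1 / L) *\<^sub>R x)) \<partial>lborel)"
proof -
  let ?d = "CARD('n)" and ?a = "1/2 - c/2" and ?b = "1/2 - c/4"
  \<comment> \<open>Bounds the lattice points whose cell meets \<open>cube (4 * L)\<close>, off
    which the profile vanishes; this makes the sum of cutoffs finite.\<close>
  define M where "M = (4 * L + \<epsilon> / 2) / \<epsilon>"
  define K where "K = {k :: real^'n. k \<in> int_lattice \<and> (\<forall>i. \<bar>k $ i\<bar> \<le> M)}"
  have finK: "finite K" unfolding K_def by (rule finite_int_lattice_cube)
  define w where "w k x = W ((1 / \<epsilon>) *\<^sub>R (x - \<epsilon> *\<^sub>R k))" for k x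
  define \<xi> where "\<xi> x = 1 - (\<Sum>k\<in>K. w k x)" for x
  define \<mu> where "\<mu> x = m ((1 / L) *\<^sub>R x)" for x
  define v where "v x = \<mu> x * \<xi> x" for x
  have Ckw: "Ck j (w k)" for j k unfolding w_def by (rule Ck_scale_shift[OF W(1)])
  have Ck\<xi>: "Ck j \<xi>" for j unfolding \<xi>_def by (intro Ck_diff Ck_const Ck_sum Ckw)
  have Ck\<mu>: "Ck j \<mu>" for j unfolding \<mu>_def using Ck_scale_shift[OF test_function_Ck[OF m(1)], of j "1 / L" 0] by simp
  have gw: "gradient (w k) x = (1 / \<epsilon>) *\<^sub>R gradient W ((1 / \<epsilon>) *\<^sub>R (x - \<epsilon> *\<^sub>R k))" for k x
    unfolding w_def by (rule gradient_scale_shift) (rule Ck_1_differentiable[OF W(1)])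
  have g\<mu>: "gradient \<mu> x = (1 / L) *\<^sub>R gradient m ((1 / L) *\<^sub>R x)" for x
    unfolding \<mu>_def using gradient_scale_shift[of m "1 / L" x 0] test_function_differentiable[OF m(1)] by simp
  have g\<xi>: "gradient \<xi> x = - (\<Sum>k\<in>K. gradient (w k) x)" for x
  proof -
    have d: "(\<lambda>x. \<Sum>k\<in>K. w k x) differentiable (at x)" by (rule Ck_1_differentiable[OF Ck_sum[OF Ckw]])
    have "\<xi> = (\<lambda>x. 1 + (-1) * (\<Sum>k\<in>K. w k x))" by (simp add: \<xi>_def fun_eq_iff)
    then have "gradient \<xi> x = gradient (\<lambda>x. 1) x + (-1) *\<^sub>R gradient (\<lambda>x. \<Sum>k\<in>K. w k x) x"
      using gradient_add[of "\<lambda>x. 1" x "\<lambda>x. (-1) * (\<Sum>k\<in>K. w k x)"] gradient_cmult[OF d, of "-1"] d by simp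
    then show ?thesis using gradient_sum[of K w x] Ck_1_differentiable[OF Ckw] by simp
  qed
  have gradW0: "gradient W y = 0" if "?b < \<bar>y $ i\<bar>" for y i
    by (rule gradient_eq_0_locally_const[OF open_coord_greater[of ?b i], where c=0])
       (use that W(4)[of _ i] in \<open>auto intro: less_imp_le\<close>)
  have gradm0: "gradient m y = 0" if "4 < \<bar>y $ i\<bar>" for y i
    by (rule gradient_eq_0_locally_const[OF open_coord_greater[of 4 i], where c=0])
       (use that m(4)[where i=i] in auto)
  have far: "\<mu> x = 0 \<and> gradient \<mu> x = 0" if "x \<notin> cube (4 * L)" for x
  proof -
    from that have "\<exists>i. 4 * L < \<bar>x $ i\<bar>" by (auto simp: cube_def not_le)
    then obtain i where "4 * L < \<bar>x $ i\<bar>" ..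
    then have "4 < \<bar>((1 / L) *\<^sub>R x) $ i\<bar>" using L by (simp add: abs_mult field_simps)
    then show ?thesis using m(4) gradm0 by (auto simp: \<mu>_def g\<mu>)
  qed
  have other: "w l x = 0 \<and> gradient (w l) x = 0"
    if "k \<in> int_lattice" "x \<in> cell \<epsilon> (\<epsilon> *\<^sub>R k)" "l \<in> K" "l \<noteq> k" for k l x
  proof -
    have "l \<in> int_lattice" using that(3) by (simp add: K_def)
    from cell_lattice_far[OF \<epsilon> that(2,1) this that(4)]
    obtain i where i: "1/2 \<le> \<bar>((1 / \<epsilon>) *\<^sub>R (x - \<epsilon> *\<^sub>R l)) $ i\<bar>" by blast
    have "?b < 1/2" using c by simp
    then have "?b < \<bar>((1 / \<epsilon>) *\<^sub>R (x - \<epsilon> *\<^sub>R l)) $ i\<bar>" using i by (rule less_le_trans)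
    then show ?thesis using W(4)[OF less_imp_le] gradW0 unfolding gw w_def by simp
  qed
  have cell_sum: "(\<Sum>l\<in>K. h l) = (if k \<in> K then h k else 0)"
    if "\<And>l. l \<in> K \<Longrightarrow> l \<noteq> k \<Longrightarrow> h l = 0" for h :: "real^'n \<Rightarrow> 'b::ab_group_add" and k
  proof (cases "k \<in> K")
    case True
    then show ?thesis using that finK by (subst sum.remove[of K k]) (auto intro!: sum.neutral)
  next
    case False
    then show ?thesis using that by (auto intro!: sum.neutral)
  qed
  have \<xi>_cell: "\<xi> x = 1 - (if k \<in> K then w k x else 0)"
    and g\<xi>_cell: "norm (gradient \<xi> x) \<le> norm (gradient (w k) x)"
    if "k \<in> int_lattice" "x \<in> cell \<epsilon> (\<epsilon> *\<^sub>R k)" for k x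
  proof -
    show "\<xi> x = 1 - (if k \<in> K then w k x else 0)"
      unfolding \<xi>_def using cell_sum[of k "\<lambda>l. w l x"] other[OF that] by simp
    show "norm (gradient \<xi> x) \<le> norm (gradient (w k) x)"
      unfolding g\<xi> norm_minus_cancel using cell_sum[of k "\<lambda>l. gradient (w l) x"] other[OF that] by simp
  qed
  have w01: "0 \<le> w k x \<and> w k x \<le> 1" for k x using W(2) by (simp add: w_def)
  have \<xi>01: "0 \<le> \<xi> x \<and> \<xi> x \<le> 1" for x
  proof -
    obtain k where "k \<in> int_lattice" "x \<in> cell \<epsilon> (\<epsilon> *\<^sub>R k)" using cell_lattice_unique[OF \<epsilon>, of x] by blast
    from \<xi>_cell[OF this] show ?thesis using w01[of k x] by simp
  qed
  have inK: "k \<in> K" if "k \<in> int_lattice" "x \<in> cell \<epsilon> (\<epsilon> *\<^sub>R k)" "\<mu> x \<noteq> 0" for k x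
  proof -
    have x: "\<bar>x $ i\<bar> \<le> 4 * L" for i using far[of x] that(3) by (auto simp: cube_def)
    have "\<bar>k $ i\<bar> \<le> M" for i
    proof -
      have "- \<epsilon> / 2 \<le> x $ i - \<epsilon> * k $ i \<and> x $ i - \<epsilon> * k $ i < \<epsilon> / 2"
        using that(2) by (simp add: cell_def)
      then have "\<bar>\<epsilon> * k $ i\<bar> \<le> 4 * L + \<epsilon> / 2" using x[of i] by linarith
      then show ?thesis using \<epsilon> by (simp add: M_def abs_mult le_divide_eq mult.commute)
    qed
    then show ?thesis using that(1) by (simp add: K_def)
  qed
  \<comment> \<open>A closed set containing the points where v is nonzero. The removed cubes, of
    half-side \<epsilon> \<eta> (1/2 - c/2), are larger than the holes, so even the closure of these
    points stays in the perforated domain.\<close>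
  define S where "S = {x :: real^'n. (\<forall>i. \<bar>x $ i\<bar> \<le> 4 * L) \<and>
    (\<forall>k\<in>int_lattice. \<exists>i. \<epsilon> * \<eta> * ?a \<le> \<bar>x $ i - \<epsilon> * k $ i\<bar>)}"
  have "closed S"
  proof -
    have "S = cube (4 * L) \<inter> (\<Inter>k\<in>int_lattice. \<Union>i. {x. \<epsilon> * \<eta> * ?a \<le> \<bar>x $ i - \<epsilon> * k $ i\<bar>})"
      by (auto simp: S_def cube_def)
    also have "closed \<dots>"
      by (intro closed_Int closed_INT ballI closed_UN closed_Collect_le continuous_intros)
         (auto simp: cube_eq_cbox)
    finally show ?thesis .
  qed
  have vS: "{x. v x \<noteq> 0} \<subseteq> S"
  proof
    fix x assume "x \<in> {x. v x \<noteq> 0}"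
    then have \<mu>: "\<mu> x \<noteq> 0" and \<xi>: "\<xi> x \<noteq> 0" by (auto simp: v_def)
    have "\<exists>i. \<epsilon> * \<eta> * ?a \<le> \<bar>x $ i - \<epsilon> * k $ i\<bar>" if k: "k \<in> int_lattice" for k
    proof (rule ccontr)
      assume "\<not> ?thesis"
      then have near: "\<bar>x $ i - \<epsilon> * k $ i\<bar> < \<epsilon> * \<eta> * ?a" for i by (simp add: not_le)
      have "\<epsilon> * \<eta> * ?a \<le> \<epsilon> * 1 * (1/2)" using \<epsilon> \<eta> c by (intro mult_mono) auto
      then have near2: "\<bar>x $ i - \<epsilon> * k $ i\<bar> < \<epsilon> / 2" for i using near[of i] by linarith
      have "- \<epsilon> / 2 \<le> x $ i - \<epsilon> * k $ i \<and> x $ i - \<epsilon> * k $ i < \<epsilon> / 2" for i using near2[of i] by linarith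
      then have cell: "x \<in> cell \<epsilon> (\<epsilon> *\<^sub>R k)" by (simp add: cell_def)
      have "W ((1 / \<epsilon>) *\<^sub>R (x - \<epsilon> *\<^sub>R k)) = 1"
      proof (rule W(3), rule allI)
        fix i
        have "\<bar>x $ i - \<epsilon> * k $ i\<bar> \<le> \<epsilon> * (\<eta> * ?a)" using near[of i] by (simp add: mult.assoc)
        then show "\<bar>((1 / \<epsilon>) *\<^sub>R (x - \<epsilon> *\<^sub>R k)) $ i\<bar> \<le> \<eta> * ?a"
          using \<epsilon> by (simp add: abs_mult divide_le_eq mult.commute)
      qed
      then have "\<xi> x = 0" using \<xi>_cell[OF k cell] inK[OF k cell \<mu>] by (simp add: w_def)
      then show False using \<xi> by simp
    qed
    moreover have "x \<in> cube (4 * L)" using far \<mu> by blast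
    ultimately show "x \<in> S" by (simp add: S_def cube_def)
  qed
  have clS: "closure {x. v x \<noteq> 0} \<subseteq> S" by (rule closure_minimal[OF vS \<open>closed S\<close>])
  have bS: "bounded S"
    by (rule bounded_subset[of "cube (4 * L)"]) (auto simp: cube_eq_cbox bounded_cbox S_def mem_box_cart abs_le_iff minus_le_iff)
  have S\<Omega>: "S \<subseteq> perforated_domain T \<epsilon> \<eta>"
  proof
    fix x assume x: "x \<in> S"
    show "x \<in> perforated_domain T \<epsilon> \<eta>"
    proof (rule ccontr)
      assume "x \<notin> perforated_domain T \<epsilon> \<eta>"
      then obtain k y where ky: "k \<in> int_lattice" "y \<in> T" "x = \<epsilon> *\<^sub>R (k + \<eta> *\<^sub>R y)"
        by (auto simp: perforated_domain_def)
      obtain i where i: "\<epsilon> * \<eta> * ?a \<le> \<bar>x $ i - \<epsilon> * k $ i\<bar>" using x ky(1) by (auto simp: S_def)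
      have "\<bar>x $ i - \<epsilon> * k $ i\<bar> = \<epsilon> * \<eta> * \<bar>y $ i\<bar>"
        using \<epsilon> \<eta> by (simp add: ky(3) distrib_left abs_mult)
      then have "\<epsilon> * \<eta> * ?a \<le> \<epsilon> * \<eta> * \<bar>y $ i\<bar>" using i by simp
      then have "?a \<le> \<bar>y $ i\<bar>" using \<epsilon> \<eta> by simp
      moreover have "\<bar>y $ i\<bar> \<le> 1/2 - c" using T ky(2) by blast
      ultimately show False using c by linarith
    qed
  qed
  have tv: "test_function (perforated_domain T \<epsilon> \<eta>) v"
    unfolding test_function_def
  proof (intro conjI allI)
    show "Ck k v" for k unfolding v_def by (intro Ck_mult Ck\<mu> Ck\<xi>)
    show "compact (closure {x. v x \<noteq> 0})"
      using bounded_subset[OF bS clS] by (simp add: compact_eq_bounded_closed)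
    show "closure {x. v x \<noteq> 0} \<subseteq> perforated_domain T \<epsilon> \<eta>" using clS S\<Omega> by blast
  qed
  have gv: "gradient v x = \<mu> x *\<^sub>R gradient \<xi> x + \<xi> x *\<^sub>R gradient \<mu> x" for x
    unfolding v_def by (intro gradient_mult Ck_1_differentiable[OF Ck\<mu>] Ck_1_differentiable[OF Ck\<xi>])
  let ?C = "2 * B\<^sup>2 * (E + 1) / L\<^sup>2"
  have B0: "0 \<le> B" using m(2)[of 0] by linarith
  have C0: "0 \<le> ?C" using E by simp
  have mv: "(\<lambda>x. ennreal ((norm (gradient v x))\<^sup>2)) \<in> borel_measurable borel"
    using test_function_measurable(2)[OF tv] by measurable
  have "(\<integral>\<^sup>+x. ennreal ((norm (gradient v x))\<^sup>2) \<partial>lborel) \<le> (\<integral>\<^sup>+x. ennreal ?C * indicator (cube (6 * L)) x \<partial>(lborel :: (real^'n) measure))"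
  proof (rule nn_integral_mono_cells[OF mv _ \<epsilon>])
    show "(\<lambda>x. ennreal ?C * indicator (cube (6 * L)) x) \<in> borel_measurable (borel :: (real^'n) measure)" by measurable
    fix k :: "real^'n" assume k: "k \<in> int_lattice"
    let ?Q = "cell \<epsilon> (\<epsilon> *\<^sub>R k)"
    show "(\<integral>\<^sup>+x. ennreal ((norm (gradient v x))\<^sup>2) * indicator ?Q x \<partial>lborel) \<le>
        (\<integral>\<^sup>+x. ennreal ?C * indicator (cube (6 * L)) x * indicator ?Q x \<partial>lborel)"
    proof (cases "?Q \<inter> cube (4 * L) = {}")
      case True
      have "(\<integral>\<^sup>+x. ennreal ((norm (gradient v x))\<^sup>2) * indicator ?Q x \<partial>lborel) = (\<integral>\<^sup>+x. 0 \<partial>(lborel :: (real^'n) measure))"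
      proof (rule nn_integral_cong)
        fix x
        show "ennreal ((norm (gradient v x))\<^sup>2) * indicator ?Q x = 0"
        proof (cases "x \<in> ?Q")
          case True
          then have "x \<notin> cube (4 * L)" using \<open>?Q \<inter> cube (4 * L) = {}\<close> by blast
          from far[OF this] show ?thesis by (simp add: gv)
        qed simp
      qed
      then show ?thesis by simp
    next
      case False
      then obtain x0 where x0: "x0 \<in> ?Q" "x0 \<in> cube (4 * L)" by blast
      \<comment> \<open>A cell meeting \<open>cube (4 * L)\<close> reaches at most to 4L +
        \<epsilon> \<le> 6L, because \<epsilon> \<le> 2L.\<close>
      have sub: "?Q \<subseteq> cube (6 * L)"
      proof
        fix x assume "x \<in> ?Q"
        have "\<bar>x $ i\<bar> \<le> 6 * L" for i
        proof -
          have "\<bar>x $ i - x0 $ i\<bar> < \<epsilon>" by (rule cell_diff_less[OF \<open>x \<in> ?Q\<close> x0(1)])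
          moreover have "\<bar>x0 $ i\<bar> \<le> 4 * L" using x0(2) by (simp add: cube_def)
          ultimately show ?thesis using L by linarith
        qed
        then show "x \<in> cube (6 * L)" by (simp add: cube_def)
      qed
      have mgw: "(\<lambda>x. ennreal ((norm (gradient (w k) x))\<^sup>2)) \<in> borel_measurable borel"
        using borel_measurable_continuous_onI[OF continuous_gradient[OF Ckw]] by measurable
      have ew: "(\<integral>\<^sup>+x. ennreal ((norm (gradient (w k) x))\<^sup>2) \<partial>lborel) \<le> ennreal (E * \<epsilon> ^ ?d / L\<^sup>2)"
      proof -
        have "(\<integral>\<^sup>+x. ennreal ((norm (gradient (w k) x))\<^sup>2) \<partial>lborel) =
           ennreal (\<bar>\<epsilon>\<bar> ^ ?d) * (\<integral>\<^sup>+y. ennreal ((norm (gradient (w k) (\<epsilon> *\<^sub>R k + \<epsilon> *\<^sub>R y)))\<^sup>2) \<partial>lborel)"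
          using nn_integral_lborel_affine[OF mgw, of \<epsilon> "\<epsilon> *\<^sub>R k"] \<epsilon> by simp
        also have "(\<lambda>y. ennreal ((norm (gradient (w k) (\<epsilon> *\<^sub>R k + \<epsilon> *\<^sub>R y)))\<^sup>2)) =
            (\<lambda>y. ennreal (1 / \<epsilon>\<^sup>2) * ennreal ((norm (gradient W y))\<^sup>2))"
          unfolding gw using \<epsilon> by (auto simp: fun_eq_iff power_divide ennreal_mult'[symmetric])
        also have "(\<integral>\<^sup>+y. ennreal (1 / \<epsilon>\<^sup>2) * ennreal ((norm (gradient W y))\<^sup>2) \<partial>lborel) =
            ennreal (1 / \<epsilon>\<^sup>2) * (\<integral>\<^sup>+y. ennreal ((norm (gradient W y))\<^sup>2) \<partial>lborel)"
          using borel_measurable_continuous_onI[OF continuous_gradient[OF W(1)]]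
          by (intro nn_integral_cmult) measurable
        also have "ennreal (\<bar>\<epsilon>\<bar> ^ ?d) * \<dots> \<le> ennreal (\<bar>\<epsilon>\<bar> ^ ?d) * (ennreal (1 / \<epsilon>\<^sup>2) * ennreal (E * (\<epsilon> / L)\<^sup>2))"
          by (intro mult_left_mono energy) auto
        also have "\<dots> = ennreal (\<epsilon> ^ ?d * (1 / \<epsilon>\<^sup>2 * (E * (\<epsilon> / L)\<^sup>2)))"
          using \<epsilon> by (simp add: ennreal_mult'[symmetric])
        also have "\<epsilon> ^ ?d * (1 / \<epsilon>\<^sup>2 * (E * (\<epsilon> / L)\<^sup>2)) = E * \<epsilon> ^ ?d / L\<^sup>2"
          using \<epsilon> by (simp add: power_divide)
        finally show ?thesis .
      qed
      have "(\<integral>\<^sup>+x. ennreal ((norm (gradient v x))\<^sup>2) * indicator ?Q x \<partial>lborel) \<le>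
         (\<integral>\<^sup>+x. ennreal (2 * B\<^sup>2) * ennreal ((norm (gradient (w k) x))\<^sup>2) + ennreal (2 * B\<^sup>2 / L\<^sup>2) * indicator ?Q x \<partial>lborel)"
      proof (rule nn_integral_mono)
        fix x
        show "ennreal ((norm (gradient v x))\<^sup>2) * indicator ?Q x \<le>
          ennreal (2 * B\<^sup>2) * ennreal ((norm (gradient (w k) x))\<^sup>2) + ennreal (2 * B\<^sup>2 / L\<^sup>2) * indicator ?Q x"
        proof (cases "x \<in> ?Q")
          case True
          have 1: "norm (\<mu> x *\<^sub>R gradient \<xi> x) \<le> B * norm (gradient (w k) x)"
            unfolding norm_scaleR using m(2) B0 g\<xi>_cell[OF k True] by (intro mult_mono) (auto simp: \<mu>_def)
          have 2: "norm (\<xi> x *\<^sub>R gradient \<mu> x) \<le> 1 * (B / L)"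
            unfolding norm_scaleR using \<xi>01[of x] m(3) L by (intro mult_mono) (auto simp: g\<mu> divide_right_mono)
          have "(norm (gradient v x))\<^sup>2 \<le> 2 * (norm (\<mu> x *\<^sub>R gradient \<xi> x))\<^sup>2 + 2 * (norm (\<xi> x *\<^sub>R gradient \<mu> x))\<^sup>2"
            unfolding gv by (rule norm_add_sq_le)
          also have "\<dots> \<le> 2 * (B * norm (gradient (w k) x))\<^sup>2 + 2 * (1 * (B / L))\<^sup>2"
            by (intro add_mono mult_left_mono power_mono 1 2) auto
          also have "\<dots> = 2 * B\<^sup>2 * (norm (gradient (w k) x))\<^sup>2 + 2 * B\<^sup>2 / L\<^sup>2"
            by (simp add: power_mult_distrib power_divide)
          finally have "ennreal ((norm (gradient v x))\<^sup>2) \<le> ennreal (2 * B\<^sup>2 * (norm (gradient (w k) x))\<^sup>2 + 2 * B\<^sup>2 / L\<^sup>2)"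
            by (rule ennreal_leI)
          also have "\<dots> = ennreal (2 * B\<^sup>2) * ennreal ((norm (gradient (w k) x))\<^sup>2) + ennreal (2 * B\<^sup>2 / L\<^sup>2)"
            by (subst ennreal_plus) (auto simp: ennreal_mult')
          finally show ?thesis using True by simp
        qed simp
      qed
      also have "\<dots> = ennreal (2 * B\<^sup>2) * (\<integral>\<^sup>+x. ennreal ((norm (gradient (w k) x))\<^sup>2) \<partial>lborel) + ennreal (2 * B\<^sup>2 / L\<^sup>2) * ennreal (\<epsilon> ^ ?d)"
        using mgw emeasure_cell[OF \<epsilon>, of "\<epsilon> *\<^sub>R k"]
        by (subst nn_integral_add) (auto simp: nn_integral_cmult nn_integral_cmult_indicator)
      also have "\<dots> \<le> ennreal (2 * B\<^sup>2) * ennreal (E * \<epsilon> ^ ?d / L\<^sup>2) + ennreal (2 * B\<^sup>2 / L\<^sup>2) * ennreal (\<epsilon> ^ ?d)"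
        by (intro add_mono mult_left_mono ew) auto
      also have "\<dots> = ennreal (2 * B\<^sup>2 * (E * \<epsilon> ^ ?d / L\<^sup>2) + 2 * B\<^sup>2 / L\<^sup>2 * \<epsilon> ^ ?d)"
        using \<epsilon> E by (simp add: ennreal_mult'[symmetric] ennreal_plus[symmetric] del: ennreal_plus)
      also have "2 * B\<^sup>2 * (E * \<epsilon> ^ ?d / L\<^sup>2) + 2 * B\<^sup>2 / L\<^sup>2 * \<epsilon> ^ ?d = ?C * \<epsilon> ^ ?d"
        by (simp add: algebra_simps add_divide_distrib)
      also have "ennreal (?C * \<epsilon> ^ ?d) = ennreal ?C * ennreal (\<epsilon> ^ ?d)" using C0 by (rule ennreal_mult')
      also have "\<dots> = (\<integral>\<^sup>+x. ennreal ?C * indicator ?Q x \<partial>lborel)"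
        using emeasure_cell[OF \<epsilon>, of "\<epsilon> *\<^sub>R k"] by (simp add: nn_integral_cmult_indicator)
      also have "\<dots> = (\<integral>\<^sup>+x. ennreal ?C * indicator (cube (6 * L)) x * indicator ?Q x \<partial>lborel)"
        using sub by (intro nn_integral_cong) (auto simp: indicator_def)
      finally show ?thesis .
    qed
  qed
  also have "\<dots> = ennreal ?C * ennreal ((12 * L) ^ ?d)"
    using emeasure_cube[where 'n='n, of "6 * L"] L by (simp add: nn_integral_cmult_indicator)
  also have "\<dots> = ennreal (?C * (12 * L) ^ ?d)" using C0 by (rule ennreal_mult'[symmetric])
  finally have en: "(\<integral>\<^sup>+x. ennreal ((norm (gradient v x))\<^sup>2) \<partial>lborel) \<le> ennreal (?C * (12 * L) ^ ?d)" .
  have vm: "v x * m ((1 / L) *\<^sub>R x) = (\<mu> x)\<^sup>2 * \<xi> x" for x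
    by (simp add: v_def \<mu>_def power2_eq_square)
  have nonneg: "0 \<le> v x * m ((1 / L) *\<^sub>R x)" for x unfolding vm using \<xi>01 by simp
  have m\<mu>: "(\<lambda>x. ennreal ((\<mu> x)\<^sup>2 * \<xi> x)) \<in> borel_measurable borel"
    using borel_measurable_continuous_onI[OF Ck_imp_continuous[OF Ck\<mu>]]
      borel_measurable_continuous_onI[OF Ck_imp_continuous[OF Ck\<xi>]] by measurable
  \<comment> \<open>Any coordinate will do; it selects the face at which the slab is placed.\<close>
  obtain j :: 'n where True by simp
  have "ennreal (c / 4 * (2 * L) ^ ?d) = ennreal (c / 4) * ennreal ((2 * L) ^ ?d)"
    using c by (intro ennreal_mult') simp
  also have "\<dots> = (\<integral>\<^sup>+x. ennreal (c / 4) * indicator (cube L) x \<partial>(lborel :: (real^'n) measure))"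
    using emeasure_cube[where 'n='n, of L] L by (simp add: nn_integral_cmult_indicator)
  also have "\<dots> \<le> (\<integral>\<^sup>+x. ennreal ((\<mu> x)\<^sup>2 * \<xi> x) \<partial>lborel)"
  proof (rule nn_integral_mono_cells[OF _ m\<mu> \<epsilon>])
    show "(\<lambda>x. ennreal (c / 4) * indicator (cube L) x) \<in> borel_measurable (borel :: (real^'n) measure)" by measurable
    fix k :: "real^'n" assume k: "k \<in> int_lattice"
    let ?Q = "cell \<epsilon> (\<epsilon> *\<^sub>R k)"
    show "(\<integral>\<^sup>+x. ennreal (c / 4) * indicator (cube L) x * indicator ?Q x \<partial>lborel) \<le>
        (\<integral>\<^sup>+x. ennreal ((\<mu> x)\<^sup>2 * \<xi> x) * indicator ?Q x \<partial>lborel)"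
    proof (cases "?Q \<inter> cube L = {}")
      case True
      then have "(\<lambda>x. ennreal (c / 4) * indicator (cube L) x * indicator ?Q x) = (\<lambda>x. 0)"
        by (auto simp: fun_eq_iff indicator_def)
      then show ?thesis by simp
    next
      case False
      then obtain x0 where x0: "x0 \<in> ?Q" "x0 \<in> cube L" by blast
      \<comment> \<open>All coordinates are below L + \<epsilon> \<le> 3L in absolute value, where
        the rescaled profile is identically 1.\<close>
      have \<mu>1: "\<mu> x = 1" if "x \<in> ?Q" for x
      proof -
        have "\<forall>i. \<bar>((1 / L) *\<^sub>R x) $ i\<bar> < 3"
        proof
          fix i
          have "\<bar>x $ i - x0 $ i\<bar> < \<epsilon>" by (rule cell_diff_less[OF that x0(1)])
          moreover have "\<bar>x0 $ i\<bar> \<le> L" using x0(2) by (simp add: cube_def)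
          ultimately have "\<bar>x $ i\<bar> < 3 * L" using L by linarith
          then show "\<bar>((1 / L) *\<^sub>R x) $ i\<bar> < 3" using L by (simp add: abs_mult field_simps)
        qed
        then show ?thesis unfolding \<mu>_def by (rule m(5))
      qed
      let ?A = "{x \<in> ?Q. (1/2 - c/4) * \<epsilon> \<le> x $ j - (\<epsilon> *\<^sub>R k) $ j}"
      have A: "?A \<in> sets borel"
      proof -
        have "{x. (1/2 - c/4) * \<epsilon> \<le> x $ j - (\<epsilon> *\<^sub>R k) $ j} \<in> sets borel"
          by (intro borel_closed closed_Collect_le continuous_intros)
        then have "?Q \<inter> {x. (1/2 - c/4) * \<epsilon> \<le> x $ j - (\<epsilon> *\<^sub>R k) $ j} \<in> sets borel" by (intro sets.Int) auto
        moreover have "?A = ?Q \<inter> {x. (1/2 - c/4) * \<epsilon> \<le> x $ j - (\<epsilon> *\<^sub>R k) $ j}" by blast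
        ultimately show ?thesis by (simp only:)
      qed
      have "(\<integral>\<^sup>+x. ennreal (c / 4) * indicator (cube L) x * indicator ?Q x \<partial>lborel) \<le> (\<integral>\<^sup>+x. ennreal (c / 4) * indicator ?Q x \<partial>lborel)"
        by (intro nn_integral_mono) (auto simp: indicator_def)
      also have "\<dots> = ennreal (c / 4) * ennreal (\<epsilon> ^ ?d)"
        using emeasure_cell[OF \<epsilon>, of "\<epsilon> *\<^sub>R k"] by (simp add: nn_integral_cmult_indicator)
      also have "\<dots> = ennreal (c / 4 * \<epsilon> ^ ?d)" using c by (intro ennreal_mult'[symmetric]) simp
      also have "\<dots> \<le> emeasure lborel ?A" using c by (intro emeasure_cell_slab[OF \<epsilon>]) auto
      also have "\<dots> = (\<integral>\<^sup>+x. indicator ?A x \<partial>lborel)"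
        using A by (intro nn_integral_indicator[symmetric]) simp
      also have "\<dots> \<le> (\<integral>\<^sup>+x. ennreal ((\<mu> x)\<^sup>2 * \<xi> x) * indicator ?Q x \<partial>lborel)"
      proof (rule nn_integral_mono)
        fix x
        show "indicator ?A x \<le> ennreal ((\<mu> x)\<^sup>2 * \<xi> x) * indicator ?Q x"
        proof (cases "x \<in> ?A")
          case True
          then have xQ: "x \<in> ?Q" and xj: "(1/2 - c/4) * \<epsilon> \<le> x $ j - \<epsilon> * k $ j" by auto
          have "(1/2 - c/4) \<le> (x $ j - \<epsilon> * k $ j) / \<epsilon>" using xj \<epsilon> by (simp only: le_divide_eq if_True)
          also have "\<dots> \<le> \<bar>(x $ j - \<epsilon> * k $ j) / \<epsilon>\<bar>" by (rule abs_ge_self)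
          also have "\<dots> = \<bar>((1 / \<epsilon>) *\<^sub>R (x - \<epsilon> *\<^sub>R k)) $ j\<bar>" by simp
          finally have "1/2 - c/4 \<le> \<bar>((1 / \<epsilon>) *\<^sub>R (x - \<epsilon> *\<^sub>R k)) $ j\<bar>" .
          then have "w k x = 0" unfolding w_def by (rule W(4))
          then have "\<xi> x = 1" using \<xi>_cell[OF k xQ] by simp
          then show ?thesis using \<mu>1[OF xQ] xQ by (simp add: indicator_def)
        qed simp
      qed
      finally show ?thesis .
    qed
  qed
  finally have mass: "ennreal (c / 4 * (2 * L) ^ ?d) \<le> (\<integral>\<^sup>+x. ennreal (v x * m ((1 / L) *\<^sub>R x)) \<partial>lborel)"
    unfolding vm .
  show ?thesis by (rule that[OF tv en _ mass]) (use nonneg in blast)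
qed

section \<open>Solutions with a rescaled right-hand side\<close>

lemma test_function_scale:
  assumes R: "test_function UNIV R" "\<And>x i. 4 < \<bar>x $ i\<bar> \<Longrightarrow> R x = (0::real)" and L: "0 < L"
  shows "test_function UNIV (\<lambda>x. R ((1 / L) *\<^sub>R x))"
    and "\<And>x. x \<notin> cube (4 * L) \<Longrightarrow> R ((1 / L) *\<^sub>R x) = 0"
proof -
  show z: "R ((1 / L) *\<^sub>R x) = 0" if x: "x \<notin> cube (4 * L)" for x
  proof -
    from x have "\<exists>i. 4 * L < \<bar>x $ i\<bar>" by (auto simp: cube_def not_le)
    then obtain i where "4 * L < \<bar>x $ i\<bar>" ..
    then have "4 < \<bar>((1 / L) *\<^sub>R x) $ i\<bar>" using L by (simp add: abs_mult field_simps)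
    then show ?thesis by (rule R(2))
  qed
  have "{x. R ((1 / L) *\<^sub>R x) \<noteq> 0} \<subseteq> cube (4 * L)" using z by blast
  then have "bounded {x. R ((1 / L) *\<^sub>R x) \<noteq> 0}"
    unfolding cube_eq_cbox using bounded_cbox bounded_subset by blast
  then have "compact (closure {x. R ((1 / L) *\<^sub>R x) \<noteq> 0})" by (simp only: compact_closure)
  moreover have "Ck k (\<lambda>x. R ((1 / L) *\<^sub>R x))" for k
    using Ck_scale_shift[OF test_function_Ck[OF R(1)], of k "1 / L" 0] by simp
  ultimately show "test_function UNIV (\<lambda>x. R ((1 / L) *\<^sub>R x))" by (simp add: test_function_def)
qed

lemma test_function_mono: "test_function \<Omega> \<phi> \<Longrightarrow> test_function UNIV \<phi>"
  by (simp add: test_function_def)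

lemma tendsto_integral_inner:
  assumes h: "square_integrable M h" and g: "\<And>n. square_integrable M (g n)" and G: "square_integrable M G"
    and lim: "(\<lambda>n. \<integral>x. (norm (g n x - G x))\<^sup>2 \<partial>M) \<longlonglongrightarrow> 0"
  shows "(\<lambda>n. \<integral>x. h x \<bullet> g n x \<partial>M) \<longlonglongrightarrow> (\<integral>x. h x \<bullet> G x \<partial>M)"
proof -
  let ?A = "\<integral>x. (norm (h x))\<^sup>2 \<partial>M" and ?D = "\<lambda>n. (\<integral>x. h x \<bullet> g n x \<partial>M) - (\<integral>x. h x \<bullet> G x \<partial>M)"
  have "(?D n)\<^sup>2 \<le> ?A * (\<integral>x. (norm (g n x - G x))\<^sup>2 \<partial>M)" for n
  proof -
    have "?D n = (\<integral>x. h x \<bullet> (g n x - G x) \<partial>M)"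
      using square_integrable_inner[OF h g] square_integrable_inner[OF h G] by (simp add: inner_diff_right)
    then show ?thesis using Cauchy_Schwarz_integral[OF h square_integrable_diff[OF g G]] by simp
  qed
  moreover have "(\<lambda>n. ?A * (\<integral>x. (norm (g n x - G x))\<^sup>2 \<partial>M)) \<longlonglongrightarrow> 0"
    using tendsto_mult[OF tendsto_const lim] by simp
  ultimately have "(\<lambda>n. (?D n)\<^sup>2) \<longlonglongrightarrow> 0"
    by (intro tendsto_sandwich[where f="\<lambda>n. 0" and h="\<lambda>n. ?A * (\<integral>x. (norm (g n x - G x))\<^sup>2 \<partial>M)"
          and g="\<lambda>n. (?D n)\<^sup>2"] always_eventually allI) simp_all
  then have "(\<lambda>n. sqrt ((?D n)\<^sup>2)) \<longlonglongrightarrow> sqrt 0" by (rule tendsto_real_sqrt)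
  then have "?D \<longlonglongrightarrow> 0" by (simp add: tendsto_rabs_zero_iff)
  then show ?thesis using Lim_null by blast
qed

text \<open>A pointwise substitute for Hoelder's inequality: integrated over a set of finite
  measure, with s half of a lower bound for the mean of a, it bounds the L^p norm from below by the
  L^1 norm.\<close>

lemma L1_le_Lp_tradeoff:
  fixes a s p :: real
  assumes "0 \<le> a" "0 < s" "1 \<le> p"
  shows "a \<le> s + s powr (1 - p) * a powr p"
proof (cases "a \<le> s")
  case True
  have "0 \<le> s powr (1 - p) * a powr p" by simp
  then show ?thesis using True by linarith
next
  case False
  then have a: "0 < a" using assms by simp
  have "a powr (1 - p) \<le> s powr (1 - p)"
    using False assms by (intro powr_mono2') auto
  then have "a powr (1 - p) * a powr p \<le> s powr (1 - p) * a powr p" by (rule mult_right_mono) simp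
  moreover have "a powr (1 - p) * a powr p = a" using a by (simp add: powr_add[symmetric])
  ultimately show ?thesis using assms by linarith
qed

text \<open>Testing the equation with \<open>u\<close> itself gives \<open>\<parallel>G\<parallel>\<^sup>2 = - \<integral> f \<bullet> G = \<integral> u div f\<close>, and testing it with
  \<open>v\<close> bounds \<open>\<parallel>G\<parallel>\<close> from below; so \<open>u\<close> cannot be small in \<open>L\<^sup>1\<close> on the support of \<open>div f\<close>.\<close>

lemma weak_solution_L1_lower_bound:
  fixes r v :: "real^'n \<Rightarrow> real"
  assumes dom: "poincare_domain \<Omega> K" and r: "test_function UNIV r" and v: "test_function \<Omega> v" and t: "0 < t"
    and b: "\<And>x. \<bar>gradient r x $ i\<bar> \<le> b * indicator Q x" and Q: "Q \<in> sets borel" "emeasure lborel Q < \<infinity>"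
  obtains u where "weak_solution \<Omega> (\<lambda>x. (t * r x) *\<^sub>R axis i 1) u" "square_integrable (lebesgue_on \<Omega>) u"
    "integrable (lebesgue_on \<Omega>) (\<lambda>x. \<bar>u x\<bar> * indicator Q x)"
    "t * (\<integral>x. v x * gradient r x $ i \<partial>lborel)\<^sup>2 \<le>
      b * (\<integral>x. \<bar>u x\<bar> * indicator Q x \<partial>lebesgue_on \<Omega>) * (\<integral>x. (norm (gradient v x))\<^sup>2 \<partial>lebesgue_on \<Omega>)"
proof -
  let ?M = "lebesgue_on \<Omega>" and ?X = "\<integral>x. v x * gradient r x $ i \<partial>lborel"
  let ?f = "\<lambda>x. (t * r x) *\<^sub>R axis i (1::real)"
  have \<Omega>: "\<Omega> \<in> sets borel" using dom by (simp add: poincare_domain_def)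
  have sr: "square_integrable ?M r" by (rule test_function_square_integrable(1)[OF r \<Omega>])
  have ri: "test_function UNIV (\<lambda>x. gradient r x $ i)" by (rule test_function_gradient_nth[OF r])
  have sri: "square_integrable ?M (\<lambda>x. gradient r x $ i)" by (rule test_function_square_integrable(1)[OF ri \<Omega>])
  have f: "square_integrable ?M ?f"
  proof -
    have "(norm (?f x))\<^sup>2 = t\<^sup>2 * (norm (r x))\<^sup>2" for x
      by (simp add: norm_axis_1 power_mult_distrib abs_mult)
    then show ?thesis using sr unfolding square_integrable_def by auto
  qed
  obtain u G \<psi> where u: "weak_solution \<Omega> ?f u" "square_integrable ?M u" and G: "square_integrable ?M G"
    and weak: "\<forall>\<phi>. test_function \<Omega> \<phi> \<longrightarrow> (\<integral>x. (G x + ?f x) \<bullet> gradient \<phi> x \<partial>?M) = 0"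
    and \<psi>': "\<forall>n. test_function \<Omega> (\<psi> n)"
    and limu: "(\<lambda>n. \<integral>x. (norm (\<psi> n x - u x))\<^sup>2 \<partial>?M) \<longlonglongrightarrow> 0"
    and limG: "(\<lambda>n. \<integral>x. (norm (gradient (\<psi> n) x - G x))\<^sup>2 \<partial>?M) \<longlonglongrightarrow> 0"
    by (rule weak_solution_exists[OF dom f])
  have \<psi>: "test_function \<Omega> (\<psi> n)" for n using \<psi>' by blast
  \<comment> \<open>For f = t r e_i the weak equation, integrated by parts, moves the derivative
    from \<phi> to r; this is the form in which \<phi> can be replaced by an L^2 limit.\<close>
  have key: "(\<integral>x. G x \<bullet> gradient \<phi> x \<partial>?M) = t * (\<integral>x. \<phi> x * gradient r x $ i \<partial>lborel)"
    if \<phi>: "test_function \<Omega> \<phi>" for \<phi>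
  proof -
    have D: "square_integrable ?M (gradient \<phi>)" by (rule test_function_square_integrable(2)[OF \<phi> \<Omega>])
    have "(\<integral>x. G x \<bullet> gradient \<phi> x + ?f x \<bullet> gradient \<phi> x \<partial>?M) = (\<integral>x. G x \<bullet> gradient \<phi> x \<partial>?M) + (\<integral>x. ?f x \<bullet> gradient \<phi> x \<partial>?M)"
      by (intro Bochner_Integration.integral_add square_integrable_inner G D f)
    then have "(\<integral>x. G x \<bullet> gradient \<phi> x \<partial>?M) = - (\<integral>x. ?f x \<bullet> gradient \<phi> x \<partial>?M)"
      using weak \<phi> by (simp add: inner_add_left)
    also have "(\<integral>x. ?f x \<bullet> gradient \<phi> x \<partial>?M) = t * (\<integral>x. r x * gradient \<phi> x $ i \<partial>?M)"
      by (simp add: inner_axis' mult.assoc)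
    also have "(\<integral>x. r x * gradient \<phi> x $ i \<partial>?M) = (\<integral>x. r x * gradient \<phi> x $ i \<partial>lborel)"
    proof (rule integral_lebesgue_on_eq_lborel[OF \<Omega>])
      show "r x * gradient \<phi> x $ i = 0" if "x \<notin> \<Omega>" for x using test_function_zero[OF \<phi> that] by simp
      show "(\<lambda>x. r x * gradient \<phi> x $ i) \<in> borel_measurable borel"
        using test_function_measurable(1)[OF r] test_function_measurable(1)[OF test_function_gradient_nth[OF \<phi>]] by measurable
    qed
    also have "\<dots> = - (\<integral>x. \<phi> x * gradient r x $ i \<partial>lborel)"
      by (rule integral_gradient_nth_by_parts[OF r test_function_mono[OF \<phi>]])
    finally show ?thesis by simp
  qed
  have toM: "(\<integral>x. \<phi> x * gradient r x $ i \<partial>lborel) = (\<integral>x. (gradient r x $ i) \<bullet> \<phi> x \<partial>?M)"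
    if \<phi>: "test_function \<Omega> \<phi>" for \<phi>
  proof -
    have "(\<integral>x. \<phi> x * gradient r x $ i \<partial>?M) = (\<integral>x. \<phi> x * gradient r x $ i \<partial>lborel)"
    proof (rule integral_lebesgue_on_eq_lborel[OF \<Omega>])
      show "\<phi> x * gradient r x $ i = 0" if "x \<notin> \<Omega>" for x using test_function_zero[OF \<phi> that] by simp
      show "(\<lambda>x. \<phi> x * gradient r x $ i) \<in> borel_measurable borel"
        using test_function_measurable(1)[OF \<phi>] test_function_measurable(1)[OF ri] by measurable
    qed
    then show ?thesis by (simp add: mult.commute)
  qed
  \<comment> \<open>u need not be a test function; both sides of \<open>key\<close> pass to the
    limit along its approximants \<open>\<psi> n\<close>.\<close>
  have "(\<lambda>n. \<integral>x. G x \<bullet> gradient (\<psi> n) x \<partial>?M) \<longlonglongrightarrow> (\<integral>x. G x \<bullet> G x \<partial>?M)"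
    by (rule tendsto_integral_inner[OF G test_function_square_integrable(2)[OF \<psi> \<Omega>] G limG])
  moreover have "(\<lambda>n. \<integral>x. G x \<bullet> gradient (\<psi> n) x \<partial>?M) \<longlonglongrightarrow> t * (\<integral>x. (gradient r x $ i) \<bullet> u x \<partial>?M)"
    unfolding key[OF \<psi>] toM[OF \<psi>]
    by (intro tendsto_mult tendsto_const tendsto_integral_inner[OF sri test_function_square_integrable(1)[OF \<psi> \<Omega>] u(2) limu])
  ultimately have GG: "(\<integral>x. G x \<bullet> G x \<partial>?M) = t * (\<integral>x. (gradient r x $ i) \<bullet> u x \<partial>?M)"
    by (rule LIMSEQ_unique)
  have sQ: "square_integrable ?M (indicator Q :: _ \<Rightarrow> real)"
    unfolding square_integrable_iff_nn
  proof
    have "(indicator Q :: _ \<Rightarrow> real) \<in> borel_measurable borel" using Q(1) by measurable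
    then show "(indicator Q :: _ \<Rightarrow> real) \<in> borel_measurable ?M" by (rule borel_measurable_lebesgue_onI)
    have \<Omega>l: "\<Omega> \<in> sets lebesgue" using \<Omega> by (auto intro: sets_completionI_sets)
    have "(\<integral>\<^sup>+x. ennreal ((norm (indicator Q x :: real))\<^sup>2) \<partial>?M) = (\<integral>\<^sup>+x. indicator Q x * indicator \<Omega> x \<partial>lebesgue)"
      using \<Omega>l by (subst nn_integral_restrict_space) (auto intro!: nn_integral_cong simp: indicator_def)
    also have "\<dots> \<le> (\<integral>\<^sup>+x. indicator Q x \<partial>lebesgue)"
      by (intro nn_integral_mono) (auto simp: indicator_def)
    also have "\<dots> = emeasure lborel Q" using Q(1) by (simp add: nn_integral_completion)
    finally show "(\<integral>\<^sup>+x. ennreal ((norm (indicator Q x :: real))\<^sup>2) \<partial>?M) < \<infinity>" using Q(2) by (rule le_less_trans)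
  qed
  have "square_integrable ?M (\<lambda>x. \<bar>u x\<bar>)" using u(2) unfolding square_integrable_def by auto
  from square_integrable_inner[OF this sQ]
  have iu: "integrable ?M (\<lambda>x. \<bar>u x\<bar> * indicator Q x)" by simp
  let ?S = "\<integral>x. \<bar>u x\<bar> * indicator Q x \<partial>?M" and ?V = "\<integral>x. (norm (gradient v x))\<^sup>2 \<partial>?M"
  have "(\<integral>x. (gradient r x $ i) \<bullet> u x \<partial>?M) \<le> (\<integral>x. b * (\<bar>u x\<bar> * indicator Q x) \<partial>?M)"
  proof (rule integral_mono)
    show "integrable ?M (\<lambda>x. (gradient r x $ i) \<bullet> u x)" by (rule square_integrable_inner[OF sri u(2)])
    show "integrable ?M (\<lambda>x. b * (\<bar>u x\<bar> * indicator Q x))" using iu by simp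
    fix x
    have "(gradient r x $ i) \<bullet> u x \<le> \<bar>gradient r x $ i\<bar> * \<bar>u x\<bar>"
      by (simp add: abs_mult[symmetric])
    also have "\<dots> \<le> (b * indicator Q x) * \<bar>u x\<bar>" by (rule mult_right_mono[OF b]) simp
    finally show "(gradient r x $ i) \<bullet> u x \<le> b * (\<bar>u x\<bar> * indicator Q x)" by (simp add: mult_ac)
  qed
  then have "t * (\<integral>x. (gradient r x $ i) \<bullet> u x \<partial>?M) \<le> t * (b * ?S)" using t by simp
  then have GS: "(\<integral>x. (norm (G x))\<^sup>2 \<partial>?M) \<le> t * (b * ?S)" using GG by (simp add: power2_norm_eq_inner)
  \<comment> \<open>By \<open>key\<close> for v, t X is the pairing of G with the gradient of v. One
    factor t then cancels against the energy bound \<open>GS\<close>.\<close>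
  have "(t * ?X)\<^sup>2 \<le> (\<integral>x. (norm (G x))\<^sup>2 \<partial>?M) * ?V"
    unfolding key[OF v, symmetric] by (rule Cauchy_Schwarz_integral[OF G test_function_square_integrable(2)[OF v \<Omega>]])
  also have "\<dots> \<le> (t * (b * ?S)) * ?V" by (rule mult_right_mono[OF GS]) simp
  finally have "t * (t * ?X\<^sup>2) \<le> t * (b * ?S * ?V)" by (simp add: power2_eq_square mult_ac)
  then have "t * ?X\<^sup>2 \<le> b * ?S * ?V" using t by simp
  from that[OF u iu this] show ?thesis .
qed

text \<open>A matter of powers of L: the pairing X is at least of order L^(d-1) and the energy of v
  at most of order L^(d-2), so the integral of |u| over the cube is at least of order t L^(d+1), and
  its mean of order t L. Normalising f makes t at least of order L^(-d/p), which cancels the volume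
  factor in the L^p norm of u.\<close>

lemma weak_solution_lower_bound:
  fixes R v :: "real^'n \<Rightarrow> real"
  assumes dom: "poincare_domain \<Omega> K" and p: "2 \<le> p" and L: "0 < L"
    and R: "test_function UNIV R" "\<And>x. \<bar>R x\<bar> \<le> B" "\<And>x i. 4 < \<bar>x $ i\<bar> \<Longrightarrow> R x = 0" and B: "0 < B"
    and m: "\<And>x. \<bar>gradient R x $ i\<bar> \<le> B" "\<And>x j. 4 < \<bar>x $ j\<bar> \<Longrightarrow> gradient R x $ i = 0"
    and v: "test_function \<Omega> v" and c: "0 < c" and C: "0 < C"
    and energy: "(\<integral>\<^sup>+x. ennreal ((norm (gradient v x))\<^sup>2) \<partial>lborel) \<le> ennreal (C / L\<^sup>2 * (12 * L) ^ CARD('n))"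
    and nonneg: "\<And>x. 0 \<le> v x * gradient R ((1 / L) *\<^sub>R x) $ i"
    and mass: "ennreal (c * (2 * L) ^ CARD('n)) \<le> (\<integral>\<^sup>+x. ennreal (v x * gradient R ((1 / L) *\<^sub>R x) $ i) \<partial>lborel)"
  obtains f u where "f \<in> Lp_space p \<Omega>" "f \<in> Lp_space 2 \<Omega>" "Lp_norm p \<Omega> f = 1" "weak_solution \<Omega> f u"
    "ennreal (c\<^sup>2 / (B * C * 3 ^ CARD('n)) / (2 * 8 ^ CARD('n) * B) * L) \<le> Lp_norm p \<Omega> u"
proof -
  let ?M = "lebesgue_on \<Omega>" and ?d = "CARD('n)"
  let ?Q = "cube (4 * L) :: (real^'n) set"
  have \<Omega>: "\<Omega> \<in> sets borel" using dom by (simp add: poincare_domain_def)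
  have \<Omega>l: "\<Omega> \<in> sets lebesgue" using \<Omega> by (auto intro: sets_completionI_sets)
  have p0: "0 < p" using p by simp
  define r where "r x = R ((1 / L) *\<^sub>R x)" for x
  have r: "test_function UNIV r" unfolding r_def by (rule test_function_scale(1)[OF R(1) _ L]) (rule R(3))
  have r0: "r x = 0" if "x \<notin> ?Q" for x
    unfolding r_def by (rule test_function_scale(2)[OF R(1) _ L]) (use that R(3) in blast)+
  have gr: "gradient r x $ i = (1 / L) * gradient R ((1 / L) *\<^sub>R x) $ i" for x
    unfolding r_def using gradient_scale_shift[of R "1 / L" x 0] test_function_differentiable[OF R(1)] by simp
  have grQ: "\<bar>gradient r x $ i\<bar> \<le> (B / L) * indicator ?Q x" for x
  proof (cases "x \<in> ?Q")
    case True
    then show ?thesis using m(1) L by (simp add: gr abs_mult divide_right_mono)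
  next
    case False
    from False have "\<exists>j. 4 * L < \<bar>x $ j\<bar>" by (auto simp: cube_def not_le)
    then obtain j where "4 * L < \<bar>x $ j\<bar>" ..
    then have "4 < \<bar>((1 / L) *\<^sub>R x) $ j\<bar>" using L by (simp add: abs_mult field_simps)
    from m(2)[OF this] show ?thesis using False by (simp add: gr)
  qed
  have eQ: "emeasure lborel ?Q = ennreal ((8 * L) ^ ?d)" using emeasure_cube[where 'n='n, of "4 * L"] L by simp
  let ?X = "\<integral>x. v x * gradient r x $ i \<partial>lborel"
  have X: "c * (2 * L) ^ ?d / L \<le> ?X"
  proof -
    have "integrable lborel (\<lambda>x. v x * gradient r x $ i)"
      using square_integrable_inner[OF test_function_square_integrable(3)[OF test_function_mono[OF v], of UNIV]
          test_function_square_integrable(3)[OF test_function_gradient_nth[OF r], of UNIV]] by simp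
    then have "integrable lborel (\<lambda>x. L * (v x * gradient r x $ i))" by simp
    then have int: "integrable lborel (\<lambda>x. v x * gradient R ((1 / L) *\<^sub>R x) $ i)" using L by (simp add: gr)
    have "ennreal (c * (2 * L) ^ ?d) \<le> ennreal (\<integral>x. v x * gradient R ((1 / L) *\<^sub>R x) $ i \<partial>lborel)"
      using mass nn_integral_eq_integral[OF int] nonneg by simp
    then have "c * (2 * L) ^ ?d \<le> (\<integral>x. v x * gradient R ((1 / L) *\<^sub>R x) $ i \<partial>lborel)"
      by (subst (asm) ennreal_le_iff) (auto intro!: Bochner_Integration.integral_nonneg nonneg)
    then have "c * (2 * L) ^ ?d / L \<le> (\<integral>x. v x * gradient R ((1 / L) *\<^sub>R x) $ i \<partial>lborel) / L"
      using L by (intro divide_right_mono) auto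
    also have "\<dots> = ?X" by (simp add: gr)
    finally show ?thesis .
  qed
  have X0: "0 < c * (2 * L) ^ ?d / L" using c L by simp
  have rint: "integrable ?M (\<lambda>x. \<bar>r x\<bar> powr p)"
  proof (rule test_function_integrable(2)[OF r _ _ _ \<Omega>, where B="B powr p"])
    have [measurable]: "r \<in> borel_measurable borel" by (rule test_function_measurable(1)[OF r])
    show "(\<lambda>x. \<bar>r x\<bar> powr p) \<in> borel_measurable borel" by measurable
    show "norm (\<bar>r x\<bar> powr p) \<le> B powr p" for x using R(2) p by (auto simp: r_def intro!: powr_mono2)
    show "\<bar>r x\<bar> powr p = 0" if "x \<notin> closure {x. r x \<noteq> 0}" for x
    proof -
      have "r x = 0" using that closure_subset[of "{x. r x \<noteq> 0}"] by auto
      then show ?thesis by simp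
    qed
  qed
  define I where "I = (\<integral>x. \<bar>r x\<bar> powr p \<partial>?M)"
  have nnI: "(\<integral>\<^sup>+x. ennreal (\<bar>r x\<bar> powr p) \<partial>?M) = ennreal I"
    unfolding I_def by (rule nn_integral_eq_integral[OF rint]) simp
  \<comment> \<open>f has to be nonzero on \<Omega> to be normalised. Were r zero almost everywhere
    on \<Omega>, integration by parts would make X vanish, against its lower bound.\<close>
  have I0: "0 < I"
  proof -
    have "I \<noteq> 0"
    proof
      assume "I = 0"
      then have "AE x in ?M. \<bar>r x\<bar> powr p = 0"
        using integral_nonneg_eq_0_iff_AE[OF rint] by (simp add: I_def)
      then have "AE x in ?M. r x * gradient v x $ i = 0" by (rule AE_mp) (auto intro!: AE_I2)
      then have "(\<integral>x. r x * gradient v x $ i \<partial>?M) = 0" by (rule integral_eq_zero_AE)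
      moreover have "(\<integral>x. r x * gradient v x $ i \<partial>?M) = (\<integral>x. r x * gradient v x $ i \<partial>lborel)"
      proof (rule integral_lebesgue_on_eq_lborel[OF \<Omega>])
        show "r x * gradient v x $ i = 0" if "x \<notin> \<Omega>" for x using test_function_zero[OF v that] by simp
        show "(\<lambda>x. r x * gradient v x $ i) \<in> borel_measurable borel"
          using test_function_measurable(1)[OF r] test_function_measurable(1)[OF test_function_gradient_nth[OF v]] by measurable
      qed
      moreover have "(\<integral>x. r x * gradient v x $ i \<partial>lborel) = - ?X"
        by (rule integral_gradient_nth_by_parts[OF r test_function_mono[OF v]])
      ultimately have "?X = 0" by simp
      then show False using X X0 by linarith
    qed
    moreover have "0 \<le> I" by (simp add: I_def)
    ultimately show ?thesis by simp
  qed
  have IB: "I \<le> B powr p * (8 * L) ^ ?d"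
  proof -
    have "ennreal I = (\<integral>\<^sup>+x. ennreal (\<bar>r x\<bar> powr p) * indicator \<Omega> x \<partial>lebesgue)"
      unfolding nnI[symmetric] using \<Omega>l by (intro nn_integral_restrict_space) auto
    also have "\<dots> \<le> (\<integral>\<^sup>+x. ennreal (B powr p) * indicator ?Q x \<partial>lebesgue)"
    proof (rule nn_integral_mono)
      fix x :: "real^'n"
      have "\<bar>r x\<bar> powr p \<le> B powr p" using R(2) p by (auto simp: r_def intro!: powr_mono2)
      moreover note r0[of x]
      ultimately show "ennreal (\<bar>r x\<bar> powr p) * indicator \<Omega> x \<le> ennreal (B powr p) * indicator ?Q x"
        by (auto simp: indicator_def intro!: ennreal_leI)
    qed
    also have "\<dots> = ennreal (B powr p) * ennreal ((8 * L) ^ ?d)"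
      by (simp add: nn_integral_completion nn_integral_cmult_indicator eQ)
    also have "\<dots> = ennreal (B powr p * (8 * L) ^ ?d)" by (rule ennreal_mult'[symmetric]) simp
    finally show ?thesis using L by (subst (asm) ennreal_le_iff) auto
  qed
  \<comment> \<open>The scalar that gives \<open>?f\<close> unit L^p norm.\<close>
  define t where "t = I powr (- 1 / p)"
  have t: "0 < t" using I0 by (simp add: t_def)
  have "t powr p = I powr (- 1 / p * p)" unfolding t_def by (rule powr_powr)
  also have "- 1 / p * p = - 1" using p0 by simp
  finally have tI: "t powr p * I = 1" using I0 by (simp add: powr_neg_one)
  let ?f = "\<lambda>x. (t * r x) *\<^sub>R axis i (1::real)"
  have Qb: "?Q \<in> sets borel" "emeasure lborel ?Q < \<infinity>" by (auto simp: eQ)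
  obtain u where u: "weak_solution \<Omega> ?f u" "square_integrable ?M u"
    and iu: "integrable ?M (\<lambda>x. \<bar>u x\<bar> * indicator ?Q x)"
    and est: "t * ?X\<^sup>2 \<le> B / L * (\<integral>x. \<bar>u x\<bar> * indicator ?Q x \<partial>?M) * (\<integral>x. (norm (gradient v x))\<^sup>2 \<partial>?M)"
    by (rule weak_solution_L1_lower_bound[OF dom r v t grQ Qb])
  have nf: "norm (?f x) = t * \<bar>r x\<bar>" for x using t by (simp add: norm_axis_1 abs_mult)
  have fm: "?f \<in> borel_measurable ?M"
    using test_function_measurable(3)[OF r, of \<Omega>] by measurable
  have nn1: "(\<integral>\<^sup>+x. ennreal (norm (?f x) powr p) \<partial>?M) = ennreal (1 powr p)"
  proof -
    have "(\<integral>\<^sup>+x. ennreal (norm (?f x) powr p) \<partial>?M) = (\<integral>\<^sup>+x. ennreal (t powr p) * ennreal (\<bar>r x\<bar> powr p) \<partial>?M)"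
      unfolding nf using t by (intro nn_integral_cong) (simp add: powr_mult ennreal_mult')
    also have "\<dots> = ennreal (t powr p) * ennreal I"
      unfolding nnI[symmetric] using test_function_measurable(3)[OF r, of \<Omega>]
      by (intro nn_integral_cmult) measurable
    also have "\<dots> = ennreal (t powr p * I)" by (rule ennreal_mult'[symmetric]) simp
    finally show ?thesis by (simp add: tI)
  qed
  have f1: "Lp_norm p \<Omega> ?f = 1" using Lp_norm_eq_iff[OF p0, of 1 \<Omega> ?f] nn1 by simp
  have fp: "?f \<in> Lp_space p \<Omega>" using fm f1 by (simp add: Lp_space_def)
  have f2: "?f \<in> Lp_space 2 \<Omega>"
  proof -
    have "(norm (?f x))\<^sup>2 = t\<^sup>2 * (norm (r x))\<^sup>2" for x by (simp only: nf power_mult_distrib real_norm_def)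
    then show ?thesis
      using test_function_square_integrable(1)[OF r \<Omega>] fm
      unfolding Lp_space_2_iff square_integrable_def by simp
  qed
  define S where "S = (\<integral>x. \<bar>u x\<bar> * indicator ?Q x \<partial>?M)"
  define c2 where "c2 = c\<^sup>2 / (B * C * 3 ^ ?d)"
  have c2: "0 < c2" using c B C by (simp add: c2_def)
  have V: "(\<integral>x. (norm (gradient v x))\<^sup>2 \<partial>?M) \<le> C / L\<^sup>2 * (12 * L) ^ ?d"
  proof -
    have "ennreal (\<integral>x. (norm (gradient v x))\<^sup>2 \<partial>?M) = (\<integral>\<^sup>+x. ennreal ((norm (gradient v x))\<^sup>2) \<partial>?M)"
      by (rule square_integrable_nn_integral[OF test_function_square_integrable(2)[OF v \<Omega>], symmetric])
    also have "\<dots> = (\<integral>\<^sup>+x. ennreal ((norm (gradient v x))\<^sup>2) \<partial>lborel)"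
      using test_function_zero[OF v] by (intro nn_integral_lebesgue_on_eq_lborel[OF \<Omega>]) simp
    also note energy
    finally show ?thesis using C L by (subst (asm) ennreal_le_iff) auto
  qed
  have S0: "0 \<le> S" unfolding S_def by (intro Bochner_Integration.integral_nonneg) simp
  have S: "t * c2 * L * L ^ ?d \<le> S"
  proof -
    have "t * (c * (2 * L) ^ ?d / L)\<^sup>2 \<le> t * ?X\<^sup>2"
      using X X0 t by (intro mult_left_mono power_mono) auto
    also have "\<dots> \<le> B / L * S * (\<integral>x. (norm (gradient v x))\<^sup>2 \<partial>?M)"
      unfolding S_def by (rule est)
    also have "\<dots> \<le> B / L * S * (C / L\<^sup>2 * (12 * L) ^ ?d)"
      using B L S0 by (intro mult_left_mono[OF V] mult_nonneg_nonneg) simp_all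
    finally have le: "t * (c * (2 * L) ^ ?d / L)\<^sup>2 \<le> B / L * S * (C / L\<^sup>2 * (12 * L) ^ ?d)" .
    \<comment> \<open>(2L)^2 times 3 is 12L times L: the factor 3^d in \<open>c2\<close> is what
      turns (2L)^(2d) into a multiple of (12L)^d.\<close>
    have pow: "((2 * L) ^ ?d)\<^sup>2 * 3 ^ ?d = (12 * L) ^ ?d * L ^ ?d"
    proof -
      have "((2 * L) ^ ?d)\<^sup>2 * 3 ^ ?d = ((2 * L) * (2 * L) * 3) ^ ?d"
        by (simp only: power2_eq_square power_mult_distrib)
      also have "(2 * L) * (2 * L) * 3 = (12 * L) * L" by simp
      finally show ?thesis by (simp only: power_mult_distrib)
    qed
    have "t * c\<^sup>2 * ((2 * L) ^ ?d)\<^sup>2 * L \<le> B * C * S * (12 * L) ^ ?d"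
    proof -
      have a: "(t * (c * (2 * L) ^ ?d / L)\<^sup>2) * L ^ 3 \<le> (B / L * S * (C / L\<^sup>2 * (12 * L) ^ ?d)) * L ^ 3"
        by (rule mult_right_mono[OF le]) (use L in simp)
      have e1: "(t * (c * (2 * L) ^ ?d / L)\<^sup>2) * L ^ 3 = t * c\<^sup>2 * ((2 * L) ^ ?d)\<^sup>2 * L"
        using L by (simp add: power_divide power_mult_distrib power2_eq_square power3_eq_cube)
      have e2: "(B / L * S * (C / L\<^sup>2 * (12 * L) ^ ?d)) * L ^ 3 = B * C * S * (12 * L) ^ ?d"
        using L by (simp add: power2_eq_square power3_eq_cube)
      show ?thesis using a unfolding e1 e2 .
    qed
    then have "t * c\<^sup>2 * ((2 * L) ^ ?d)\<^sup>2 * L * 3 ^ ?d \<le> B * C * S * (12 * L) ^ ?d * 3 ^ ?d"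
      by (rule mult_right_mono) simp
    then have "(t * c\<^sup>2 * L) * (((2 * L) ^ ?d)\<^sup>2 * 3 ^ ?d) \<le> (B * C * S * 3 ^ ?d) * (12 * L) ^ ?d"
      by (simp only: mult_ac)
    then have "(t * c\<^sup>2 * L * L ^ ?d) * (12 * L) ^ ?d \<le> (B * C * S * 3 ^ ?d) * (12 * L) ^ ?d"
      unfolding pow by (simp only: mult_ac)
    then have "t * c\<^sup>2 * L * L ^ ?d \<le> B * C * S * 3 ^ ?d"
      by (rule mult_right_le_imp_le) (use L in simp)
    then have "t * c\<^sup>2 * L * L ^ ?d / (B * C * 3 ^ ?d) \<le> S"
      using B C by (simp add: divide_le_eq mult_ac)
    then show ?thesis by (simp add: c2_def mult_ac)
  qed
  \<comment> \<open>Half of the lower bound for the mean of |u| over the cube of side 8L; the first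
    term of the tradeoff then takes up at most half of S.\<close>
  define s where "s = t * c2 * L / (2 * 8 ^ ?d)"
  have s: "0 < s" using t c2 L by (simp add: s_def)
  have Ss: "2 * (s * (8 * L) ^ ?d) \<le> S"
    using S by (simp add: s_def power_mult_distrib)
  have Up: "ennreal (s powr p * (8 * L) ^ ?d) \<le> (\<integral>\<^sup>+x. ennreal (\<bar>u x\<bar> powr p) \<partial>?M)"
  proof (cases "(\<integral>\<^sup>+x. ennreal (\<bar>u x\<bar> powr p) \<partial>?M)")
    case (real U)
    have um: "u \<in> borel_measurable ?M" by (rule square_integrable_measurable[OF u(2)])
    have "ennreal S = (\<integral>\<^sup>+x. ennreal (\<bar>u x\<bar> * indicator ?Q x) \<partial>?M)"
      unfolding S_def by (rule nn_integral_eq_integral[OF iu, symmetric]) simp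
    also have "\<dots> \<le> (\<integral>\<^sup>+x. ennreal s * indicator ?Q x + ennreal (s powr (1 - p)) * ennreal (\<bar>u x\<bar> powr p) \<partial>?M)"
    proof (rule nn_integral_mono)
      fix x
      show "ennreal (\<bar>u x\<bar> * indicator ?Q x) \<le> ennreal s * indicator ?Q x + ennreal (s powr (1 - p)) * ennreal (\<bar>u x\<bar> powr p)"
      proof (cases "x \<in> ?Q")
        case True
        have "ennreal \<bar>u x\<bar> \<le> ennreal (s + s powr (1 - p) * \<bar>u x\<bar> powr p)"
          by (intro ennreal_leI L1_le_Lp_tradeoff) (use s p in auto)
        also have "\<dots> = ennreal s + ennreal (s powr (1 - p)) * ennreal (\<bar>u x\<bar> powr p)"
          using s by (subst ennreal_plus) (auto simp: ennreal_mult')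
        finally show ?thesis using True by simp
      qed simp
    qed
    also have "\<dots> = ennreal s * (\<integral>\<^sup>+x. indicator ?Q x \<partial>?M) + ennreal (s powr (1 - p)) * ennreal U"
    proof -
      have "(\<lambda>x. indicator ?Q x :: ennreal) \<in> borel_measurable borel" by measurable
      then have "(\<lambda>x. indicator ?Q x :: ennreal) \<in> borel_measurable ?M" by (rule borel_measurable_lebesgue_onI)
      then show ?thesis using um unfolding real(2)[symmetric]
        by (subst nn_integral_add) (auto simp: nn_integral_cmult)
    qed
    also have "(\<integral>\<^sup>+x. indicator ?Q x \<partial>?M) \<le> ennreal ((8 * L) ^ ?d)"
    proof -
      have "(\<integral>\<^sup>+x. indicator ?Q x \<partial>?M) = (\<integral>\<^sup>+x. indicator ?Q x * indicator \<Omega> x \<partial>lebesgue)"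
        using \<Omega>l by (intro nn_integral_restrict_space) auto
      also have "\<dots> \<le> (\<integral>\<^sup>+x. indicator ?Q x \<partial>lebesgue)"
        by (intro nn_integral_mono) (auto simp: indicator_def)
      also have "\<dots> = ennreal ((8 * L) ^ ?d)" by (simp add: nn_integral_completion eQ)
      finally show ?thesis .
    qed
    finally have "ennreal S \<le> ennreal s * ennreal ((8 * L) ^ ?d) + ennreal (s powr (1 - p)) * ennreal U"
      by (simp add: add_right_mono mult_left_mono)
    also have "\<dots> = ennreal (s * (8 * L) ^ ?d + s powr (1 - p) * U)"
      using s real(1) L by (simp add: ennreal_mult'[symmetric] ennreal_plus[symmetric] del: ennreal_plus)
    finally have "S \<le> s * (8 * L) ^ ?d + s powr (1 - p) * U"
      using s L real(1) by (subst (asm) ennreal_le_iff) auto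
    then have "s * (8 * L) ^ ?d \<le> s powr (1 - p) * U" using Ss by linarith
    then have "s powr (p - 1) * (s * (8 * L) ^ ?d) \<le> s powr (p - 1) * (s powr (1 - p) * U)"
      by (rule mult_left_mono) simp
    also have "s powr (p - 1) * (s powr (1 - p) * U) = U"
      using s by (simp add: mult.assoc[symmetric] powr_add[symmetric])
    also have "s powr (p - 1) * (s * (8 * L) ^ ?d) = s powr p * (8 * L) ^ ?d"
      using s powr_mult_base[of s "p - 1"] by (simp add: mult_ac)
    finally show ?thesis unfolding real(2) by (rule ennreal_leI)
  qed simp
  define \<kappa> where "\<kappa> = c2 / (2 * 8 ^ ?d * B)"
  have \<kappa>: "0 < \<kappa>" using c2 B by (simp add: \<kappa>_def)
  \<comment> \<open>The normalisation read backwards: |r| \<le> B on a cube of volume (8L)^d bounds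
    t from below, and with it the volume factor disappears from the estimate of u.\<close>
  have "1 = t powr p * I" using tI by simp
  also have "\<dots> \<le> t powr p * (B powr p * (8 * L) ^ ?d)" by (rule mult_left_mono[OF IB]) simp
  finally have one: "1 \<le> t powr p * (B powr p * (8 * L) ^ ?d)" .
  have "s = (\<kappa> * L) * (t * B)" using B by (simp add: s_def \<kappa>_def)
  then have "s powr p = (\<kappa> * L) powr p * (t powr p * B powr p)"
    using \<kappa> L t B by (simp add: powr_mult)
  then have eq: "s powr p * (8 * L) ^ ?d = (\<kappa> * L) powr p * (t powr p * (B powr p * (8 * L) ^ ?d))"
    by (simp only: mult_ac)
  have le: "(\<kappa> * L) powr p * 1 \<le> (\<kappa> * L) powr p * (t powr p * (B powr p * (8 * L) ^ ?d))"
    by (rule mult_left_mono[OF one]) simp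
  have "(\<kappa> * L) powr p \<le> s powr p * (8 * L) ^ ?d" using le unfolding eq mult_1_right .
  then have "ennreal ((\<kappa> * L) powr p) \<le> (\<integral>\<^sup>+x. ennreal (norm (u x) powr p) \<partial>?M)"
    using Up order_trans[OF ennreal_leI] by simp
  then have "ennreal (\<kappa> * L) \<le> Lp_norm p \<Omega> u"
    using Lp_norm_ge_iff[OF p0, of "\<kappa> * L" \<Omega> u] \<kappa> L by simp
  from that[OF fp f2 f1 u(1)] this show ?thesis by (simp add: \<kappa>_def c2_def)
qed

text \<open>R is a bump times x_i, so that its i-th partial derivative is 1 on the plateau. This
  derivative integrates to 0 and so takes negative values too, which is why the test function of the
  lower bound contains it as a factor. In units of L, the plateau 3 holds every cell that meets the
  cube of half-side 1.\<close>

lemma linear_bump_exists: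
  obtains R :: "real^'n \<Rightarrow> real" and i B where "test_function UNIV R" "0 < B" "\<forall>x. \<bar>R x\<bar> \<le> B"
    "\<forall>x j. 4 < \<bar>x $ j\<bar> \<longrightarrow> R x = 0 \<and> gradient R x $ i = 0"
    "test_function UNIV (\<lambda>x. gradient R x $ i)"
    "\<forall>x. \<bar>gradient R x $ i\<bar> \<le> B" "\<forall>x. norm (gradient (\<lambda>x. gradient R x $ i) x) \<le> B"
    "\<forall>x. (\<forall>j. \<bar>x $ j\<bar> < 3) \<longrightarrow> gradient R x $ i = 1"
proof -
  obtain i :: 'n where True by simp
  have "0 < (3::real)" "(3::real) < 4" by simp_all
  then obtain \<beta> :: "real^'n \<Rightarrow> real" where \<beta>: "\<And>k. Ck k \<beta>" "\<And>x. 0 \<le> \<beta> x \<and> \<beta> x \<le> 1"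
    "\<And>x. (\<And>i. \<bar>x $ i\<bar> \<le> 3) \<Longrightarrow> \<beta> x = 1" "\<And>x i. 4 \<le> \<bar>x $ i\<bar> \<Longrightarrow> \<beta> x = 0" "test_function UNIV \<beta>"
    using test_function_box_bump[of 3 4] by metis
  define R where "R x = \<beta> x * x $ i" for x
  have R: "test_function UNIV R" unfolding R_def by (rule test_function_mult[OF \<beta>(5) Ck_nth])
  have m: "test_function UNIV (\<lambda>x. gradient R x $ i)" by (rule test_function_gradient_nth[OF R])
  obtain B1 where B1: "B1 > 0" "\<And>x. \<bar>R x\<bar> \<le> B1" using test_function_bounded[OF R] by metis
  obtain B2 where B2: "B2 > 0" "\<And>x. \<bar>gradient R x $ i\<bar> \<le> B2" "\<And>x. norm (gradient (\<lambda>x. gradient R x $ i) x) \<le> B2"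
    using test_function_bounded[OF m] by metis
  have z: "gradient R x = 0" if "4 < \<bar>x $ j\<bar>" for x j
    by (rule gradient_eq_0_locally_const[OF open_coord_greater[of 4 j], where c=0])
       (use that \<beta>(4)[where i=j] in \<open>auto simp: R_def intro: less_imp_le\<close>)
  have one: "gradient R x $ i = 1" if x: "\<forall>j. \<bar>x $ j\<bar> < 3" for x
  proof -
    have "((\<lambda>x. x $ i) has_derivative (\<lambda>h. h $ i)) (at x)"
      by (rule bounded_linear_imp_has_derivative[OF bounded_linear_vec_nth])
    then have "(R has_derivative (\<lambda>h. h $ i)) (at x)"
    proof (rule has_derivative_transform_within_open[OF _ open_coord_less[of 3]])
      show "x \<in> {x. \<forall>i. \<bar>x $ i\<bar> < 3}" using x by simp
      show "y $ i = R y" if "y \<in> {x. \<forall>i. \<bar>x $ i\<bar> < 3}" for y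
        using \<beta>(3)[of y] that by (simp add: R_def less_imp_le)
    qed
    then have "(R has_derivative (\<lambda>h. axis i 1 \<bullet> h)) (at x)" by (simp add: inner_axis')
    from has_derivative_imp_gradient[OF this] show ?thesis by simp
  qed
  show ?thesis
  proof (rule that[of R "max B1 B2" i]; (intro allI impI conjI)?)
    show "R x = 0" if "4 < \<bar>x $ j\<bar>" for x j using \<beta>(4)[where i=j and x=x] that by (simp add: R_def)
  qed (use R m B1 B2 z one in \<open>auto simp: le_max_iff_disj\<close>)
qed

section \<open>Assembling the two bounds\<close>

text \<open>Yields \<epsilon> \<le> 2L: a cell is never larger than a fixed multiple of the length
  on which f varies, and the comparison of cells with cubes in the lower bound rests on
  this.\<close>

lemma scale_factor_lower:
  assumes "2 \<le> d" "0 < \<eta>" "\<eta> \<le> 1"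
  shows "1/2 \<le> scale_factor d \<eta>"
proof -
  have "(1/2)\<^sup>2 \<le> (scale_factor d \<eta>)\<^sup>2"
  proof (cases "d = 2")
    case True
    have "2/3 \<le> ln (2::real)" by (rule ln2_ge_two_thirds)
    moreover have "ln \<eta> \<le> 0" using assms by simp
    ultimately have "1/4 \<le> ln 2 - ln \<eta>" by linarith
    then show ?thesis unfolding scale_factor_sq[OF assms] using True by (simp add: power2_eq_square)
  next
    case False
    have "\<eta> ^ (d - 2) \<le> 1" "0 < \<eta> ^ (d - 2)" using assms by (auto intro: power_le_one)
    then have "1 \<le> 1 / \<eta> ^ (d - 2)" by simp
    then show ?thesis unfolding scale_factor_sq[OF assms] using False by (simp add: power2_eq_square)
  qed
  moreover have "0 \<le> scale_factor d \<eta>" by (simp add: scale_factor_def)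
  ultimately show ?thesis by (rule power2_le_imp_le)
qed

lemma C_sup_upper_bound:
  fixes T :: "(real^'n) set"
  assumes dom: "poincare_domain (perforated_domain T \<epsilon> \<eta>) (P * L\<^sup>2)" and p: "2 \<le> p" and P: "0 < P" and L: "0 < L"
  shows "C_sup T p \<epsilon> \<eta> \<le>
    ennreal ((2 powr p * (2 * (2 powr (p + 1)) powr ((p - 2) / 2))) powr (1 / p) * sqrt P * L)"
    (is "_ \<le> ennreal ?c")
  unfolding C_sup_def Let_def
proof (rule Sup_least, clarify)
  let ?\<Omega> = "perforated_domain T \<epsilon> \<eta>"
  fix u :: "real^'n \<Rightarrow> real" and f :: "real^'n \<Rightarrow> real^'n"
  assume f: "f \<in> Lp_space p ?\<Omega>" "f \<in> Lp_space 2 ?\<Omega>" "Lp_norm p ?\<Omega> f = 1" and u: "weak_solution ?\<Omega> f u"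
  let ?g = "2 powr p * (2 * (2 powr (p + 1)) powr ((p - 2) / 2))"
  have p0: "0 < p" using p by simp
  have nn: "(\<integral>\<^sup>+x. ennreal (norm (f x) powr p) \<partial>lebesgue_on ?\<Omega>) = ennreal 1"
    using Lp_norm_eq_iff[OF p0, of 1 ?\<Omega> f] f(3) by simp
  have fm: "(\<lambda>x. norm (f x) powr p) \<in> borel_measurable (lebesgue_on ?\<Omega>)"
    using f(1) by (auto simp: Lp_space_def)
  have int: "integrable (lebesgue_on ?\<Omega>) (\<lambda>x. norm (f x) powr p)"
    by (rule integrableI_nn_integral_finite[OF fm _ nn]) simp
  have one: "(\<integral>x. norm (f x) powr p \<partial>lebesgue_on ?\<Omega>) = 1"
    using nn_integral_eq_integral[OF int] nn by simp
  have "(\<integral>\<^sup>+x. ennreal (norm (u x) powr p) \<partial>lebesgue_on ?\<Omega>) \<le>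
     ennreal (2 powr p * (2 * ((2 powr (p + 1)) powr ((p - 2) / 2) * (P * L\<^sup>2) powr (p / 2) * 1)))"
    using weak_solution_Lp_estimate[OF dom p u _ int] f(2) one by (simp add: Lp_space_2_iff)
  also have "2 powr p * (2 * ((2 powr (p + 1)) powr ((p - 2) / 2) * (P * L\<^sup>2) powr (p / 2) * 1)) = ?c powr p"
  proof -
    \<comment> \<open>The p-th root of (P L^2)^(p/2) is sqrt P times L, so the bound is linear in
      L.\<close>
    have "P * L\<^sup>2 = (sqrt P * L) powr 2" using P L by (simp add: powr_numeral power_mult_distrib)
    then have "(P * L\<^sup>2) powr (p / 2) = (sqrt P * L) powr (2 * (p / 2))" by (simp only: powr_powr)
    then have e1: "(P * L\<^sup>2) powr (p / 2) = (sqrt P * L) powr p" by simp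
    have "(?g powr (1 / p)) powr p = ?g" using p0 by (simp add: powr_powr)
    then have "?c powr p = ?g * (sqrt P * L) powr p"
      using P L by (simp only: mult.assoc) (subst powr_mult, auto)
    then show ?thesis unfolding e1 by (simp only: mult_1_right mult.assoc)
  qed
  finally show "Lp_norm p ?\<Omega> u \<le> ennreal ?c"
    using L P by (subst Lp_norm_le_iff[OF p0]) auto
qed

text \<open>\<open>scale_factor\<close> treats both dimension ranges at once. The constants are
  settled before \<epsilon> and \<eta> are fixed: the ball and the cube of the hole, the Poincare
  constant P, the cutoff energy E and the profile R with its bound B.\<close>

theorem C_sup_two_sided:
  fixes T :: "(real^'n) set"
  assumes d: "CARD('n) \<ge> 2" and p: "2 \<le> p" and T: "admissible_hole T"
  obtains c C where "0 < c" "0 < C"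
    "\<forall>\<epsilon> \<eta>. 0 < \<epsilon> \<and> 0 < \<eta> \<and> \<eta> \<le> 1 \<longrightarrow>
      ennreal (c * (\<epsilon> * scale_factor CARD('n) \<eta>)) \<le> C_sup T p \<epsilon> \<eta> \<and>
      C_sup T p \<epsilon> \<eta> \<le> ennreal (C * (\<epsilon> * scale_factor CARD('n) \<eta>))"
proof -
  let ?d = "CARD('n)"
  obtain c\<^sub>0 where c: "0 < c\<^sub>0" "c\<^sub>0 \<le> 1/8" and compT: "compact T" and ball: "ball 0 c\<^sub>0 \<subseteq> T"
    and cube: "\<forall>x\<in>T. \<forall>i. \<bar>x $ i\<bar> \<le> 1/2 - c\<^sub>0"
    by (rule admissible_hole_in_cube[OF T])
  obtain P where P: "P > 0" and dom: "\<forall>\<epsilon> \<eta>. 0 < \<epsilon> \<and> 0 < \<eta> \<and> \<eta> \<le> 1 \<and> scale_factor ?d \<eta> \<noteq> 0 \<longrightarrow>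
    poincare_domain (perforated_domain T \<epsilon> \<eta>) (P * (\<epsilon> * scale_factor ?d \<eta>)\<^sup>2)"
    by (rule poincare_perforated_domain[OF d compT c(1) ball])
  obtain E where E: "E > 0" and cutoff: "\<forall>\<eta>. 0 < \<eta> \<and> \<eta> \<le> 1 \<longrightarrow>
      (\<exists>W :: real^'n \<Rightarrow> real. (\<forall>k. Ck k W) \<and> (\<forall>y. 0 \<le> W y \<and> W y \<le> 1) \<and>
      (\<forall>y. (\<forall>i. \<bar>y $ i\<bar> \<le> \<eta> * (1/2 - c\<^sub>0/2)) \<longrightarrow> W y = 1) \<and>
      (\<forall>y. (\<exists>i. 1/2 - c\<^sub>0/4 \<le> \<bar>y $ i\<bar>) \<longrightarrow> W y = 0) \<and>
      (\<integral>\<^sup>+y. ennreal ((norm (gradient W y))\<^sup>2) \<partial>lborel) \<le> ennreal (E / (scale_factor ?d \<eta>)\<^sup>2))"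
    by (rule hole_cutoff[OF d c])
  obtain R :: "real^'n \<Rightarrow> real" and i B where R: "test_function UNIV R" "0 < B" "\<forall>x. \<bar>R x\<bar> \<le> B"
    "\<forall>x j. 4 < \<bar>x $ j\<bar> \<longrightarrow> R x = 0 \<and> gradient R x $ i = 0"
    "test_function UNIV (\<lambda>x. gradient R x $ i)"
    "\<forall>x. \<bar>gradient R x $ i\<bar> \<le> B" "\<forall>x. norm (gradient (\<lambda>x. gradient R x $ i) x) \<le> B"
    "\<forall>x. (\<forall>j. \<bar>x $ j\<bar> < 3) \<longrightarrow> gradient R x $ i = 1"
    by (rule linear_bump_exists)
  define C where "C = (2 powr p * (2 * (2 powr (p + 1)) powr ((p - 2) / 2))) powr (1 / p) * sqrt P"
  \<comment> \<open>The energy constant of v as produced by \<open>test_function_perforated\<close>;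
    \<open>k\<close> is then the constant of \<open>weak_solution_lower_bound\<close> with mass
    fraction \<open>c\<^sub>0 / 4\<close>.\<close>
  define D where "D = 2 * B\<^sup>2 * (E + 1)"
  define k where "k = (c\<^sub>0 / 4)\<^sup>2 / (B * D * 3 ^ ?d) / (2 * 8 ^ ?d * B)"
  have D: "0 < D" using R(2) E by (simp add: D_def)
  have k: "0 < k" using c R(2) D by (simp add: k_def)
  have C: "0 < C" using P by (simp add: C_def)
  show ?thesis
  proof (rule that[OF k C]; intro allI impI)
    fix \<epsilon> \<eta> :: real assume H: "0 < \<epsilon> \<and> 0 < \<eta> \<and> \<eta> \<le> 1"
    then have \<epsilon>: "0 < \<epsilon>" and \<eta>: "0 < \<eta>" "\<eta> \<le> 1" by auto
    let ?\<Omega> = "perforated_domain T \<epsilon> \<eta>"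
    define L where "L = \<epsilon> * scale_factor ?d \<eta>"
    have sf: "1/2 \<le> scale_factor ?d \<eta>" by (rule scale_factor_lower[OF d \<eta>])
    have L: "0 < L" "\<epsilon> \<le> 2 * L"
    proof -
      show "0 < L" using sf \<epsilon> by (simp add: L_def)
      have "\<epsilon> * (1/2) \<le> L" unfolding L_def using sf \<epsilon> by (intro mult_left_mono) auto
      then show "\<epsilon> \<le> 2 * L" by simp
    qed
    have dom': "poincare_domain ?\<Omega> (P * L\<^sup>2)" using dom H sf unfolding L_def by auto
    have upper: "C_sup T p \<epsilon> \<eta> \<le> ennreal (C * L)"
      unfolding C_def by (rule C_sup_upper_bound[OF dom' p P L(1)])
    obtain W :: "real^'n \<Rightarrow> real" where W: "\<forall>k. Ck k W" "\<forall>y. 0 \<le> W y \<and> W y \<le> 1"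
      "\<forall>y. (\<forall>i. \<bar>y $ i\<bar> \<le> \<eta> * (1/2 - c\<^sub>0/2)) \<longrightarrow> W y = 1"
      "\<forall>y. (\<exists>i. 1/2 - c\<^sub>0/4 \<le> \<bar>y $ i\<bar>) \<longrightarrow> W y = 0"
      and Wen: "(\<integral>\<^sup>+y. ennreal ((norm (gradient W y))\<^sup>2) \<partial>lborel) \<le> ennreal (E / (scale_factor ?d \<eta>)\<^sup>2)"
      using cutoff[THEN spec, THEN mp, OF conjI[OF \<eta>]] by (elim exE conjE)
    have "E / (scale_factor ?d \<eta>)\<^sup>2 = E * (\<epsilon> / L)\<^sup>2" using \<epsilon> by (simp add: L_def power_divide)
    with Wen have Wen': "(\<integral>\<^sup>+y. ennreal ((norm (gradient W y))\<^sup>2) \<partial>lborel) \<le> ennreal (E * (\<epsilon> / L)\<^sup>2)" by simp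
    have Rz: "gradient R x $ i = 0" if "4 < \<bar>x $ j\<bar>" for x j using R(4) that by blast
    have W0: "W y = 0" if "1/2 - c\<^sub>0/4 \<le> \<bar>y $ j\<bar>" for y j using W(4) that by blast
    obtain v where v: "test_function ?\<Omega> v"
      and ven: "(\<integral>\<^sup>+x. ennreal ((norm (gradient v x))\<^sup>2) \<partial>lborel) \<le> ennreal (2 * B\<^sup>2 * (E + 1) / L\<^sup>2 * (12 * L) ^ ?d)"
      and nonneg: "\<forall>x. 0 \<le> v x * gradient R ((1 / L) *\<^sub>R x) $ i"
      and mass: "ennreal (c\<^sub>0 / 4 * (2 * L) ^ ?d) \<le> (\<integral>\<^sup>+x. ennreal (v x * gradient R ((1 / L) *\<^sub>R x) $ i) \<partial>lborel)"
      by (rule test_function_perforated[where m="\<lambda>x. gradient R x $ i",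
            OF R(5) R(6)[rule_format] R(7)[rule_format] Rz R(8)[THEN spec, THEN mp] c cube
              W(1)[rule_format] W(2)[rule_format] W(3)[THEN spec, THEN mp] W0 Wen' less_imp_le[OF E] \<epsilon> \<eta> L])
    have c4: "0 < c\<^sub>0 / 4" using c by simp
    obtain f u where f: "f \<in> Lp_space p ?\<Omega>" "f \<in> Lp_space 2 ?\<Omega>" "Lp_norm p ?\<Omega> f = 1"
      and u: "weak_solution ?\<Omega> f u"
      and low: "ennreal ((c\<^sub>0 / 4)\<^sup>2 / (B * D * 3 ^ ?d) / (2 * 8 ^ ?d * B) * L) \<le> Lp_norm p ?\<Omega> u"
    proof (rule weak_solution_lower_bound[OF dom' p L(1) R(1) _ _ R(2) _ _ v c4 D])
      show "(\<integral>\<^sup>+x. ennreal ((norm (gradient v x))\<^sup>2) \<partial>lborel) \<le> ennreal (D / L\<^sup>2 * (12 * L) ^ ?d)"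
        using ven by (simp only: D_def)
      show "ennreal (c\<^sub>0 / 4 * (2 * L) ^ ?d) \<le> (\<integral>\<^sup>+x. ennreal (v x * gradient R ((1 / L) *\<^sub>R x) $ i) \<partial>lborel)"
        by (rule mass)
    qed (use R nonneg in blast)+
    have "ennreal (k * L) \<le> Lp_norm p ?\<Omega> u" using low by (simp only: k_def)
    also have "\<dots> \<le> C_sup T p \<epsilon> \<eta>"
      unfolding C_sup_def Let_def by (rule Sup_upper) (use f u in blast)
    finally show "ennreal (k * (\<epsilon> * scale_factor ?d \<eta>)) \<le> C_sup T p \<epsilon> \<eta> \<and>
      C_sup T p \<epsilon> \<eta> \<le> ennreal (C * (\<epsilon> * scale_factor ?d \<eta>))"
      using upper by (simp only: L_def)
  qed
qed

theorem theorem4p6: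
  fixes T :: "(real^'n) set" and p :: real
  assumes "CARD('n) \<ge> 2" and "2 \<le> p" and "admissible_hole T"
  shows "(CARD('n) \<ge> 3 \<longrightarrow>
           (\<exists>c C. 0 < c \<and> 0 < C \<and>
             (\<forall>\<epsilon> \<eta>. 0 < \<epsilon> \<and> \<epsilon> \<le> 1 \<and> 0 < \<eta> \<and> \<eta> \<le> 1 \<longrightarrow>
               ennreal (c * \<epsilon> * \<eta> powr ((2 - real CARD('n)) / 2)) \<le> C_sup T p \<epsilon> \<eta> \<and>
               C_sup T p \<epsilon> \<eta> \<le> ennreal (C * \<epsilon> * \<eta> powr ((2 - real CARD('n)) / 2))))) \<and>
         (CARD('n) = 2 \<longrightarrow>
           (\<exists>c C. 0 < c \<and> 0 < C \<and>
             (\<forall>\<epsilon> \<eta>. 0 < \<epsilon> \<and> \<epsilon> \<le> 1 \<and> 0 < \<eta> \<and> \<eta> \<le> 1 \<longrightarrow>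
               ennreal (c * \<epsilon> * \<bar>ln (\<eta> / 2)\<bar> powr (1 / 2)) \<le> C_sup T p \<epsilon> \<eta> \<and>
               C_sup T p \<epsilon> \<eta> \<le> ennreal (C * \<epsilon> * \<bar>ln (\<eta> / 2)\<bar> powr (1 / 2)))))"
proof -
  obtain c C where "0 < c" "0 < C" and bounds: "\<forall>\<epsilon> \<eta>. 0 < \<epsilon> \<and> 0 < \<eta> \<and> \<eta> \<le> 1 \<longrightarrow>
      ennreal (c * (\<epsilon> * scale_factor CARD('n) \<eta>)) \<le> C_sup T p \<epsilon> \<eta> \<and>
      C_sup T p \<epsilon> \<eta> \<le> ennreal (C * (\<epsilon> * scale_factor CARD('n) \<eta>))"
    by (rule C_sup_two_sided[OF assms])
  show ?thesis
  proof (intro conjI impI)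
    assume "CARD('n) \<ge> 3"
    then have "scale_factor CARD('n) \<eta> = \<eta> powr ((2 - real CARD('n)) / 2)" for \<eta>
      by (simp add: scale_factor_def)
    with bounds \<open>0 < c\<close> \<open>0 < C\<close> show "\<exists>c C. 0 < c \<and> 0 < C \<and>
             (\<forall>\<epsilon> \<eta>. 0 < \<epsilon> \<and> \<epsilon> \<le> 1 \<and> 0 < \<eta> \<and> \<eta> \<le> 1 \<longrightarrow>
               ennreal (c * \<epsilon> * \<eta> powr ((2 - real CARD('n)) / 2)) \<le> C_sup T p \<epsilon> \<eta> \<and>
               C_sup T p \<epsilon> \<eta> \<le> ennreal (C * \<epsilon> * \<eta> powr ((2 - real CARD('n)) / 2)))"
      by (intro exI[of _ c] exI[of _ C]) (simp add: mult.assoc)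
  next
    assume "CARD('n) = 2"
    then have "scale_factor CARD('n) \<eta> = \<bar>ln (\<eta> / 2)\<bar> powr (1 / 2)" for \<eta>
      by (simp add: scale_factor_def)
    with bounds \<open>0 < c\<close> \<open>0 < C\<close> show "\<exists>c C. 0 < c \<and> 0 < C \<and>
             (\<forall>\<epsilon> \<eta>. 0 < \<epsilon> \<and> \<epsilon> \<le> 1 \<and> 0 < \<eta> \<and> \<eta> \<le> 1 \<longrightarrow>
               ennreal (c * \<epsilon> * \<bar>ln (\<eta> / 2)\<bar> powr (1 / 2)) \<le> C_sup T p \<epsilon> \<eta> \<and>
               C_sup T p \<epsilon> \<eta> \<le> ennreal (C * \<epsilon> * \<bar>ln (\<eta> / 2)\<bar> powr (1 / 2)))"
      by (intro exI[of _ c] exI[of _ C]) (simp add: mult.assoc)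
  qed
qed

end
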